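(* Let $\boldsymbol{\mu}$ and $\boldsymbol{\nu}$ be $k$-tuples of partitions, each partition having infinitely many parts of which only finitely many are nonzero. Fix positive integers $n,m,p,q$ and variables $X_n=(x_1,\dots,x_n)$, $Y_m=(y_1,\dots,y_m)$, $W_p=(w_1,\dots,w_p)$, $Z_q=(z_1,\dots,z_q)$. Then, as formal power series, $$\sum_{\boldsymbol{\lambda}} t^{d(\boldsymbol{\mu},\boldsymbol{\lambda})}\,\mathcal{L}^S_{\boldsymbol{\nu}/\boldsymbol{\lambda}}(X_n;Y_m;t)\,\mathcal{L}^S_{\boldsymbol{\mu}/\boldsymbol{\lambda}}(W_p;Z_q;t)=\Omega\cdot\sum_{\boldsymbol{\lambda}} t^{d(\boldsymbol{\lambda},\boldsymbol{\nu})}\,\mathcal{L}^S_{\boldsymbol{\lambda}/\boldsymbol{\mu}}(X_n;Y_m;t)\,\mathcal{L}^S_{\boldsymbol{\lambda}/\boldsymbol{\nu}}(W_p;Z_q;t),$$ where both sums run over all $k$-tuples of partitions $\boldsymbol{\lambda}$ and $$\Omega=\prod_{l=0}^{k-1}\frac{\prod_{i=1}^n\prod_{\alpha=1}^p(1-x_iw_\alpha t^l)\;\prod_{j=1}^m\prod_{\beta=1}^q(1-y_jz_\beta t^l)}{\prod_{j=1}^m\prod_{\alpha=1}^p(1+y_jw_\alpha t^l)\;\prod_{i=1}^n\prod_{\beta=1}^q(1+x_iz_\beta t^l)}.$$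
   Context: Fix an integer $k\ge1$ (colours $1,\dots,k$) and an indeterminate $t$. For $\mathbf I=(I_1,\dots,I_k)\in\{0,1\}^k$ let $|\mathbf I|=\sum_cI_c$, and for $\mathbf I,\mathbf J\in\mathbb Z^k$ let $\varphi(\mathbf I,\mathbf J)=\sum_{1\le c<d\le k}I_cJ_d$. A vertex is a unit square whose bottom, left, top, right edges carry labels $\mathbf I,\mathbf J,\mathbf K,\mathbf L\in\{0,1\}^k$; $I_c=1$ means a path of colour $c$ uses that edge (paths move up and right). The white weight with parameter $x$ is $W_x(\mathbf I,\mathbf J,\mathbf K,\mathbf L)=\mathbf 1_{\mathbf I+\mathbf J=\mathbf K+\mathbf L}\prod_{c}\mathbf 1_{I_c+J_c\neq2}\,x^{|\mathbf L|}t^{\varphi(\mathbf L,\mathbf I+\mathbf J)}$, and the purple weight is $P_x(\mathbf I,\mathbf J,\mathbf K,\mathbf L)=\mathbf 1_{\mathbf I+\mathbf J=\mathbf K+\mathbf L}\prod_{c}\mathbf 1_{K_c\ge J_c}\,x^{|\mathbf L|}t^{\varphi(\mathbf L,\mathbf K-\mathbf J)}$. For $k$-tuples of partitions $\boldsymbol\lambda=(\lambda^{(1)},\dots,\lambda^{(k)})$, $\boldsymbol\mu=(\mu^{(1)},\dots,\mu^{(k)})$, each regarded as having exactly $\ell$ parts (padding with zeros), where $\ell$ is at least the number of nonzero parts of every partition involved, and variables $X_n,Y_m$, consider the lattice with $n+m$ rows and columns indexed by the integers $-\ell,\dots,N$ ($N$ at least every part of every partition involved): rows $1,\dots,n$ from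 the bottom are white with parameters $x_1,\dots,x_n$, rows $n+1,\dots,n+m$ are purple with parameters $y_1,\dots,y_m$. The bottom boundary edge of column $c$ carries colour $a$ iff $c=\mu^{(a)}_j-j$ for some $1\le j\le\ell$; the top boundary edge of column $c$ carries colour $a$ iff $c=\lambda^{(a)}_j-j$ for some $j$; all left and right boundary edges are empty. A configuration assigns labels in $\{0,1\}^k$ to all internal edges; its weight is the product of the vertex weights (white or purple, with the row's parameter). $\mathcal L^S_{\boldsymbol\lambda/\boldsymbol\mu}(X_n;Y_m;t)$ is the sum of the weights of all configurations (it does not depend on $\ell,N$ once they are large enough). For tuples of partitions with infinitely many parts, finitely many nonzero, use any sufficiently large $\ell$. For $k$-tuples $\boldsymbol\alpha,\boldsymbol\beta$ and $L$ at least the number of nonzero parts of all their components, let $N_L(\boldsymbol\alpha)=\sum_{1\le a<b\le k}\#\{(i,j)\in\{1,\dots,L\}^2:\alpha^{(a)}_j-j>\alpha^{(b)}_i-i\}$ and $d(\boldsymbol\alpha,\boldsymbol\beta)=N_L(\boldsymbol\beta)-N_L(\boldsymbol\alpha)$ (independent of $L$). *)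

theory Defs
  imports Complex_Main "HOL-Library.Poly_Mapping" "HOL-Library.FuncSet"
begin

section \<open>Formal power series in arbitrarily many variables\<close>

text \<open>
  A series with variables from \<^typ>\<open>'v\<close> and coefficients in \<^typ>\<open>'a\<close> is given by its coefficients;
  monomials are the finitely supported exponent vectors \<^typ>\<open>'v \<Rightarrow>\<^sub>0 nat\<close>.
\<close>

typedef ('v, 'a) mfps = "UNIV :: (('v \<Rightarrow>\<^sub>0 nat) \<Rightarrow> 'a) set"
  morphisms mfps_coeff Abs_mfps
  by simp

lemma mfps_coeff_Abs [simp]: "mfps_coeff (Abs_mfps f) = f"
  by (simp add: Abs_mfps_inverse)

lemma mfps_eqI: "(\<And>m. mfps_coeff f m = mfps_coeff g m) \<Longrightarrow> f = g"
  using mfps_coeff_inject[of f g] by (simp add: fun_eq_iff)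

definition splits :: "('v \<Rightarrow>\<^sub>0 nat) \<Rightarrow> (('v \<Rightarrow>\<^sub>0 nat) \<times> ('v \<Rightarrow>\<^sub>0 nat)) set" where
  "splits m = {(a, b). a + b = m}"

lemma finite_splits [simp]: "finite (splits m)"
proof -
  let ?B = "{a. \<forall>v. Poly_Mapping.lookup a v \<le> Poly_Mapping.lookup m v}"
  let ?r = "\<lambda>a :: 'a \<Rightarrow>\<^sub>0 nat. restrict (Poly_Mapping.lookup a) (Poly_Mapping.keys m)"
  have "?r ` ?B \<subseteq> PiE (Poly_Mapping.keys m) (\<lambda>v. {..Poly_Mapping.lookup m v})"
    by auto
  then have 1: "finite (?r ` ?B)"
    by (rule finite_subset) (rule finite_PiE[OF finite_keys finite_atMost])
  have "inj_on ?r ?B"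
  proof (rule inj_onI)
    fix a b assume a: "a \<in> ?B" and b: "b \<in> ?B" and e: "?r a = ?r b"
    show "a = b"
    proof (rule poly_mapping_eqI)
      fix v
      show "Poly_Mapping.lookup a v = Poly_Mapping.lookup b v"
      proof (cases "v \<in> Poly_Mapping.keys m")
        case True
        with fun_cong[OF e, of v] show ?thesis by simp
      next
        case False
        then have "Poly_Mapping.lookup m v = 0" by (simp add: in_keys_iff)
        with a b show ?thesis by (metis (mono_tags, lifting) le_zero_eq mem_Collect_eq)
      qed
    qed
  qed
  with 1 have 2: "finite ?B" by (rule finite_imageD)
  have "splits m \<subseteq> ?B \<times> ?B"
    by (auto simp: splits_def lookup_add)
  then show ?thesis using 2 by (meson finite_SigmaI finite_subset)
qed

instantiation mfps :: (type, comm_ring_1) comm_ring_1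
begin

definition "0 = Abs_mfps (\<lambda>_. 0)"
definition "1 = Abs_mfps (\<lambda>m. if m = 0 then 1 else 0)"
definition "f + g = Abs_mfps (\<lambda>m. mfps_coeff f m + mfps_coeff g m)"
definition "f - g = Abs_mfps (\<lambda>m. mfps_coeff f m - mfps_coeff g m)"
definition "- f = Abs_mfps (\<lambda>m. - mfps_coeff f m)"
definition "f * g = Abs_mfps (\<lambda>m. \<Sum>(a, b)\<in>splits m. mfps_coeff f a * mfps_coeff g b)"

instance
proof
  fix f g h :: "('a, 'b) mfps"
  show "f + g + h = f + (g + h)" "f + g = g + f" "0 + f = f" "- f + f = 0" "f - g = f + - g"
    by (auto intro!: mfps_eqI
        simp: plus_mfps_def minus_mfps_def uminus_mfps_def zero_mfps_def algebra_simps)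
  show "(0 :: ('a, 'b) mfps) \<noteq> 1"
  proof
    assume "(0 :: ('a, 'b) mfps) = 1"
    then have "mfps_coeff (0 :: ('a, 'b) mfps) 0 = mfps_coeff 1 0" by simp
    then show False by (simp add: zero_mfps_def one_mfps_def)
  qed
  show "(f + g) * h = f * h + g * h"
    by (auto intro!: mfps_eqI
        simp: plus_mfps_def times_mfps_def case_prod_unfold distrib_right sum.distrib)
  show "f * g = g * f"
  proof (rule mfps_eqI)
    fix m
    show "mfps_coeff (f * g) m = mfps_coeff (g * f) m"
      unfolding times_mfps_def mfps_coeff_Abs
      by (rule sum.reindex_bij_witness[of _ prod.swap prod.swap])
         (auto simp only: splits_def split_paired_all case_prod_conv
           mem_Collect_eq swap_simp add.commute mult.commute)
  qed
  show "1 * f = f"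
  proof (rule mfps_eqI)
    fix m
    have "mfps_coeff (1 * f) m =
        (\<Sum>p\<in>splits m. if p = (0, m) then mfps_coeff f m else 0)"
      unfolding times_mfps_def one_mfps_def mfps_coeff_Abs
    proof (rule sum.cong)
      fix p assume "p \<in> splits m"
      then have p: "p = (fst p, snd p)" "fst p + snd p = m"
        by (auto simp: splits_def)
      show "(case p of (a, b) \<Rightarrow> (if a = 0 then 1 else 0) * mfps_coeff f b) =
          (if p = (0, m) then mfps_coeff f m else 0)"
      proof (cases "fst p = 0")
        case True
        with p have "p = (0, m)" by (metis add_0)
        then show ?thesis by simp
      next
        case False
        then have "p \<noteq> (0, m)" by auto
        with False show ?thesis by (simp add: case_prod_unfold)
      qed
    qed simp
    also have "\<dots> = mfps_coeff f m"
      by (subst sum.delta) (simp_all, simp add: splits_def)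
    finally show "mfps_coeff (1 * f) m = mfps_coeff f m" .
  qed
  show "f * g * h = f * (g * h)"
  proof (rule mfps_eqI)
    fix m
    let ?s = "\<lambda>a b c. mfps_coeff f a * mfps_coeff g b * mfps_coeff h c"
    have "mfps_coeff (f * g * h) m =
        (\<Sum>p\<in>splits m. \<Sum>q\<in>splits (fst p). ?s (fst q) (snd q) (snd p))"
      unfolding times_mfps_def mfps_coeff_Abs case_prod_unfold sum_distrib_right ..
    also have "\<dots> = (\<Sum>(p, q)\<in>Sigma (splits m) (\<lambda>p. splits (fst p)).
          ?s (fst q) (snd q) (snd p))"
      by (rule sum.Sigma) (intro finite_splits ballI)+
    also have "\<dots> = (\<Sum>(p, q)\<in>Sigma (splits m) (\<lambda>p. splits (snd p)).
          ?s (fst p) (fst q) (snd q))"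
      by (rule sum.reindex_bij_witness[of _
            "\<lambda>(p, q). ((fst p + fst q, snd q), (fst p, fst q))"
            "\<lambda>(p, q). ((fst q, snd q + snd p), (snd q, snd p))"])
         (clarsimp simp: splits_def; simp add: add.assoc)+
    also have "\<dots> = (\<Sum>p\<in>splits m. \<Sum>q\<in>splits (snd p). ?s (fst p) (fst q) (snd q))"
      by (rule sum.Sigma[symmetric]) (intro finite_splits ballI)+
    also have "\<dots> = mfps_coeff (f * (g * h)) m"
      unfolding times_mfps_def mfps_coeff_Abs case_prod_unfold sum_distrib_left mult.assoc ..
    finally show "mfps_coeff (f * g * h) m = mfps_coeff (f * (g * h)) m" .
  qed
qed

end

instantiation mfps :: (type, comm_ring_1) inverse
begin

definition "inverse (f :: ('a, 'b) mfps) = (if f dvd 1 then THE g. f * g = 1 else 0)"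
definition "(f :: ('a, 'b) mfps) div g = f * inverse g"

instance ..

end

lemma mfps_inverse_unique:
  fixes f g :: "('v, 'a :: comm_ring_1) mfps"
  assumes "f * g = 1"
  shows "inverse f = g"
proof -
  have "(THE g. f * g = 1) = g"
  proof (rule the_equality)
    fix h assume h: "f * h = 1"
    have "h = f * g * h" using assms by simp
    also have "\<dots> = g * (f * h)" by (simp only: mult.assoc mult.left_commute)
    finally show "h = g" using h by simp
  qed (fact assms)
  moreover have "f dvd 1" by (rule dvdI[OF assms[symmetric]])
  ultimately show ?thesis by (simp add: inverse_mfps_def)
qed

definition mfps_const :: "'a \<Rightarrow> ('v, 'a :: comm_ring_1) mfps" where
  "mfps_const c = Abs_mfps (\<lambda>m. if m = 0 then c else 0)"

definition mfps_var :: "'v \<Rightarrow> ('v, 'a :: comm_ring_1) mfps" where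
  "mfps_var v = Abs_mfps (\<lambda>m. if m = Poly_Mapping.single v 1 then 1 else 0)"

text \<open>
  Infinite sums of series are taken coefficientwise; \<^term>\<open>mfps_sum F A\<close> is meaningful only if
  every monomial has a nonzero coefficient in just finitely many of the summands.
\<close>

definition mfps_summable :: "('i \<Rightarrow> ('v, 'a :: comm_ring_1) mfps) \<Rightarrow> 'i set \<Rightarrow> bool" where
  "mfps_summable F A \<longleftrightarrow> (\<forall>m. finite {i \<in> A. mfps_coeff (F i) m \<noteq> 0})"

definition mfps_sum :: "('i \<Rightarrow> ('v, 'a :: comm_ring_1) mfps) \<Rightarrow> 'i set \<Rightarrow> ('v, 'a) mfps" where
  "mfps_sum F A =
     Abs_mfps (\<lambda>m. \<Sum>i \<in> {i \<in> A. mfps_coeff (F i) m \<noteq> 0}. mfps_coeff (F i) m)"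


section \<open>The coefficient ring and the variables\<close>

text \<open>
  Finitely supported functions \<^typ>\<open>int \<Rightarrow>\<^sub>0 int\<close> with convolution product form the ring of Laurent
  polynomials in \<open>t\<close> with integer coefficients; negative powers of \<open>t\<close> are needed because
  \<open>d\<close> below can be negative. All four families of variables are indexed from 1; only finitely
  many of the variables occur in any given identity.
\<close>

datatype indet = X nat | Y nat | W nat | Z nat

type_synonym series = "(indet, int \<Rightarrow>\<^sub>0 int) mfps"

definition tpow :: "int \<Rightarrow> series" where
  "tpow d = mfps_const (Poly_Mapping.single d 1)"

definition x_var :: "nat \<Rightarrow> series" where "x_var i = mfps_var (X i)"
definition y_var :: "nat \<Rightarrow> series" where "y_var i = mfps_var (Y i)"
definition w_var :: "nat \<Rightarrow> series" where "w_var i = mfps_var (W i)"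
definition z_var :: "nat \<Rightarrow> series" where "z_var i = mfps_var (Z i)"


section \<open>Vertex weights\<close>

text \<open>Edge labels are functions on the colours \<open>1..k\<close>, extensional so that each occurs once.\<close>

definition labels :: "nat \<Rightarrow> (nat \<Rightarrow> int) set" where
  "labels k = {1..k} \<rightarrow>\<^sub>E {0, 1}"

definition empty_label :: "nat \<Rightarrow> nat \<Rightarrow> int" where
  "empty_label k = (\<lambda>a\<in>{1..k}. 0)"

definition phi :: "nat \<Rightarrow> (nat \<Rightarrow> int) \<Rightarrow> (nat \<Rightarrow> int) \<Rightarrow> int" where
  "phi k I J = (\<Sum>(c, d) \<in> {(c, d). 1 \<le> c \<and> c < d \<and> d \<le> k}. I c * J d)"

definition label_size :: "nat \<Rightarrow> (nat \<Rightarrow> int) \<Rightarrow> nat" where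
  "label_size k I = nat (\<Sum>c = 1..k. I c)"

text \<open>The labels are those of the bottom, left, top and right edge, in this order.\<close>

definition white_weight ::
  "nat \<Rightarrow> series \<Rightarrow> (nat \<Rightarrow> int) \<Rightarrow> (nat \<Rightarrow> int) \<Rightarrow> (nat \<Rightarrow> int) \<Rightarrow> (nat \<Rightarrow> int) \<Rightarrow> series" where
  "white_weight k x I J K L =
     (if (\<forall>c\<in>{1..k}. I c + J c = K c + L c) \<and> (\<forall>c\<in>{1..k}. I c + J c \<noteq> 2)
      then x ^ label_size k L * tpow (phi k L (\<lambda>c. I c + J c)) else 0)"

definition purple_weight ::
  "nat \<Rightarrow> series \<Rightarrow> (nat \<Rightarrow> int) \<Rightarrow> (nat \<Rightarrow> int) \<Rightarrow> (nat \<Rightarrow> int) \<Rightarrow> (nat \<Rightarrow> int) \<Rightarrow> series" where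
  "purple_weight k x I J K L =
     (if (\<forall>c\<in>{1..k}. I c + J c = K c + L c) \<and> (\<forall>c\<in>{1..k}. K c \<ge> J c)
      then x ^ label_size k L * tpow (phi k L (\<lambda>c. K c - J c)) else 0)"


section \<open>Tuples of partitions\<close>

text \<open>
  A partition is stored as the sequence of its parts with index starting at 0, so the usual
  \<open>j\<close>-th part (\<open>j \<ge> 1\<close>) is \<open>part \<lambda> j\<close>.
\<close>

definition partitions :: "(nat \<Rightarrow> nat) set" where
  "partitions = {f. antimono f \<and> finite {i. f i \<noteq> 0}}"

definition part :: "(nat \<Rightarrow> nat) \<Rightarrow> nat \<Rightarrow> nat" where
  "part f j = f (j - 1)"

definition num_parts :: "(nat \<Rightarrow> nat) \<Rightarrow> nat" where
  "num_parts f = card {j. j \<ge> 1 \<and> part f j \<noteq> 0}"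

type_synonym ptuple = "nat \<Rightarrow> nat \<Rightarrow> nat"

definition partition_tuples :: "nat \<Rightarrow> ptuple set" where
  "partition_tuples k = {1..k} \<rightarrow>\<^sub>E partitions"

definition max_num_parts :: "nat \<Rightarrow> ptuple \<Rightarrow> ptuple \<Rightarrow> nat" where
  "max_num_parts k \<alpha> \<beta> = Max ((\<lambda>a. max (num_parts (\<alpha> a)) (num_parts (\<beta> a))) ` {1..k})"

text \<open>The first part of a partition is its largest.\<close>

definition max_part :: "nat \<Rightarrow> ptuple \<Rightarrow> ptuple \<Rightarrow> nat" where
  "max_part k \<alpha> \<beta> = Max ((\<lambda>a. max (part (\<alpha> a) 1) (part (\<beta> a) 1)) ` {1..k})"

definition N_stat :: "nat \<Rightarrow> nat \<Rightarrow> ptuple \<Rightarrow> nat" where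
  "N_stat k L \<alpha> = (\<Sum>(a, b) \<in> {(a, b). 1 \<le> a \<and> a < b \<and> b \<le> k}.
     card {(i, j) \<in> {1..L} \<times> {1..L}.
       int (part (\<alpha> a) j) - int j > int (part (\<alpha> b) i) - int i})"

definition d_stat :: "nat \<Rightarrow> ptuple \<Rightarrow> ptuple \<Rightarrow> int" where
  "d_stat k \<alpha> \<beta> =
     (let L = max_num_parts k \<alpha> \<beta> in int (N_stat k L \<beta>) - int (N_stat k L \<alpha>))"


section \<open>The lattice model\<close>

definition boundary_label :: "nat \<Rightarrow> nat \<Rightarrow> ptuple \<Rightarrow> int \<Rightarrow> nat \<Rightarrow> int" where
  "boundary_label k l \<alpha> c =
     (\<lambda>a\<in>{1..k}. if \<exists>j\<in>{1..l}. c = int (part (\<alpha> a) j) - int j then 1 else 0)"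

text \<open>
  Edge coordinates for \<open>R\<close> rows and columns \<open>-l, \<dots>, N\<close>: \<open>v (c, r)\<close> labels the vertical edge of
  column \<open>c\<close> just above row \<open>r\<close> (\<open>r = 0\<close> is the bottom boundary), and \<open>h (c, r)\<close> labels the
  horizontal edge of row \<open>r\<close> just left of column \<open>c\<close> (\<open>c = N + 1\<close> is the right boundary).
\<close>

definition configurations ::
  "nat \<Rightarrow> nat \<Rightarrow> nat \<Rightarrow> nat \<Rightarrow> ptuple \<Rightarrow> ptuple \<Rightarrow>
    ((int \<times> nat \<Rightarrow> nat \<Rightarrow> int) \<times> (int \<times> nat \<Rightarrow> nat \<Rightarrow> int)) set" where
  "configurations k l N R lam mu =
     {(v, h). v \<in> {- int l..int N} \<times> {0..R} \<rightarrow>\<^sub>E labels k \<and>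
        h \<in> {- int l..int N + 1} \<times> {1..R} \<rightarrow>\<^sub>E labels k \<and>
        (\<forall>c\<in>{- int l..int N}. v (c, 0) = boundary_label k l mu c \<and>
                               v (c, R) = boundary_label k l lam c) \<and>
        (\<forall>r\<in>{1..R}. h (- int l, r) = empty_label k \<and> h (int N + 1, r) = empty_label k)}"

definition vertex_weight ::
  "nat \<Rightarrow> nat \<Rightarrow> (nat \<Rightarrow> series) \<Rightarrow> (nat \<Rightarrow> series) \<Rightarrow> nat \<Rightarrow>
    (nat \<Rightarrow> int) \<Rightarrow> (nat \<Rightarrow> int) \<Rightarrow> (nat \<Rightarrow> int) \<Rightarrow> (nat \<Rightarrow> int) \<Rightarrow> series" where
  "vertex_weight k n x y r =
     (if r \<le> n then white_weight k (x r) else purple_weight k (y (r - n)))"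

definition partition_function ::
  "nat \<Rightarrow> nat \<Rightarrow> nat \<Rightarrow> nat \<Rightarrow> nat \<Rightarrow> (nat \<Rightarrow> series) \<Rightarrow> (nat \<Rightarrow> series) \<Rightarrow>
    ptuple \<Rightarrow> ptuple \<Rightarrow> series" where
  "partition_function k l N n m x y lam mu =
     (\<Sum>(v, h) \<in> configurations k l N (n + m) lam mu.
        \<Prod>r = 1..n + m. \<Prod>c \<in> {- int l..int N}.
          vertex_weight k n x y r (v (c, r - 1)) (h (c, r)) (v (c, r)) (h (c + 1, r)))"

text \<open>
  The skew function with outer shape \<open>lam\<close> and inner shape \<open>mu\<close>, in the variables
  \<open>x 1, \<dots>, x n\<close> and \<open>y 1, \<dots>, y m\<close>. The number of parts and the last column are the smallest
  admissible ones; larger values give the same sum.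
\<close>

definition LS ::
  "nat \<Rightarrow> nat \<Rightarrow> nat \<Rightarrow> (nat \<Rightarrow> series) \<Rightarrow> (nat \<Rightarrow> series) \<Rightarrow> ptuple \<Rightarrow> ptuple \<Rightarrow> series" where
  "LS k n m x y lam mu =
     partition_function k (max_num_parts k lam mu) (max_part k lam mu) n m x y lam mu"

definition Omega :: "nat \<Rightarrow> nat \<Rightarrow> nat \<Rightarrow> nat \<Rightarrow> nat \<Rightarrow> series" where
  "Omega k n m p q =
     (\<Prod>l = 0..k - 1.
        ((\<Prod>i = 1..n. \<Prod>\<alpha> = 1..p. 1 - x_var i * w_var \<alpha> * tpow (int l)) *
         (\<Prod>j = 1..m. \<Prod>\<beta> = 1..q. 1 - y_var j * z_var \<beta> * tpow (int l))) /
        ((\<Prod>j = 1..m. \<Prod>\<alpha> = 1..p. 1 + y_var j * w_var \<alpha> * tpow (int l)) *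
         (\<Prod>i = 1..n. \<Prod>\<beta> = 1..q. 1 + x_var i * z_var \<beta> * tpow (int l))))"

end

theory Submission
  imports Defs
begin

text \<open>
  Interleave the colours: colour \<open>a\<close> in column \<open>c\<close> becomes the position \<open>p = k c + a - 1\<close> of a
  single fermionic line, so that a step of a path is a jump from \<open>p\<close> to \<open>p + k\<close>. Let \<open>f\<^sub>p\<close> be this
  jump, weighted by \<open>t\<close> to the number of particles it overtakes inside its own column, and \<open>e\<^sub>p\<close> the
  reverse jump, weighted by the particles it overtakes in the next column. A purple row is the
  product of the factors \<open>1 + y f\<^sub>p\<close> in one order of the positions, a white row the product of the
  factors \<open>1 + x f\<^sub>p\<close> in the opposite order. Since \<open>f\<^sub>p\<close> squares to zero, the purple row with parameter
  \<open>- x\<close> is the inverse of the white row with parameter \<open>x\<close>. The factor \<open>t\<close> to the power \<open>d\<close> turns the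
  transpose of a white row into the product of the factors \<open>1 + w e\<^sub>p\<close>.

  It remains to exchange a dual white row with a purple row. Jumps \<open>e\<^sub>p\<close> and \<open>f\<^sub>q\<close> with \<open>p \<noteq> q\<close> commute, and
  \<open>(1 + w e\<^sub>p) (1 + y f\<^sub>p) Q\<^sub>p\<^sub>+\<^sub>1 = Q\<^sub>p (1 + y f\<^sub>p) (1 + w e\<^sub>p)\<close>, where \<open>Q\<^sub>p\<close> is the diagonal operator with entry
  \<open>\<Prod>l<r. 1 + y w t^l\<close> on a state with \<open>r\<close> particles among the positions \<open>p, \<dots>, p + k - 1\<close>. The product
  over all positions telescopes: far to the left \<open>r = k\<close>, far to the right \<open>r = 0\<close>, which leaves the
  factor \<open>\<Prod>l<k. 1 + y w t^l\<close>. The other three exchange relations follow by inverting rows.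
\<close>

section \<open>Truncation of power series\<close>

text \<open>The entry of a kernel at \<open>(i, j)\<close> leads from the upper state
  \<open>i\<close> down to the lower state \<open>j\<close>, so every factor undoes jumps. Let
  \<open>A\<close> be the kernel of the x, y rows and \<open>B\<close> the twisted transpose of the
  kernel of the w, z rows. The left sum is the entry of \<open>A \<star> B\<close> at (\<nu>,
  \<mu>), the right sum the same entry of \<open>B \<star> A\<close>; the theorem is a commutation
  relation up to a scalar. A dual white row is exchanged with a purple row because transposition
  reverses the order of the factors: both products become ascending, and e_p and f_p can be brought
  side by side. The obstacle is infinity: states are infinite sets, rows infinite products, and the
  sums range over infinitely many states. Each jump costs one variable and changes the number of
  boxes by one, so up to a given degree only finitely many states are reached; identities are proved
  modulo each degree, in finite windows, and passed to the limit. The scalar is carried as numerator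
  and denominator, and the denominator, a product of series with constant term 1, is cancelled at
  the end.\<close>

lemma mfps_coeff_zero [simp]: "mfps_coeff 0 m = 0"
  by (simp add: zero_mfps_def)

lemma mfps_coeff_one: "mfps_coeff 1 m = (if m = 0 then 1 else 0)"
  by (simp add: one_mfps_def)

lemma mfps_coeff_add [simp]: "mfps_coeff (f + g) m = mfps_coeff f m + mfps_coeff g m"
  by (simp add: plus_mfps_def)

lemma mfps_coeff_uminus [simp]: "mfps_coeff (- f) m = - mfps_coeff f m"
  by (simp add: uminus_mfps_def)

lemma mfps_coeff_mult:
  "mfps_coeff (f * g) m = (\<Sum>(a, b)\<in>splits m. mfps_coeff f a * mfps_coeff g b)"
  by (simp add: times_mfps_def)

lemma mfps_coeff_sum: "mfps_coeff (sum f A) m = (\<Sum>i\<in>A. mfps_coeff (f i) m)"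
  by (induction A rule: infinite_finite_induct) simp_all

definition mdeg :: "('v \<Rightarrow>\<^sub>0 nat) \<Rightarrow> nat" where
  "mdeg m = (\<Sum>v\<in>Poly_Mapping.keys m. Poly_Mapping.lookup m v)"

lemma mdeg_superset:
  assumes "finite K" "Poly_Mapping.keys m \<subseteq> K"
  shows "mdeg m = (\<Sum>v\<in>K. Poly_Mapping.lookup m v)"
  unfolding mdeg_def by (rule sum.mono_neutral_left) (use assms in \<open>auto simp: in_keys_iff\<close>)

lemma mdeg_add: "mdeg (a + b) = mdeg a + mdeg b"
proof -
  let ?K = "Poly_Mapping.keys a \<union> Poly_Mapping.keys b"
  have "Poly_Mapping.keys (a + b) \<subseteq> ?K" by (rule keys_add)
  then have "mdeg (a + b) = (\<Sum>v\<in>?K. Poly_Mapping.lookup (a + b) v)" by (intro mdeg_superset) auto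
  also have "\<dots> = mdeg a + mdeg b"
    by (simp add: lookup_add sum.distrib mdeg_superset[of ?K a] mdeg_superset[of ?K b])
  finally show ?thesis .
qed

lemma mdeg_single [simp]: "mdeg (Poly_Mapping.single v n) = n"
  by (simp add: mdeg_def)

definition ord_ge :: "nat \<Rightarrow> ('v, 'a :: comm_ring_1) mfps \<Rightarrow> bool" where
  "ord_ge n f \<longleftrightarrow> (\<forall>m. mdeg m < n \<longrightarrow> mfps_coeff f m = 0)"

text \<open>Congruence modulo terms of total degree above \<open>n\<close>. Series are shown equal
  by showing this for every \<open>n\<close>, which replaces infinite sums of series by finite ones.
  Degree \<open>n\<close> itself is still compared, so a series is congruent to zero once its order
  is \<open>Suc n\<close>.\<close>

definition tr_eq :: "nat \<Rightarrow> ('v, 'a :: comm_ring_1) mfps \<Rightarrow> ('v, 'a) mfps \<Rightarrow> bool" where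
  "tr_eq n f g \<longleftrightarrow> (\<forall>m. mdeg m \<le> n \<longrightarrow> mfps_coeff f m = mfps_coeff g m)"

lemma ord_ge_0 [simp]: "ord_ge 0 f"
  and ord_ge_zero [simp]: "ord_ge n 0"
  by (simp_all add: ord_ge_def)

lemma ord_ge_mono: "ord_ge n f \<Longrightarrow> k \<le> n \<Longrightarrow> ord_ge k f"
  by (auto simp: ord_ge_def)

lemma ord_ge_add: "ord_ge n f \<Longrightarrow> ord_ge n g \<Longrightarrow> ord_ge n (f + g)"
  by (simp add: ord_ge_def)

lemma ord_ge_uminus: "ord_ge n f \<Longrightarrow> ord_ge n (- f)"
  by (simp add: ord_ge_def)

lemma ord_ge_mult:
  fixes f g :: "('v, 'a :: comm_ring_1) mfps"
  assumes "ord_ge a f" "ord_ge b g"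
  shows "ord_ge (a + b) (f * g)"
  unfolding ord_ge_def mfps_coeff_mult
proof (intro allI impI sum.neutral ballI)
  fix m :: "'v \<Rightarrow>\<^sub>0 nat" and z assume m: "mdeg m < a + b" and z: "z \<in> splits m"
  obtain c d where cd: "z = (c, d)" by (cases z)
  with z have "m = c + d" by (auto simp: splits_def)
  with m have "mdeg c < a \<or> mdeg d < b" by (auto simp: mdeg_add)
  with assms show "(case z of (c, d) \<Rightarrow> mfps_coeff f c * mfps_coeff g d) = 0"
    by (auto simp: cd ord_ge_def)
qed

lemma ord_ge_power: "ord_ge 1 f \<Longrightarrow> ord_ge n (f ^ n)"
proof (induction n)
  case (Suc n)
  then show ?case using ord_ge_mult[of 1 f n "f ^ n"] by simp
qed simp

lemma tr_eq_refl [simp]: "tr_eq n f f"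
  by (simp add: tr_eq_def)

lemma tr_eq_sym: "tr_eq n f g \<Longrightarrow> tr_eq n g f"
  by (simp add: tr_eq_def)

lemma tr_eq_trans [trans]: "tr_eq n f g \<Longrightarrow> tr_eq n g h \<Longrightarrow> tr_eq n f h"
  by (simp add: tr_eq_def)

lemma tr_eq_zero: "ord_ge (Suc n) f \<Longrightarrow> tr_eq n f 0"
  by (simp add: tr_eq_def ord_ge_def less_Suc_eq_le)

lemma tr_eq_add: "tr_eq n f f' \<Longrightarrow> tr_eq n g g' \<Longrightarrow> tr_eq n (f + g) (f' + g')"
  by (simp add: tr_eq_def)

lemma tr_eq_mult:
  fixes f g f' g' :: "('v, 'a :: comm_ring_1) mfps"
  assumes "tr_eq n f f'" "tr_eq n g g'"
  shows "tr_eq n (f * g) (f' * g')"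
  unfolding tr_eq_def mfps_coeff_mult
proof (intro allI impI sum.cong refl)
  fix m :: "'v \<Rightarrow>\<^sub>0 nat" and z assume m: "mdeg m \<le> n" and z: "z \<in> splits m"
  obtain c d where cd: "z = (c, d)" by (cases z)
  with z have "m = c + d" by (auto simp: splits_def)
  with m have "mdeg c \<le> n" "mdeg d \<le> n" by (auto simp: mdeg_add)
  with assms show "(case z of (c, d) \<Rightarrow> mfps_coeff f c * mfps_coeff g d) =
      (case z of (c, d) \<Rightarrow> mfps_coeff f' c * mfps_coeff g' d)"
    by (auto simp: cd tr_eq_def)
qed

lemma tr_eq_sum: "(\<And>i. i \<in> A \<Longrightarrow> tr_eq n (f i) (g i)) \<Longrightarrow> tr_eq n (sum f A) (sum g A)"
  by (simp add: tr_eq_def mfps_coeff_sum)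

lemma mfps_eqI_tr: "(\<And>n. tr_eq n f g) \<Longrightarrow> f = g"
  by (rule mfps_eqI) (auto simp: tr_eq_def)

lemma tr_eq_mfps_sum:
  fixes F :: "'i \<Rightarrow> ('v, 'a :: comm_ring_1) mfps"
  assumes B: "finite B" "B \<subseteq> A" and z: "\<And>i. i \<in> A - B \<Longrightarrow> ord_ge (Suc n) (F i)"
  shows "tr_eq n (mfps_sum F A) (\<Sum>i\<in>B. F i)"
  unfolding tr_eq_def mfps_coeff_sum
proof (intro allI impI)
  fix m :: "'v \<Rightarrow>\<^sub>0 nat" assume m: "mdeg m \<le> n"
  have "{i \<in> A. mfps_coeff (F i) m \<noteq> 0} \<subseteq> B"
    using z m by (auto simp: ord_ge_def less_Suc_eq_le)
  then show "mfps_coeff (mfps_sum F A) m = (\<Sum>i\<in>B. mfps_coeff (F i) m)"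
    unfolding mfps_sum_def mfps_coeff_Abs
    by (intro sum.mono_neutral_left) (use B in auto)
qed

lemma mfps_sum_finite_support:
  assumes "finite B" "B \<subseteq> A" "\<And>i. i \<in> A - B \<Longrightarrow> F i = 0"
  shows "mfps_sum F A = (\<Sum>i\<in>B. F i)"
  by (rule mfps_eqI_tr, rule tr_eq_mfps_sum) (use assms in auto)

lemma mfps_sum_reindex:
  assumes "bij_betw h A B"
  shows "mfps_sum (\<lambda>i. F (h i)) A = mfps_sum F B"
  unfolding mfps_sum_def
proof (intro arg_cong[where f = Abs_mfps] ext)
  fix m
  have "bij_betw h {i \<in> A. mfps_coeff (F (h i)) m \<noteq> 0} {i \<in> B. mfps_coeff (F i) m \<noteq> 0}"
    using assms by (auto simp: bij_betw_def inj_on_def image_iff)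
  then show "(\<Sum>i | i \<in> A \<and> mfps_coeff (F (h i)) m \<noteq> 0. mfps_coeff (F (h i)) m) =
      (\<Sum>i | i \<in> B \<and> mfps_coeff (F i) m \<noteq> 0. mfps_coeff (F i) m)"
    by (rule sum.reindex_bij_betw)
qed

lemma mfps_summable_reindex:
  assumes "bij_betw h A B" "mfps_summable F B"
  shows "mfps_summable (\<lambda>i. F (h i)) A"
  unfolding mfps_summable_def
proof
  fix m
  have "h ` {i \<in> A. mfps_coeff (F (h i)) m \<noteq> 0} \<subseteq> {i \<in> B. mfps_coeff (F i) m \<noteq> 0}"
    using assms(1) by (auto simp: bij_betw_def)
  moreover have "finite {i \<in> B. mfps_coeff (F i) m \<noteq> 0}"
    using assms(2) by (simp add: mfps_summable_def)
  moreover have "inj_on h {i \<in> A. mfps_coeff (F (h i)) m \<noteq> 0}"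
    using assms(1) by (auto simp: bij_betw_def inj_on_def)
  ultimately show "finite {i \<in> A. mfps_coeff (F (h i)) m \<noteq> 0}"
    using inj_on_finite by blast
qed

lemma mfps_sum_cong: "(\<And>i. i \<in> A \<Longrightarrow> F i = G i) \<Longrightarrow> mfps_sum F A = mfps_sum G A"
  unfolding mfps_sum_def by (intro arg_cong[where f = Abs_mfps] ext sum.cong) auto

lemma mfps_summable_cong: "(\<And>i. i \<in> A \<Longrightarrow> F i = G i) \<Longrightarrow> mfps_summable F A = mfps_summable G A"
  unfolding mfps_summable_def by (auto cong: conj_cong)

text \<open>The inverse is the geometric series in \<open>- u\<close>, whose powers have growing
  order.\<close>

lemma one_plus_unit:
  fixes u :: "('v, 'a :: comm_ring_1) mfps"
  assumes u: "ord_ge 1 u"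
  shows "\<exists>g. (1 + u) * g = 1"
proof
  define S where "S n = (\<Sum>i\<le>n. (- u) ^ i)" for n :: nat
  \<comment> \<open>Only the powers up to \<open>mdeg m\<close> reach the monomial \<open>m\<close>,
    so its coefficient is read off that partial sum.\<close>
  define g where "g = Abs_mfps (\<lambda>m. mfps_coeff (S (mdeg m)) m)"
  have o: "ord_ge i ((- u) ^ i)" for i
    by (rule ord_ge_power) (rule ord_ge_uminus[OF u])
  have "tr_eq n g (S n)" for n
    unfolding tr_eq_def
  proof (intro allI impI)
    fix m :: "'v \<Rightarrow>\<^sub>0 nat" assume m: "mdeg m \<le> n"
    have "mfps_coeff (S (mdeg m)) m = mfps_coeff (S n) m"
      unfolding S_def mfps_coeff_sum
      by (rule sum.mono_neutral_left) (use m o in \<open>auto simp: ord_ge_def\<close>)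
    then show "mfps_coeff g m = mfps_coeff (S n) m" by (simp add: g_def)
  qed
  then have "tr_eq n ((1 + u) * g) ((1 + u) * S n)" for n
    by (intro tr_eq_mult) auto
  moreover have "(1 + u) * S n = 1 + (- ((- u) ^ Suc n))" for n
    using sum_gp_basic[of "- u" n] by (simp add: S_def)
  moreover have "tr_eq n (1 + (- ((- u) ^ Suc n))) (1 + 0)" for n
    by (intro tr_eq_add tr_eq_refl tr_eq_zero ord_ge_uminus o)
  ultimately have "tr_eq n ((1 + u) * g) 1" for n
    by (metis add.right_neutral tr_eq_trans)
  then show "(1 + u) * g = 1" by (rule mfps_eqI_tr)
qed

lemma tpow_0 [simp]: "tpow 0 = 1"
  by (rule mfps_eqI) (simp add: tpow_def mfps_const_def mfps_coeff_one)

lemma tpow_add: "tpow (a + b) = tpow a * tpow b"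
proof (rule mfps_eqI)
  fix m
  let ?c = "\<lambda>a. Poly_Mapping.single a 1 :: int \<Rightarrow>\<^sub>0 int"
  have "mfps_coeff (tpow a * tpow b) m =
      (\<Sum>z\<in>splits m. if z = (0, 0) then ?c a * ?c b else 0)"
    unfolding mfps_coeff_mult tpow_def mfps_const_def
    by (rule sum.cong) (auto split: if_splits)
  also have "\<dots> = (if (0, 0) \<in> splits m then ?c a * ?c b else 0)"
    by (rule sum.delta) simp
  also have "\<dots> = mfps_coeff (tpow (a + b)) m"
    by (auto simp: tpow_def mfps_const_def splits_def mult_single)
  finally show "mfps_coeff (tpow (a + b)) m = mfps_coeff (tpow a * tpow b) m" by simp
qed

section \<open>Kernels over a graded index set\<close>

text \<open>
  The entries of a band kernel have order at least the difference of the degrees of their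
  indices. This makes all infinite matrix products converge and associate.
\<close>

locale graded_index =
  fixes M :: "'i set" and sz :: "'i \<Rightarrow> nat"
  assumes finite_level: "finite {i \<in> M. sz i \<le> n}"
begin

text \<open>The distance \<open>|sz i - sz j|\<close>, spelled with truncated subtraction. Its
  triangle inequality is what makes the order bound of band kernels survive multiplication.\<close>

definition gap :: "'i \<Rightarrow> 'i \<Rightarrow> nat" where
  "gap i j = (sz i - sz j) + (sz j - sz i)"

definition band :: "('i \<Rightarrow> 'i \<Rightarrow> ('v, 'a :: comm_ring_1) mfps) \<Rightarrow> bool" where
  "band A \<longleftrightarrow> (\<forall>i j. (i \<notin> M \<or> j \<notin> M \<longrightarrow> A i j = 0) \<and> ord_ge (gap i j) (A i j))"

definition kmult ::
  "('i \<Rightarrow> 'i \<Rightarrow> ('v, 'a :: comm_ring_1) mfps) \<Rightarrow> ('i \<Rightarrow> 'i \<Rightarrow> ('v, 'a) mfps) \<Rightarrow>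
    'i \<Rightarrow> 'i \<Rightarrow> ('v, 'a) mfps" (infixl \<open>\<star>\<close> 70) where
  "(A \<star> B) i j = (if i \<in> M \<and> j \<in> M then mfps_sum (\<lambda>l. A i l * B l j) M else 0)"

definition kid :: "'i \<Rightarrow> 'i \<Rightarrow> ('v, 'a :: comm_ring_1) mfps" where
  "kid i j = (if i \<in> M \<and> i = j then 1 else 0)"

definition smult :: "('v, 'a) mfps \<Rightarrow> ('i \<Rightarrow> 'i \<Rightarrow> ('v, 'a :: comm_ring_1) mfps) \<Rightarrow>
    'i \<Rightarrow> 'i \<Rightarrow> ('v, 'a) mfps" where
  "smult c A i j = c * A i j"

lemma band_zero: "band A \<Longrightarrow> i \<notin> M \<or> j \<notin> M \<Longrightarrow> A i j = 0"
  and band_ord: "band A \<Longrightarrow> ord_ge (gap i j) (A i j)"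
  by (auto simp: band_def)

lemma ord_ge_kterm:
  assumes "band A" "band B"
  shows "ord_ge (gap i l + gap l j) (A i l * B l j)"
  using assms by (intro ord_ge_mult band_ord)

text \<open>Passing from \<open>i\<close> to a state of size above \<open>sz i + n\<close> already
  costs more than degree \<open>n\<close> in the first factor, so those summands vanish modulo
  degree \<open>n\<close>.\<close>

lemma kmult_trunc:
  assumes "band A" "band B" "i \<in> M" "j \<in> M" "sz i + n \<le> N"
  shows "tr_eq n ((A \<star> B) i j) (\<Sum>l\<in>{l \<in> M. sz l \<le> N}. A i l * B l j)"
proof -
  have "tr_eq n (mfps_sum (\<lambda>l. A i l * B l j) M) (\<Sum>l\<in>{l \<in> M. sz l \<le> N}. A i l * B l j)"
  proof (rule tr_eq_mfps_sum)
    fix l assume "l \<in> M - {l \<in> M. sz l \<le> N}"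
    then have "Suc n \<le> gap i l + gap l j" using assms(5) by (auto simp: gap_def)
    then show "ord_ge (Suc n) (A i l * B l j)"
      using ord_ge_kterm[OF assms(1,2)] ord_ge_mono by blast
  qed (use finite_level in auto)
  then show ?thesis using assms(3,4) by (simp add: kmult_def)
qed

lemma summable_kterms:
  assumes "band A" "band B"
  shows "mfps_summable (\<lambda>l. A i l * B l j) M"
  unfolding mfps_summable_def
proof
  fix m
  have "{l \<in> M. mfps_coeff (A i l * B l j) m \<noteq> 0} \<subseteq> {l \<in> M. sz l \<le> sz i + mdeg m}"
  proof clarify
    fix l assume "mfps_coeff (A i l * B l j) m \<noteq> 0"
    then have "\<not> mdeg m < gap i l + gap l j"
      using ord_ge_kterm[OF assms] by (metis ord_ge_def)
    then show "sz l \<le> sz i + mdeg m" by (auto simp: gap_def)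
  qed
  then show "finite {l \<in> M. mfps_coeff (A i l * B l j) m \<noteq> 0}"
    using finite_level finite_subset by blast
qed

lemma band_kmult:
  assumes "band A" "band B"
  shows "band (A \<star> B)"
  unfolding band_def
proof (intro allI conjI)
  fix i j
  show "i \<notin> M \<or> j \<notin> M \<longrightarrow> (A \<star> B) i j = 0" by (auto simp: kmult_def)
  show "ord_ge (gap i j) ((A \<star> B) i j)"
  proof (cases "i \<in> M \<and> j \<in> M")
    case True
    have "mfps_coeff (A i l * B l j) m = 0" if "mdeg m < gap i j" for l m
    proof -
      have "gap i j \<le> gap i l + gap l j" by (simp add: gap_def)
      with that have "mdeg m < gap i l + gap l j" by simp
      then show ?thesis using ord_ge_kterm[OF assms, of i l j] by (auto simp: ord_ge_def)
    qed
    then have "mfps_coeff (mfps_sum (\<lambda>l. A i l * B l j) M) m = 0" if "mdeg m < gap i j" for m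
      using that by (simp add: mfps_sum_def)
    then show ?thesis using True by (simp add: kmult_def ord_ge_def)
  qed (auto simp: kmult_def)
qed

lemma kmult_assoc:
  assumes A: "band A" and B: "band B" and C: "band C"
  shows "A \<star> B \<star> C = A \<star> (B \<star> C)"
proof (intro ext mfps_eqI_tr)
  fix i j n
  show "tr_eq n ((A \<star> B \<star> C) i j) ((A \<star> (B \<star> C)) i j)"
  proof (cases "i \<in> M \<and> j \<in> M")
    case True
    \<comment> \<open>The slack is \<open>n + n\<close>: intermediate states \<open>h\<close> matter
      up to size \<open>sz i + n\<close>, and from such an \<open>h\<close> the inner product must
      reach another \<open>n\<close> levels.\<close>
    define F where "F = {l \<in> M. sz l \<le> sz i + (n + n)}"
    have AB: "band (A \<star> B)" and BC: "band (B \<star> C)" using assms by (auto intro: band_kmult)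
    have "tr_eq n ((A \<star> B \<star> C) i j) (\<Sum>l\<in>F. (A \<star> B) i l * C l j)"
      unfolding F_def using True AB C by (intro kmult_trunc) auto
    also have "tr_eq n \<dots> (\<Sum>l\<in>F. (\<Sum>h\<in>F. A i h * B h l) * C l j)"
      unfolding F_def using True A B by (intro tr_eq_sum tr_eq_mult kmult_trunc) auto
    also have "(\<Sum>l\<in>F. (\<Sum>h\<in>F. A i h * B h l) * C l j) =
        (\<Sum>h\<in>F. A i h * (\<Sum>l\<in>F. B h l * C l j))"
      unfolding sum_distrib_left sum_distrib_right mult.assoc by (rule sum.swap)
    also have "tr_eq n \<dots> (\<Sum>h\<in>{l \<in> M. sz l \<le> sz i + n}. A i h * (\<Sum>l\<in>F. B h l * C l j))"
    proof -
      have "tr_eq n (\<Sum>h\<in>F. A i h * (\<Sum>l\<in>F. B h l * C l j))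
          (\<Sum>h\<in>F. if sz h \<le> sz i + n then A i h * (\<Sum>l\<in>F. B h l * C l j) else 0)"
      proof (rule tr_eq_sum)
        fix h assume "h \<in> F"
        show "tr_eq n (A i h * (\<Sum>l\<in>F. B h l * C l j))
          (if sz h \<le> sz i + n then A i h * (\<Sum>l\<in>F. B h l * C l j) else 0)"
        proof (cases "sz h \<le> sz i + n")
          case False
          then have "Suc n \<le> gap i h" by (simp add: gap_def)
          then have "ord_ge (Suc n + 0) (A i h * (\<Sum>l\<in>F. B h l * C l j))"
            using band_ord[OF A, of i h] by (intro ord_ge_mult) (auto intro: ord_ge_mono)
          then show ?thesis using False by (simp add: tr_eq_zero)
        qed simp
      qed
      also have "(\<Sum>h\<in>F. if sz h \<le> sz i + n then A i h * (\<Sum>l\<in>F. B h l * C l j) else 0) =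
        (\<Sum>h\<in>{l \<in> M. sz l \<le> sz i + n}. A i h * (\<Sum>l\<in>F. B h l * C l j))"
        by (rule sum.mono_neutral_cong_right) (use finite_level F_def in auto)
      finally show ?thesis .
    qed
    also have "tr_eq n \<dots> (\<Sum>h\<in>{l \<in> M. sz l \<le> sz i + n}. A i h * (B \<star> C) h j)"
      unfolding F_def using True B C
      by (intro tr_eq_sum tr_eq_mult tr_eq_refl tr_eq_sym[OF kmult_trunc]) auto
    also have "tr_eq n \<dots> ((A \<star> (B \<star> C)) i j)"
      using True A BC by (intro tr_eq_sym[OF kmult_trunc]) auto
    finally show ?thesis .
  qed (auto simp: kmult_def)
qed

lemma kmult_finite_support:
  assumes "i \<in> M" "j \<in> M" "finite F" "F \<subseteq> M" "\<And>l. l \<in> M - F \<Longrightarrow> A i l = 0"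
  shows "(A \<star> B) i j = (\<Sum>l\<in>F. A i l * B l j)"
  using assms mfps_sum_finite_support[of F M "\<lambda>l. A i l * B l j"] by (simp add: kmult_def)

lemma band_kid: "band kid"
  by (auto simp: band_def kid_def gap_def)

lemma kmult_kid_left: "band A \<Longrightarrow> kid \<star> A = A"
proof (intro ext)
  fix i j assume A: "band A"
  show "(kid \<star> A) i j = A i j"
  proof (cases "i \<in> M \<and> j \<in> M")
    case True
    then have "(kid \<star> A) i j = (\<Sum>l\<in>{i}. kid i l * A l j)"
      by (intro kmult_finite_support) (auto simp: kid_def)
    then show ?thesis using True by (simp add: kid_def)
  qed (use A in \<open>auto simp: kmult_def band_zero\<close>)
qed

lemma kmult_kid_right: "band A \<Longrightarrow> A \<star> kid = A"
proof (intro ext)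
  fix i j assume A: "band A"
  show "(A \<star> kid) i j = A i j"
  proof (cases "i \<in> M \<and> j \<in> M")
    case True
    have "mfps_sum (\<lambda>l. A i l * kid l j) M = (\<Sum>l\<in>{j}. A i l * kid l j)"
      by (rule mfps_sum_finite_support) (use True in \<open>auto simp: kid_def\<close>)
    then have "(A \<star> kid) i j = (\<Sum>l\<in>{j}. A i l * kid l j)"
      using True by (simp add: kmult_def)
    then show ?thesis using True by (simp add: kid_def)
  qed (use A in \<open>auto simp: kmult_def band_zero\<close>)
qed

lemma band_smult: "band A \<Longrightarrow> band (smult c A)"
  using ord_ge_mult[of 0 c "gap i j" "A i j" for i j] by (auto simp: band_def smult_def)

lemma kmult_smult_left:
  assumes "band A" "band B"
  shows "smult c A \<star> B = smult c (A \<star> B)"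
proof (intro ext mfps_eqI_tr)
  fix i j n
  show "tr_eq n ((smult c A \<star> B) i j) (smult c (A \<star> B) i j)"
  proof (cases "i \<in> M \<and> j \<in> M")
    case True
    let ?F = "{l \<in> M. sz l \<le> sz i + n}"
    have "tr_eq n ((smult c A \<star> B) i j) (\<Sum>l\<in>?F. smult c A i l * B l j)"
      using True assms by (intro kmult_trunc band_smult) auto
    also have "(\<Sum>l\<in>?F. smult c A i l * B l j) = c * (\<Sum>l\<in>?F. A i l * B l j)"
      by (simp add: smult_def sum_distrib_left mult.assoc)
    also have "tr_eq n \<dots> (c * (A \<star> B) i j)"
      using True assms by (intro tr_eq_mult tr_eq_refl tr_eq_sym[OF kmult_trunc]) auto
    finally show ?thesis by (simp only: smult_def[of c "A \<star> B" i j])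
  qed (auto simp: kmult_def smult_def)
qed

lemma kmult_smult_right:
  assumes "band A" "band B"
  shows "A \<star> smult c B = smult c (A \<star> B)"
proof -
  have "A \<star> smult c B = smult c A \<star> B"
    by (intro ext) (simp add: kmult_def smult_def mult_ac)
  then show ?thesis using kmult_smult_left[OF assms] by simp
qed

lemma smult_smult: "smult a (smult b A) = smult (a * b) A"
  by (intro ext) (simp add: smult_def mult.assoc)

lemma smult_1 [simp]: "smult 1 A = A"
  by (intro ext) (simp add: smult_def)

text \<open>Pointwise eventual equality gives no common threshold for all entries, but modulo degree
  \<open>n\<close> the product sees only finitely many of them. This is how identities in finite
  windows pass to infinite rows.\<close>

lemma kmult_limit:
  assumes "\<And>r. band (A r)" "\<And>r. band (B r)" "band A'" "band B'"
    and A: "\<And>i j. \<forall>\<^sub>F r in sequentially. A r i j = A' i j"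
    and B: "\<And>i j. \<forall>\<^sub>F r in sequentially. B r i j = B' i j"
  shows "\<forall>\<^sub>F r in sequentially. tr_eq n ((A r \<star> B r) i j) ((A' \<star> B') i j)"
proof (cases "i \<in> M \<and> j \<in> M")
  case True
  let ?F = "{l \<in> M. sz l \<le> sz i + n}"
  have "\<forall>\<^sub>F r in sequentially. \<forall>l\<in>?F. A r i l = A' i l \<and> B r l j = B' l j"
    using A B finite_level by (intro eventually_ball_finite ballI eventually_conj) auto
  then show ?thesis
  proof eventually_elim
    case (elim r)
    have "tr_eq n ((A r \<star> B r) i j) (\<Sum>l\<in>?F. A r i l * B r l j)"
      using assms True by (intro kmult_trunc) auto
    also have "(\<Sum>l\<in>?F. A r i l * B r l j) = (\<Sum>l\<in>?F. A' i l * B' l j)"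
      using elim by (intro sum.cong) auto
    also have "tr_eq n \<dots> ((A' \<star> B') i j)"
      using assms True by (intro tr_eq_sym[OF kmult_trunc]) auto
    finally show ?case .
  qed
qed (auto simp: kmult_def)

text \<open>The transpose, twisted entrywise by \<open>g\<close>. With the powers of
  \<open>t\<close> given by \<open>dd\<close> it absorbs the factor t^d in the sums of the
  theorem.\<close>

definition adj :: "('i \<Rightarrow> 'i \<Rightarrow> ('v, 'a) mfps) \<Rightarrow> ('i \<Rightarrow> 'i \<Rightarrow> ('v, 'a :: comm_ring_1) mfps) \<Rightarrow>
    'i \<Rightarrow> 'i \<Rightarrow> ('v, 'a) mfps" where
  "adj g A i j = g i j * A j i"

lemma band_adj:
  assumes "band A"
  shows "band (adj g A)"
  unfolding band_def adj_def
proof (intro allI conjI)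
  fix i j
  show "i \<notin> M \<or> j \<notin> M \<longrightarrow> g i j * A j i = 0" using band_zero[OF assms] by auto
  have "ord_ge (0 + gap j i) (g i j * A j i)"
    by (intro ord_ge_mult band_ord[OF assms]) simp
  then show "ord_ge (gap i j) (g i j * A j i)" by (simp add: gap_def add.commute)
qed

text \<open>The cocycle identity splits the twist of a product along every intermediate state, so
  the twisted transpose is as anti-multiplicative as the plain one.\<close>

lemma adj_kmult:
  assumes "band A" "band B"
    and g: "\<And>i j l. i \<in> M \<Longrightarrow> j \<in> M \<Longrightarrow> l \<in> M \<Longrightarrow> g i j = g i l * g l j"
  shows "adj g (A \<star> B) = adj g B \<star> adj g A"
proof (intro ext mfps_eqI_tr)
  fix i j n
  show "tr_eq n (adj g (A \<star> B) i j) ((adj g B \<star> adj g A) i j)"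
  proof (cases "i \<in> M \<and> j \<in> M")
    case True
    \<comment> \<open>The two products start at \<open>j\<close> and at \<open>i\<close>; the common
      finite range must be high enough for truncation from both.\<close>
    let ?F = "{l \<in> M. sz l \<le> sz i + sz j + n}"
    have "tr_eq n (adj g (A \<star> B) i j) (g i j * (\<Sum>l\<in>?F. A j l * B l i))"
      unfolding adj_def using True assms by (intro tr_eq_mult tr_eq_refl kmult_trunc) auto
    also have "g i j * (\<Sum>l\<in>?F. A j l * B l i) = (\<Sum>l\<in>?F. adj g B i l * adj g A l j)"
      unfolding sum_distrib_left
    proof (rule sum.cong)
      fix l assume "l \<in> ?F"
      then show "g i j * (A j l * B l i) = adj g B i l * adj g A l j"
        using g[of i j l] True by (simp add: adj_def mult_ac)
    qed simp
    also have "tr_eq n \<dots> ((adj g B \<star> adj g A) i j)"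
      using True assms by (intro tr_eq_sym[OF kmult_trunc] band_adj) auto
    finally show ?thesis .
  qed (auto simp: kmult_def adj_def)
qed

end

section \<open>Elementary moves of particles\<close>

definition up :: "nat \<Rightarrow> int \<Rightarrow> int set \<Rightarrow> int set" where
  "up k p S = insert (p + int k) (S - {p})"

definition dn :: "nat \<Rightarrow> int \<Rightarrow> int set \<Rightarrow> int set" where
  "dn k p S = insert p (S - {p + int k})"

definition can_up :: "nat \<Rightarrow> int \<Rightarrow> int set \<Rightarrow> bool" where
  "can_up k p S \<longleftrightarrow> p \<in> S \<and> p + int k \<notin> S"

definition can_dn :: "nat \<Rightarrow> int \<Rightarrow> int set \<Rightarrow> bool" where
  "can_dn k p S \<longleftrightarrow> p \<notin> S \<and> p + int k \<in> S"

text \<open>In terms of colours: the larger colours in the column of \<open>p\<close>, while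
  \<open>next_col\<close> holds the smaller colours one column further. Together they form the open
  interval from \<open>p\<close> to \<open>p + k\<close>, everything that a jump from
  \<open>p\<close> passes.\<close>

definition col_rest :: "nat \<Rightarrow> int \<Rightarrow> int set" where
  "col_rest k p = {p<..<(p div int k + 1) * int k}"

definition next_col :: "nat \<Rightarrow> int \<Rightarrow> int set" where
  "next_col k p = {(p div int k + 1) * int k..<p + int k}"

definition same :: "nat \<Rightarrow> int \<Rightarrow> int set \<Rightarrow> nat" where
  "same k p S = card (S \<inter> col_rest k p)"

definition wrap :: "nat \<Rightarrow> int \<Rightarrow> int set \<Rightarrow> nat" where
  "wrap k p S = card (S \<inter> next_col k p)"

definition fits :: "nat \<Rightarrow> nat \<Rightarrow> nat \<Rightarrow> int set \<Rightarrow> bool" where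
  "fits k L N S \<longleftrightarrow> (\<forall>p < - int L * int k. p \<in> S) \<and> (\<forall>p \<ge> (int N + 1) * int k. p \<notin> S)"

text \<open>The matrix of the ordered product of the factors \<open>1 + y f\<^sub>p\<close> along a list of positions.\<close>

fun kp :: "nat \<Rightarrow> series \<Rightarrow> int list \<Rightarrow> int set \<Rightarrow> int set \<Rightarrow> series" where
  "kp k y [] i j = (if i = j then 1 else 0)"
| "kp k y (p # ps) i j = kp k y ps i j +
     (if can_dn k p i then y * tpow (int (same k p i)) * kp k y ps (dn k p i) j else 0)"

lemma int_less_mult_iff_div: "x < (c + 1) * K \<longleftrightarrow> x div K \<le> c" if "K > 0" for x c K :: int
proof
  assume x: "x < (c + 1) * K"
  show "x div K \<le> c"
  proof (rule ccontr)
    assume "\<not> x div K \<le> c"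
    then have "(c + 1) * K \<le> x div K * K" using that by (intro mult_right_mono) auto
    also have "\<dots> \<le> x" using that by (metis div_mult_mod_eq le_add_same_cancel1 pos_mod_sign)
    finally show False using x by simp
  qed
next
  assume "x div K \<le> c"
  have "x div K * K + x mod K = x" "x mod K < K" using that by simp_all
  then have "x < x div K * K + K" by linarith
  also have "\<dots> = (x div K + 1) * K" by (simp add: algebra_simps)
  also have "\<dots> \<le> (c + 1) * K" using that \<open>x div K \<le> c\<close> by (intro mult_right_mono) auto
  finally show "x < (c + 1) * K" .
qed

lemma card_move:
  assumes "finite R" "x \<in> S" "y \<notin> S"
  shows "int (card (insert y (S - {x}) \<inter> R)) =
    int (card (S \<inter> R)) - (if x \<in> R then 1 else 0) + (if y \<in> R then 1 else 0)"
proof -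
  have fin: "finite (S \<inter> R)" using assms by auto
  have "insert y (S - {x}) \<inter> R =
      (if y \<in> R then insert y ((S \<inter> R) - {x}) else (S \<inter> R) - {x})" by auto
  moreover have "int (card ((S \<inter> R) - {x})) = int (card (S \<inter> R)) - (if x \<in> R then 1 else 0)"
  proof (cases "x \<in> R")
    case True
    with fin assms(2) have "card (S \<inter> R) > 0" by (auto simp: card_gt_0_iff)
    then show ?thesis using True assms(2) by (simp add: card_Diff_singleton_if of_nat_diff)
  qed simp
  moreover have "y \<notin> (S \<inter> R) - {x}" using assms by auto
  ultimately show ?thesis using fin by auto
qed

lemma fits_mono: "fits k L N S \<Longrightarrow> L \<le> L' \<Longrightarrow> N \<le> N' \<Longrightarrow> fits k L' N' S"
  unfolding fits_def
proof (intro conjI allI impI; elim conjE)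
  fix p assume "\<forall>p < - int L * int k. p \<in> S" "L \<le> L'" "p < - int L' * int k"
  moreover have "- int L' * int k \<le> - int L * int k" using \<open>L \<le> L'\<close> by (simp add: mult_right_mono)
  ultimately show "p \<in> S" by auto
next
  fix p assume "\<forall>p \<ge> (int N + 1) * int k. p \<notin> S" "N \<le> N'" "p \<ge> (int N' + 1) * int k"
  moreover have "(int N' + 1) * int k \<ge> (int N + 1) * int k"
    using \<open>N \<le> N'\<close> by (simp add: mult_right_mono)
  ultimately show "p \<notin> S" by auto
qed

lemma can_dn_fits:
  assumes "fits k L N S" "can_dn k p S"
  shows "- int L * int k \<le> p" "p < int N * int k"
proof -
  show "- int L * int k \<le> p" using assms by (force simp: fits_def can_dn_def)
  have "p + int k < (int N + 1) * int k" using assms by (meson can_dn_def fits_def not_le)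
  then show "p < int N * int k" by (simp add: algebra_simps)
qed

lemma fits_dn:
  assumes "fits k L N S" "can_dn k p S"
  shows "fits k L N (dn k p S)"
  using assms can_dn_fits[OF assms] by (auto simp: fits_def can_dn_def dn_def algebra_simps)

text \<open>Positions outside the window admit no move, so their factors act as the identity, and a
  move keeps the state inside the window. Column \<open>N\<close> is idle as well: a particle moved
  down to \<open>p\<close> comes from \<open>p + k\<close>, which must lie in the window.\<close>

lemma kp_filter:
  assumes "fits k L N i"
  shows "kp k y ps i j = kp k y (filter (\<lambda>p. - int L * int k \<le> p \<and> p < int N * int k) ps) i j"
  using assms
proof (induction ps arbitrary: i)
  case (Cons p ps)
  show ?case
  proof (cases "can_dn k p i")
    case True
    then show ?thesis
      using Cons.IH[OF Cons.prems] Cons.IH[OF fits_dn[OF Cons.prems True]] can_dn_fits[OF Cons.prems True]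
      by simp
  next
    case False
    then show ?thesis using Cons.IH[OF Cons.prems] by simp
  qed
qed simp

lemma kp_fits:
  assumes "fits k L N i" "kp k y ps i j \<noteq> 0"
  shows "fits k L N j"
  using assms
proof (induction ps arbitrary: i)
  case (Cons p ps)
  show ?case
  proof (cases "kp k y ps i j = 0")
    case True
    with Cons.prems have "can_dn k p i" "kp k y ps (dn k p i) j \<noteq> 0" by (auto split: if_splits)
    then show ?thesis using Cons.IH Cons.prems(1) fits_dn by blast
  qed (use Cons in auto)
qed (auto split: if_splits)

lemma filter_upto:
  "filter (\<lambda>p. a \<le> p \<and> p < b) [lo..hi] = [max lo a..min hi (b - 1)]" for a b :: int
proof (induction lo hi rule: upto.induct)
  case (1 lo hi)
  show ?case
  proof (cases "lo \<le> hi")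
    case True
    note IH = 1[OF True]
    have eq: "[lo..hi] = lo # [lo + 1..hi]" using True by (simp add: upto_rec1)
    consider "lo < a" | "a \<le> lo" "lo < b" | "a \<le> lo" "b \<le> lo" by linarith
    then show ?thesis
    proof cases
      case 1
      then show ?thesis using IH by (simp add: eq max_def)
    next
      case 2
      then have "[max lo a..min hi (b - 1)] = lo # [max (lo + 1) a..min hi (b - 1)]"
        using True by (auto simp: max_def upto_rec1)
      then show ?thesis using IH 2 by (simp add: eq)
    next
      case 3
      then show ?thesis using IH by (simp add: eq)
    qed
  qed simp
qed

definition pos :: "nat \<Rightarrow> nat \<Rightarrow> nat \<Rightarrow> int list" where
  "pos k L N = [- int L * int k..(int N + 1) * int k - 1]"

text \<open>Enlarging the window adds only idle positions. Hence the product over all integers makes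
  sense entry by entry, in either order.\<close>

lemma kp_pos_stable:
  assumes "fits k L N i" "L \<le> L'" "N \<le> N'"
  shows "kp k y (pos k L' N') i j = kp k y (pos k L N) i j"
    and "kp k y (rev (pos k L' N')) i j = kp k y (rev (pos k L N)) i j"
proof -
  have "- int L' * int k \<le> - int L * int k" "int N * int k \<le> int N' * int k"
    using assms by (simp_all add: mult_right_mono)
  then have "filter (\<lambda>p. - int L * int k \<le> p \<and> p < int N * int k) (pos k L' N') =
      filter (\<lambda>p. - int L * int k \<le> p \<and> p < int N * int k) (pos k L N)"
    unfolding pos_def filter_upto by (simp add: algebra_simps)
  then show "kp k y (pos k L' N') i j = kp k y (pos k L N) i j"
    "kp k y (rev (pos k L' N')) i j = kp k y (rev (pos k L N)) i j"
    using kp_filter[OF assms(1), of y "pos k L' N'" j] kp_filter[OF assms(1), of y "pos k L N" j]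
      kp_filter[OF assms(1), of y "rev (pos k L' N')" j] kp_filter[OF assms(1), of y "rev (pos k L N)" j]
    by (simp_all add: rev_filter[symmetric])
qed

text \<open>The q-Pochhammer symbol \<open>(- s; t)_n\<close>.\<close>

definition qfac :: "series \<Rightarrow> nat \<Rightarrow> series" where
  "qfac s n = (\<Prod>l<n. 1 + s * tpow (int l))"

text \<open>What the operator algebra uses about states: closure under jumps, a change of size of at
  most one per jump, and being full far to the left and empty far to the right.
  \<open>moves_mayas\<close> supplies this for tuples of partitions.\<close>

locale moves = graded_index M sz for M :: "int set set" and sz +
  fixes k :: nat
  assumes k_pos: "k > 0"
    and up_closed: "S \<in> M \<Longrightarrow> can_up k p S \<Longrightarrow> up k p S \<in> M"
    and dn_closed: "S \<in> M \<Longrightarrow> can_dn k p S \<Longrightarrow> dn k p S \<in> M"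
    and gap_dn: "S \<in> M \<Longrightarrow> can_dn k p S \<Longrightarrow> gap S (dn k p S) \<le> 1"
    and ex_fits: "S \<in> M \<Longrightarrow> \<exists>r. fits k r r S"
begin

lemma gap_up:
  assumes "S \<in> M" "can_up k p S"
  shows "gap S (up k p S) \<le> 1"
proof -
  have "can_dn k p (up k p S)" "dn k p (up k p S) = S"
    using assms k_pos by (auto simp: can_up_def can_dn_def up_def dn_def)
  then show ?thesis using gap_dn[OF up_closed[OF assms], of p] by (simp add: gap_def add.commute)
qed

section \<open>Kernels of single jumps and their local relations\<close>

definition step :: "series \<Rightarrow> (int set \<Rightarrow> bool) \<Rightarrow> (int set \<Rightarrow> int set) \<Rightarrow> (int set \<Rightarrow> series) \<Rightarrow>
    int set \<Rightarrow> int set \<Rightarrow> series" where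
  "step c D g wt i j = (if i \<in> M \<and> i = j then 1 else 0) +
     (if i \<in> M \<and> D i \<and> j = g i then c * wt i else 0)"

definition diag :: "(int set \<Rightarrow> series) \<Rightarrow> int set \<Rightarrow> int set \<Rightarrow> series" where
  "diag f i j = (if i \<in> M \<and> i = j then f i else 0)"

lemma step_kmult:
  assumes "i \<in> M" "j \<in> M" "D i \<Longrightarrow> g i \<in> M" "D i \<Longrightarrow> g i \<noteq> i"
  shows "(step c D g wt \<star> B) i j = B i j + (if D i then c * wt i * B (g i) j else 0)"
proof (cases "D i")
  case True
  then have "(step c D g wt \<star> B) i j = (\<Sum>l\<in>{i, g i}. step c D g wt i l * B l j)"
    using assms by (intro kmult_finite_support) (auto simp: step_def)
  also have "\<dots> = B i j + c * wt i * B (g i) j"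
    using True assms by (auto simp: step_def)
  finally show ?thesis using True by simp
next
  case False
  then have "(step c D g wt \<star> B) i j = (\<Sum>l\<in>{i}. step c D g wt i l * B l j)"
    using assms by (intro kmult_finite_support) (auto simp: step_def)
  then show ?thesis using False assms by (simp add: step_def)
qed

lemma band_step:
  assumes "ord_ge 1 c" "\<And>i. i \<in> M \<Longrightarrow> D i \<Longrightarrow> g i \<in> M" "\<And>i. i \<in> M \<Longrightarrow> D i \<Longrightarrow> gap i (g i) \<le> 1"
  shows "band (step c D g wt)"
  unfolding band_def
proof (intro allI conjI)
  fix i j
  show "i \<notin> M \<or> j \<notin> M \<longrightarrow> step c D g wt i j = 0" using assms(2) by (auto simp: step_def)
  have 1: "ord_ge (gap i j) (if i \<in> M \<and> i = j then 1 else 0)" by (simp add: gap_def)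
  have "ord_ge (1 + 0) (c * wt i)" using assms(1) by (rule ord_ge_mult) simp
  then have "ord_ge (gap i j) (if i \<in> M \<and> D i \<and> j = g i then c * wt i else 0)"
    using assms(3) by (auto intro: ord_ge_mono)
  with 1 show "ord_ge (gap i j) (step c D g wt i j)" unfolding step_def by (rule ord_ge_add)
qed

lemma band_diag: "band (diag f)"
  by (auto simp: band_def diag_def gap_def)

lemma diag_kmult: "i \<in> M \<Longrightarrow> j \<in> M \<Longrightarrow> (diag f \<star> B) i j = f i * B i j"
  by (subst kmult_finite_support[of _ _ "{i}"]) (auto simp: diag_def)

lemma kmult_diag:
  assumes "i \<in> M" "j \<in> M"
  shows "(B \<star> diag f) i j = B i j * f j"
proof -
  have "mfps_sum (\<lambda>l. B i l * diag f l j) M = (\<Sum>l\<in>{j}. B i l * diag f l j)"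
    by (rule mfps_sum_finite_support) (use assms in \<open>auto simp: diag_def\<close>)
  then show ?thesis using assms by (simp add: kmult_def diag_def)
qed

text \<open>The first index is the state after the jump: the off-diagonal entry at
  \<open>(i, j)\<close> has \<open>j = dn k p i\<close>. The weight \<open>same\<close> has the same
  value on both states, since neither \<open>p\<close> nor \<open>p + k\<close> lies in
  \<open>col_rest k p\<close>.\<close>

definition bstep :: "series \<Rightarrow> int \<Rightarrow> int set \<Rightarrow> int set \<Rightarrow> series" where
  "bstep y p = step y (can_dn k p) (dn k p) (\<lambda>i. tpow (int (same k p i)))"

definition astep :: "series \<Rightarrow> int \<Rightarrow> int set \<Rightarrow> int set \<Rightarrow> series" where
  "astep w p = step w (can_up k p) (up k p) (\<lambda>i. tpow (int (wrap k p i)))"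

lemma bstep_kmult:
  "i \<in> M \<Longrightarrow> j \<in> M \<Longrightarrow> (bstep y p \<star> B) i j =
    B i j + (if can_dn k p i then y * tpow (int (same k p i)) * B (dn k p i) j else 0)"
  unfolding bstep_def
  by (rule step_kmult; (erule (1) dn_closed)?) (auto simp: dn_def can_dn_def)

lemma astep_kmult:
  "i \<in> M \<Longrightarrow> j \<in> M \<Longrightarrow> (astep w p \<star> B) i j =
    B i j + (if can_up k p i then w * tpow (int (wrap k p i)) * B (up k p i) j else 0)"
  unfolding astep_def
  by (rule step_kmult; (erule (1) up_closed)?) (auto simp: up_def can_up_def)

lemma band_bstep: "ord_ge 1 y \<Longrightarrow> band (bstep y p)"
  unfolding bstep_def by (rule band_step) (auto intro: dn_closed simp: gap_dn[simplified])

lemma band_astep: "ord_ge 1 w \<Longrightarrow> band (astep w p)"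
  unfolding astep_def by (rule band_step) (auto intro: up_closed simp: gap_up[simplified])

text \<open>The range counted for \<open>p'\<close> contains an end of the jump at \<open>p\<close>
  exactly when the range counted for \<open>p\<close> contains the opposite end of the jump at
  \<open>p'\<close>. This symmetry balances the powers of \<open>t\<close> when two moves are
  interchanged.\<close>

lemma col_next_duality:
  "p \<in> col_rest k p' \<longleftrightarrow> p' + int k \<in> next_col k p"
  "p + int k \<in> col_rest k p' \<longleftrightarrow> p' \<in> next_col k p"
proof -
  let ?K = "int k"
  have K: "?K > 0" using k_pos by simp
  have div1: "x < (c + 1) * ?K \<longleftrightarrow> x div ?K \<le> c" for x c
    using K by (rule int_less_mult_iff_div)
  have div2: "c * ?K \<le> x \<longleftrightarrow> c \<le> x div ?K" for x c
    using div1[of x "c - 1"] by auto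
  have mono: "x \<le> y \<Longrightarrow> x div ?K \<le> y div ?K" for x y using K by (simp add: zdiv_mono1)
  have shift: "(x + ?K) div ?K = x div ?K + 1" for x using K by simp
  show "p \<in> col_rest k p' \<longleftrightarrow> p' + ?K \<in> next_col k p"
    unfolding col_rest_def next_col_def greaterThanLessThan_iff atLeastLessThan_iff div1 div2 shift
    by auto
  show "p + ?K \<in> col_rest k p' \<longleftrightarrow> p' \<in> next_col k p"
    unfolding col_rest_def next_col_def greaterThanLessThan_iff atLeastLessThan_iff div1 div2 shift
    by auto
qed

lemma finite_cols [simp]: "finite (col_rest k p)" "finite (next_col k p)"
  by (simp_all add: col_rest_def next_col_def)

text \<open>The resulting states agree, so only the weights could differ: the up move at
  \<open>p\<close> changes \<open>same\<close> at \<open>p'\<close>, the down move at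
  \<open>p'\<close> changes \<open>wrap\<close> at \<open>p\<close>, and by duality both change by
  the same amount.\<close>

lemma astep_bstep_commute:
  assumes "p \<noteq> p'" "ord_ge 1 y" "ord_ge 1 w"
  shows "astep w p \<star> bstep y p' = bstep y p' \<star> astep w p"
proof (intro ext)
  fix i j
  show "(astep w p \<star> bstep y p') i j = (bstep y p' \<star> astep w p) i j"
  proof (cases "i \<in> M \<and> j \<in> M")
    case True
    let ?both = "can_up k p i \<and> can_dn k p' (up k p i)"
    have both: "?both \<longleftrightarrow> can_dn k p' i \<and> can_up k p (dn k p' i)"
      using assms(1) by (auto simp: can_up_def can_dn_def up_def dn_def)
    have sets: "dn k p' (up k p i) = up k p (dn k p' i)" if ?both
      using that assms(1) by (auto simp: can_up_def can_dn_def up_def dn_def)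
    have wt: "int (wrap k p i) + int (same k p' (up k p i)) =
        int (same k p' i) + int (wrap k p (dn k p' i))" if b: ?both
    proof -
      have 1: "int (same k p' (up k p i)) = int (same k p' i) -
          (if p \<in> col_rest k p' then 1 else 0) + (if p + int k \<in> col_rest k p' then 1 else 0)"
        unfolding same_def up_def by (rule card_move) (use b in \<open>auto simp: can_up_def\<close>)
      have 2: "int (wrap k p (dn k p' i)) = int (wrap k p i) -
          (if p' + int k \<in> next_col k p then 1 else 0) + (if p' \<in> next_col k p then 1 else 0)"
        unfolding wrap_def dn_def by (rule card_move) (use b both in \<open>auto simp: can_dn_def\<close>)
      show ?thesis using 1 2 col_next_duality[of p p'] by simp
    qed
    have wt': "tpow (int (wrap k p i)) * tpow (int (same k p' (up k p i))) =
        tpow (int (same k p' i)) * tpow (int (wrap k p (dn k p' i)))" if ?both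
      using wt[OF that] by (simp add: tpow_add[symmetric])
    have M: "can_up k p i \<Longrightarrow> up k p i \<in> M" "can_dn k p' i \<Longrightarrow> dn k p' i \<in> M"
      using True by (auto intro: up_closed dn_closed)
    have L: "(astep w p \<star> bstep y p') i j = (if i = j then 1 else 0) +
       (if can_dn k p' i \<and> j = dn k p' i then y * tpow (int (same k p' i)) else 0) +
       (if can_up k p i \<and> j = up k p i then w * tpow (int (wrap k p i)) else 0) +
       (if ?both \<and> j = dn k p' (up k p i) then
          w * y * (tpow (int (wrap k p i)) * tpow (int (same k p' (up k p i)))) else 0)"
      using True M by (auto simp: astep_kmult bstep_def step_def algebra_simps)
    have R: "(bstep y p' \<star> astep w p) i j = (if i = j then 1 else 0) +
       (if can_dn k p' i \<and> j = dn k p' i then y * tpow (int (same k p' i)) else 0) +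
       (if can_up k p i \<and> j = up k p i then w * tpow (int (wrap k p i)) else 0) +
       (if (can_dn k p' i \<and> can_up k p (dn k p' i)) \<and> j = up k p (dn k p' i) then
          w * y * (tpow (int (same k p' i)) * tpow (int (wrap k p (dn k p' i)))) else 0)"
      using True M by (auto simp: bstep_kmult astep_def step_def algebra_simps)
    show ?thesis unfolding L R both[symmetric] using sets wt' by auto
  qed (auto simp: kmult_def)
qed

definition winfac :: "series \<Rightarrow> int \<Rightarrow> int set \<Rightarrow> series" where
  "winfac s p i = qfac s (card (i \<inter> {p..<p + int k}))"

text \<open>Sliding the window by one trades \<open>p\<close> for \<open>p + k\<close> and keeps the
  positions in between, which are the ones that jumps at \<open>p\<close> overtake.\<close>

lemma card_window:
  "card (i \<inter> {p..<p + int k}) = (if p \<in> i then 1 else 0) + (same k p i + wrap k p i)"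
  "card (i \<inter> {p + 1..<p + 1 + int k}) = (if p + int k \<in> i then 1 else 0) + (same k p i + wrap k p i)"
proof -
  let ?K = "int k" and ?b = "(p div int k + 1) * int k"
  have K: "?K > 0" using k_pos by simp
  have b: "p < ?b" "?b \<le> p + ?K"
    using int_less_mult_iff_div[OF K, of p "p div ?K"] int_less_mult_iff_div[OF K, of p "p div ?K - 1"]
    by (simp_all add: algebra_simps)
  have "i \<inter> {p<..<p + ?K} = (i \<inter> col_rest k p) \<union> (i \<inter> next_col k p)"
    using b by (auto simp: col_rest_def next_col_def)
  moreover have "(i \<inter> col_rest k p) \<inter> (i \<inter> next_col k p) = {}"
    by (auto simp: col_rest_def next_col_def)
  ultimately have m: "card (i \<inter> {p<..<p + ?K}) = same k p i + wrap k p i"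
    by (simp add: card_Un_disjoint same_def wrap_def)
  have "{p..<p + ?K} = insert p {p<..<p + ?K}" using K by auto
  then have "i \<inter> {p..<p + ?K} = (if p \<in> i then insert p (i \<inter> {p<..<p + ?K}) else i \<inter> {p<..<p + ?K})"
    by auto
  then show "card (i \<inter> {p..<p + ?K}) = (if p \<in> i then 1 else 0) + (same k p i + wrap k p i)"
    using m by simp
  have "{p + 1..<p + 1 + ?K} = insert (p + ?K) {p<..<p + ?K}" using K by auto
  then have "i \<inter> {p + 1..<p + 1 + ?K} =
      (if p + ?K \<in> i then insert (p + ?K) (i \<inter> {p<..<p + ?K}) else i \<inter> {p<..<p + ?K})"
    by auto
  then show "card (i \<inter> {p + 1..<p + 1 + ?K}) = (if p + ?K \<in> i then 1 else 0) + (same k p i + wrap k p i)"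
    using m by simp
qed

text \<open>On a state and its neighbour under a jump at \<open>p\<close> this is a two by two
  identity. Going there and back contributes \<open>y w t^r\<close>, where \<open>r\<close> counts
  the particles strictly between \<open>p\<close> and \<open>p + k\<close>. On one side the
  excursion starts upwards, on the other downwards, and the missing factor
  \<open>1 + y w t^r\<close> is the quotient of the two window factors.\<close>

lemma local_exchange:
  assumes y: "ord_ge 1 y" and w: "ord_ge 1 w"
  shows "astep w p \<star> (bstep y p \<star> diag (winfac (y * w) (p + 1))) =
    diag (winfac (y * w) p) \<star> (bstep y p \<star> astep w p)"
proof (intro ext)
  fix i j
  let ?Q = "winfac (y * w)"
  show "(astep w p \<star> (bstep y p \<star> diag (?Q (p + 1)))) i j =
    (diag (?Q p) \<star> (bstep y p \<star> astep w p)) i j"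
  proof (cases "i \<in> M \<and> j \<in> M")
    case True
    then have M: "can_up k p i \<Longrightarrow> up k p i \<in> M" "can_dn k p i \<Longrightarrow> dn k p i \<in> M"
      by (auto intro: up_closed dn_closed)
    have K: "int k > 0" using k_pos by simp
    \<comment> \<open>Both ends of the jump lie outside the two counted ranges, so jumps at
      \<open>p\<close> leave their own weights unchanged.\<close>
    have nin: "p \<notin> col_rest k p" "p + int k \<notin> col_rest k p" "p \<notin> next_col k p" "p + int k \<notin> next_col k p"
      using int_less_mult_iff_div[OF K, of p "p div int k"] K
        int_less_mult_iff_div[OF K, of p "p div int k - 1"]
      by (auto simp: col_rest_def next_col_def algebra_simps)
    have inv: "S \<inter> col_rest k p = S' \<inter> col_rest k p \<and> S \<inter> next_col k p = S' \<inter> next_col k p"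
      if "S' = up k p S \<or> S' = dn k p S" for S S'
      using that nin by (auto simp: up_def dn_def)
    have st: "same k p (up k p i) = same k p i" "wrap k p (up k p i) = wrap k p i"
      "same k p (dn k p i) = same k p i" "wrap k p (dn k p i) = wrap k p i"
      using inv by (metis same_def wrap_def)+
    note L = True M astep_kmult bstep_kmult diag_kmult
    have win: "?Q p S = qfac (y * w) ((if p \<in> S then 1 else 0) + (same k p S + wrap k p S))"
      "?Q (p + 1) S = qfac (y * w) ((if p + int k \<in> S then 1 else 0) + (same k p S + wrap k p S))" for S
      by (simp_all only: winfac_def card_window(1)[of S p] card_window(2))
    have q: "qfac (y * w) (Suc n) = qfac (y * w) n * (1 + y * w * tpow (int n))" for n
      by (simp add: qfac_def)
    show ?thesis
    proof (cases "can_up k p i")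
      case up: True
      let ?n = "same k p i + wrap k p i"
      have c: "\<not> can_dn k p i" "can_dn k p (up k p i)" "dn k p (up k p i) = i" "up k p i \<noteq> i"
        "p \<in> i" "p + int k \<notin> i" "p \<notin> up k p i" "p + int k \<in> up k p i"
        using up K by (auto simp: can_up_def can_dn_def up_def dn_def)
      have 1: "(astep w p \<star> (bstep y p \<star> diag (?Q (p + 1)))) i j =
          (if i = j then ?Q (p + 1) i * (1 + y * w * tpow (int ?n)) else 0) +
          (if j = up k p i then w * tpow (int (wrap k p i)) * ?Q (p + 1) (up k p i) else 0)"
        using up c L st by (auto simp: diag_def tpow_add algebra_simps)
      have 2: "(diag (?Q p) \<star> (bstep y p \<star> astep w p)) i j =
          ?Q p i * ((if i = j then 1 else 0) +
          (if j = up k p i then w * tpow (int (wrap k p i)) else 0))"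
        using up c L st by (auto simp: astep_def step_def)
      have x: "?Q (p + 1) i = qfac (y * w) ?n" "?Q p i = qfac (y * w) (Suc ?n)"
        "?Q (p + 1) (up k p i) = qfac (y * w) (Suc ?n)"
        using c st by (simp_all add: win)
      show ?thesis unfolding 1 2 x q using c(4) by (cases "i = j") (auto simp: mult_ac)
    next
      case nup: False
      show ?thesis
      proof (cases "can_dn k p i")
        case dn: True
        let ?n = "same k p i + wrap k p i"
        have c: "can_up k p (dn k p i)" "up k p (dn k p i) = i" "dn k p i \<noteq> i"
          "p \<notin> i" "p + int k \<in> i" "p \<in> dn k p i" "p + int k \<notin> dn k p i"
          using dn K by (auto simp: can_up_def can_dn_def up_def dn_def)
        have 1: "(astep w p \<star> (bstep y p \<star> diag (?Q (p + 1)))) i j =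
          (if i = j then ?Q (p + 1) i else 0) +
          (if j = dn k p i then y * tpow (int (same k p i)) * ?Q (p + 1) (dn k p i) else 0)"
          using nup dn c L st by (auto simp: diag_def)
        have 2: "(diag (?Q p) \<star> (bstep y p \<star> astep w p)) i j =
          ?Q p i * ((if i = j then 1 + y * w * tpow (int ?n) else 0) +
          (if j = dn k p i then y * tpow (int (same k p i)) else 0))"
          using nup dn c L st by (auto simp: astep_def step_def tpow_add algebra_simps)
        have x: "?Q (p + 1) i = qfac (y * w) (Suc ?n)" "?Q p i = qfac (y * w) ?n"
          "?Q (p + 1) (dn k p i) = qfac (y * w) ?n"
          using c st by (simp_all add: win)
        show ?thesis unfolding 1 2 x q using c(3) by (cases "i = j") (auto simp: mult_ac)
      next
        case ndn: False
        have "p \<in> i \<longleftrightarrow> p + int k \<in> i" using nup ndn by (auto simp: can_up_def can_dn_def)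
        then have "?Q p i = ?Q (p + 1) i" by (simp add: win)
        then show ?thesis using nup ndn L by (auto simp: diag_def astep_def step_def)
      qed
    qed
  qed (auto simp: kmult_def)
qed

section \<open>Ordered products over finitely many positions\<close>

definition Bs :: "series \<Rightarrow> int list \<Rightarrow> int set \<Rightarrow> int set \<Rightarrow> series" where
  "Bs y ps = foldr (\<lambda>p B. bstep y p \<star> B) ps kid"

definition As :: "series \<Rightarrow> int list \<Rightarrow> int set \<Rightarrow> int set \<Rightarrow> series" where
  "As w ps = foldr (\<lambda>p B. astep w p \<star> B) ps kid"

lemma Bs_simps [simp]: "Bs y [] = kid" "Bs y (p # ps) = bstep y p \<star> Bs y ps"
  and As_simps [simp]: "As w [] = kid" "As w (p # ps) = astep w p \<star> As w ps"
  by (simp_all add: Bs_def As_def)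

lemma band_Bs: "ord_ge 1 y \<Longrightarrow> band (Bs y ps)"
  by (induction ps) (simp_all add: band_kid band_kmult band_bstep[simplified])

lemma band_As: "ord_ge 1 w \<Longrightarrow> band (As w ps)"
  by (induction ps) (simp_all add: band_kid band_kmult band_astep[simplified])

lemma Bs_append: "ord_ge 1 y \<Longrightarrow> Bs y (ps @ qs) = Bs y ps \<star> Bs y qs"
  by (induction ps) (simp_all add: kmult_kid_left band_Bs[simplified] kmult_assoc band_bstep[simplified])

lemma As_append: "ord_ge 1 y \<Longrightarrow> As y (ps @ qs) = As y ps \<star> As y qs"
  by (induction ps) (simp_all add: kmult_kid_left band_As[simplified] kmult_assoc band_astep[simplified])

lemma Bs_eq_kp: "i \<in> M \<Longrightarrow> j \<in> M \<Longrightarrow> Bs y ps i j = kp k y ps i j"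
proof (induction ps arbitrary: i)
  case (Cons p ps)
  then show ?case using dn_closed[OF Cons.prems(1), of p] by (simp add: bstep_kmult)
qed (simp add: kid_def)

lemma bstep_As_commute:
  assumes "ord_ge 1 y" "ord_ge 1 w" "p \<notin> set ps"
  shows "As w ps \<star> bstep y p = bstep y p \<star> As w ps"
  using assms(3)
proof (induction ps)
  case Nil
  then show ?case using assms by (simp add: kmult_kid_left kmult_kid_right band_bstep)
next
  case (Cons q ps)
  note b = band_bstep[OF assms(1)] band_astep[OF assms(2)] band_As[OF assms(2)]
  have "As w (q # ps) \<star> bstep y p = astep w q \<star> (As w ps \<star> bstep y p)"
    by (simp add: b kmult_assoc)
  also have "\<dots> = (astep w q \<star> bstep y p) \<star> As w ps"
    using Cons b by (simp add: kmult_assoc)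
  also have "\<dots> = (bstep y p \<star> astep w q) \<star> As w ps"
    using Cons.prems assms by (subst astep_bstep_commute) auto
  finally show ?case by (simp add: b kmult_assoc)
qed

lemma astep_Bs_commute:
  assumes "ord_ge 1 y" "ord_ge 1 w" "p \<notin> set ps"
  shows "astep w p \<star> Bs y ps = Bs y ps \<star> astep w p"
  using assms(3)
proof (induction ps)
  case Nil
  then show ?case using assms by (simp add: kmult_kid_left kmult_kid_right band_astep)
next
  case (Cons q ps)
  note b = band_bstep[OF assms(1)] band_astep[OF assms(2)] band_Bs[OF assms(1)]
  have "astep w p \<star> Bs y (q # ps) = (astep w p \<star> bstep y q) \<star> Bs y ps"
    by (simp add: b kmult_assoc)
  also have "\<dots> = (bstep y q \<star> astep w p) \<star> Bs y ps"
    using Cons.prems assms by (subst astep_bstep_commute) auto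
  also have "\<dots> = bstep y q \<star> (Bs y ps \<star> astep w p)"
    using Cons b by (simp add: kmult_assoc)
  finally show ?case by (simp add: b kmult_assoc)
qed

text \<open>Peel off the lowest position. Its \<open>f\<close> factor commutes with the
  \<open>e\<close> factors of the higher positions and its \<open>e\<close> factor with their
  \<open>f\<close> factors, which brings the pair together; \<open>local_exchange\<close> then
  carries the diagonal one position to the left.\<close>

lemma window_exchange:
  assumes y: "ord_ge 1 y" and w: "ord_ge 1 w" and "lo \<le> hi + 1"
  shows "As w [lo..hi] \<star> (Bs y [lo..hi] \<star> diag (winfac (y * w) (hi + 1))) =
    diag (winfac (y * w) lo) \<star> (Bs y [lo..hi] \<star> As w [lo..hi])"
  using assms(3)
proof (induction lo hi rule: upto.induct)
  case (1 lo hi)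
  show ?case
  proof (cases "lo \<le> hi")
    case True
    let ?A = "As w [lo + 1..hi]" and ?B = "Bs y [lo + 1..hi]" and ?D = "\<lambda>p. diag (winfac (y * w) p)"
      and ?a = "astep w lo" and ?b = "bstep y lo"
    note b = band_As[OF w] band_Bs[OF y] band_diag band_astep[OF w] band_bstep[OF y] band_kmult
    have eq: "[lo..hi] = lo # [lo + 1..hi]" using True by (simp add: upto_rec1)
    have "As w [lo..hi] \<star> (Bs y [lo..hi] \<star> ?D (hi + 1)) = ?a \<star> ((?A \<star> ?b) \<star> (?B \<star> ?D (hi + 1)))"
      by (simp add: b eq kmult_assoc)
    also have "?A \<star> ?b = ?b \<star> ?A" by (rule bstep_As_commute[OF y w]) simp
    also have "?a \<star> ((?b \<star> ?A) \<star> (?B \<star> ?D (hi + 1))) = ?a \<star> (?b \<star> (?A \<star> (?B \<star> ?D (hi + 1))))"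
      by (simp add: b kmult_assoc)
    also have "?A \<star> (?B \<star> ?D (hi + 1)) = ?D (lo + 1) \<star> (?B \<star> ?A)"
      using 1 True by simp
    also have "?a \<star> (?b \<star> (?D (lo + 1) \<star> (?B \<star> ?A))) = (?a \<star> (?b \<star> ?D (lo + 1))) \<star> (?B \<star> ?A)"
      by (simp add: b kmult_assoc)
    also have "?a \<star> (?b \<star> ?D (lo + 1)) = ?D lo \<star> (?b \<star> ?a)"
      by (rule local_exchange[OF y w])
    also have "?D lo \<star> (?b \<star> ?a) \<star> (?B \<star> ?A) = ?D lo \<star> (?b \<star> ((?a \<star> ?B) \<star> ?A))"
      by (simp add: b kmult_assoc)
    also have "?a \<star> ?B = ?B \<star> ?a" by (rule astep_Bs_commute[OF y w]) simp
    also have "?D lo \<star> (?b \<star> ((?B \<star> ?a) \<star> ?A)) = ?D lo \<star> (Bs y [lo..hi] \<star> As w [lo..hi])"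
      by (simp add: b eq kmult_assoc)
    finally show ?thesis .
  next
    case False
    then have "lo = hi + 1" using 1 by simp
    then show ?thesis by (simp add: kmult_kid_left kmult_kid_right band_kid band_diag)
  qed
qed

lemma bstep_inverse: "ord_ge 1 x \<Longrightarrow> bstep (- x) p \<star> bstep x p = kid"
proof (intro ext)
  fix i j
  show "(bstep (- x) p \<star> bstep x p) i j = kid i j"
  proof (cases "i \<in> M \<and> j \<in> M")
    case True
    have "\<not> can_dn k p (dn k p i)" by (simp add: can_dn_def dn_def)
    then show ?thesis
      using True dn_closed[of i p]
      by (simp add: bstep_kmult) (auto simp: bstep_def step_def kid_def)
  qed (auto simp: kmult_def kid_def)
qed

lemma Bs_inverse:
  assumes "ord_ge 1 x"
  shows "Bs (- x) ps \<star> Bs x (rev ps) = kid"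
proof (induction ps)
  case (Cons p ps)
  note b = band_Bs[OF assms] band_Bs[OF ord_ge_uminus[OF assms]] band_bstep[OF assms]
    band_bstep[OF ord_ge_uminus[OF assms]] band_kid band_kmult
  have "Bs (- x) (p # ps) \<star> Bs x (rev (p # ps)) =
      bstep (- x) p \<star> ((Bs (- x) ps \<star> Bs x (rev ps)) \<star> bstep x p)"
    by (simp add: b Bs_append assms[simplified] kmult_assoc kmult_kid_right)
  also have "\<dots> = kid" unfolding Cons.IH by (simp add: b kmult_kid_left bstep_inverse assms[simplified])
  finally show ?case .
qed (simp add: kmult_kid_left band_kid)

section \<open>Rows as products over all positions\<close>

definition row_bound :: "int set \<Rightarrow> nat" where
  "row_bound i = (LEAST r. fits k r r i)"

lemma fits_row_bound: "i \<in> M \<Longrightarrow> fits k (row_bound i) (row_bound i) i"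
  unfolding row_bound_def using ex_fits by (rule LeastI_ex)

text \<open>The purple row as an infinite ascending product. Moves are performed on the first index,
  so the window is chosen for \<open>i\<close>; by \<open>kp_pos_stable\<close> every larger window
  gives the same entry.\<close>

definition Vk :: "series \<Rightarrow> int set \<Rightarrow> int set \<Rightarrow> series" where
  "Vk y i j = (if i \<in> M \<and> j \<in> M then kp k y (pos k (row_bound i) (row_bound i)) i j else 0)"

definition Uk :: "series \<Rightarrow> int set \<Rightarrow> int set \<Rightarrow> series" where
  "Uk x i j = (if i \<in> M \<and> j \<in> M then kp k x (rev (pos k (row_bound i) (row_bound i))) i j else 0)"

lemma Vk_eq: "i \<in> M \<Longrightarrow> j \<in> M \<Longrightarrow> fits k L N i \<Longrightarrow> Vk y i j = kp k y (pos k L N) i j"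
  and Uk_eq: "i \<in> M \<Longrightarrow> j \<in> M \<Longrightarrow> fits k L N i \<Longrightarrow> Uk y i j = kp k y (rev (pos k L N)) i j"
  using kp_pos_stable[OF fits_row_bound, of i "max L (row_bound i)" "max N (row_bound i)"]
    kp_pos_stable[of k L N i "max L (row_bound i)" "max N (row_bound i)"]
  by (simp_all add: Vk_def Uk_def)

lemma eventually_Bs:
  "\<forall>\<^sub>F r in sequentially. Bs y (pos k r r) i j = Vk y i j"
  "\<forall>\<^sub>F r in sequentially. Bs y (rev (pos k r r)) i j = Uk y i j"
  if "ord_ge 1 y"
proof -
  have "Bs y (pos k r r) i j = Vk y i j \<and> Bs y (rev (pos k r r)) i j = Uk y i j"
    if "row_bound i \<le> r" for r
  proof (cases "i \<in> M \<and> j \<in> M")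
    case True
    then have "fits k r r i" using fits_row_bound fits_mono that by blast
    with True show ?thesis using Vk_eq Uk_eq by (simp add: Bs_eq_kp)
  next
    case False
    then show ?thesis using band_zero[OF band_Bs[OF \<open>ord_ge 1 y\<close>]] by (auto simp: Vk_def Uk_def)
  qed
  then show "\<forall>\<^sub>F r in sequentially. Bs y (pos k r r) i j = Vk y i j"
    "\<forall>\<^sub>F r in sequentially. Bs y (rev (pos k r r)) i j = Uk y i j"
    by (auto simp: eventually_sequentially)
qed

text \<open>Every entry agrees with an entry of a finite product, for which the order bound is
  known.\<close>

lemma band_Vk: "ord_ge 1 y \<Longrightarrow> band (Vk y)"
  and band_Uk: "ord_ge 1 y \<Longrightarrow> band (Uk y)"
proof -
  assume y: "ord_ge 1 y"
  have "ord_ge (gap i j) (Vk y i j) \<and> ord_ge (gap i j) (Uk y i j)" for i j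
  proof -
    obtain r where "Bs y (pos k r r) i j = Vk y i j" "Bs y (rev (pos k r r)) i j = Uk y i j"
      using eventually_happens'[OF sequentially_bot
          eventually_conj[OF eventually_Bs(1)[OF y, of i j] eventually_Bs(2)[OF y, of i j]]] by blast
    then show ?thesis using band_ord[OF band_Bs[OF y]] by metis
  qed
  then show "band (Vk y)" "band (Uk y)" by (auto simp: band_def Vk_def Uk_def)
qed

lemma tr_eq_eventually:
  assumes "\<forall>\<^sub>F r in sequentially. tr_eq n (F r) a" "\<forall>\<^sub>F r in sequentially. tr_eq n (G r) b"
    "\<forall>\<^sub>F r in sequentially. F r = G r"
  shows "tr_eq n a b"
proof -
  have "\<forall>\<^sub>F r in sequentially. tr_eq n a b"
    using assms by eventually_elim (metis tr_eq_sym tr_eq_trans)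
  then show ?thesis by simp
qed

lemma kmult_limit_kid:
  assumes "\<And>r. band (A r)" "\<And>r. band (B r)" "band A'" "band B'"
    and "\<And>i j. \<forall>\<^sub>F r in sequentially. A r i j = A' i j"
    and "\<And>i j. \<forall>\<^sub>F r in sequentially. B r i j = B' i j"
    and "\<And>r. A r \<star> B r = kid"
  shows "A' \<star> B' = kid"
proof (intro ext mfps_eqI_tr, rule tr_eq_eventually)
  fix i j n
  show "\<forall>\<^sub>F r in sequentially. tr_eq n ((A r \<star> B r) i j) ((A' \<star> B') i j)"
    by (intro kmult_limit assms)
  show "\<forall>\<^sub>F r in sequentially. tr_eq n (kid i j) (kid i j)" by simp
  show "\<forall>\<^sub>F r in sequentially. (A r \<star> B r) i j = kid i j" by (simp add: assms(7))
qed

lemma Vk_Uk_inverse: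
  assumes x: "ord_ge 1 x"
  shows "Vk (- x) \<star> Uk x = kid" "Uk x \<star> Vk (- x) = kid"
proof -
  note x' = ord_ge_uminus[OF x]
  note b = band_Bs[OF x] band_Bs[OF x'] band_Uk[OF x] band_Vk[OF x'] eventually_Bs(2)[OF x]
    eventually_Bs(1)[OF x']
  show "Vk (- x) \<star> Uk x = kid"
    by (rule kmult_limit_kid[OF b(2,1,4,3,6,5)]) (rule Bs_inverse[OF x])
  show "Uk x \<star> Vk (- x) = kid"
    by (rule kmult_limit_kid[OF b(1,2,3,4,5,6)])
      (use Bs_inverse[OF x', of "rev (pos k r r)" for r] in simp)
qed

text \<open>Row 1 is the lowest and the first index of a kernel is the upper state, so later rows
  multiply from the left.\<close>

primrec kprod :: "(nat \<Rightarrow> int set \<Rightarrow> int set \<Rightarrow> series) \<Rightarrow> nat \<Rightarrow> int set \<Rightarrow> int set \<Rightarrow> series" where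
  "kprod A 0 = kid"
| "kprod A (Suc r) = A (Suc r) \<star> kprod A r"

lemma band_kprod: "(\<And>r. r \<in> {1..R} \<Longrightarrow> band (A r)) \<Longrightarrow> band (kprod A R)"
  by (induction R) (auto intro: band_kid band_kmult)

end

section \<open>Twisted transposes and the exchange of rows\<close>

locale moves_adj = moves +
  fixes dd :: "int set \<Rightarrow> int set \<Rightarrow> int"
  assumes dd_cocycle: "\<lbrakk>i \<in> M; j \<in> M; l \<in> M\<rbrakk> \<Longrightarrow> dd i j = dd i l + dd l j"
    and dd_up: "\<lbrakk>i \<in> M; can_up k p i\<rbrakk> \<Longrightarrow> dd i (up k p i) = int (wrap k p i) - int (same k p i)"
begin

abbreviation dual :: "(int set \<Rightarrow> int set \<Rightarrow> series) \<Rightarrow> int set \<Rightarrow> int set \<Rightarrow> series" where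
  "dual \<equiv> adj (\<lambda>i j. tpow (dd i j))"

lemma dd_refl: "i \<in> M \<Longrightarrow> dd i i = 0"
  using dd_cocycle[of i i i] by simp

lemma dual_kmult: "band A \<Longrightarrow> band B \<Longrightarrow> dual (A \<star> B) = dual B \<star> dual A"
  by (rule adj_kmult) (metis dd_cocycle tpow_add)+

lemma dual_kid: "dual kid = kid"
  by (intro ext) (auto simp: adj_def kid_def dd_refl)

text \<open>The value of \<open>dd\<close> on a single jump is exactly the difference of exponents
  that turns the weight \<open>same\<close> of the transposed jump into \<open>wrap\<close>.\<close>

lemma dual_bstep: "dual (bstep w p) = astep w p"
proof (intro ext)
  fix i j
  have K: "int k > 0" using k_pos by simp
  have 1: "(j \<in> M \<and> can_dn k p j \<and> i = dn k p j) \<longleftrightarrow> (i \<in> M \<and> can_up k p i \<and> j = up k p i)"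
  proof
    assume *: "j \<in> M \<and> can_dn k p j \<and> i = dn k p j"
    then show "i \<in> M \<and> can_up k p i \<and> j = up k p i"
      using K dn_closed[of j p] by (auto simp: can_dn_def can_up_def dn_def up_def)
  next
    assume *: "i \<in> M \<and> can_up k p i \<and> j = up k p i"
    then show "j \<in> M \<and> can_dn k p j \<and> i = dn k p j"
      using K up_closed[of i p] by (auto simp: can_dn_def can_up_def dn_def up_def)
  qed
  have 2: "tpow (dd i (up k p i)) * (w * tpow (int (same k p (up k p i)))) = w * tpow (int (wrap k p i))"
    if "i \<in> M" "can_up k p i"
  proof -
    have "p \<notin> col_rest k p" "p + int k \<notin> col_rest k p"
      using int_less_mult_iff_div[OF K, of "p + int k" "p div int k"] K
      by (auto simp: col_rest_def)
    then have "same k p (up k p i) = same k p i"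
      unfolding same_def up_def by (intro arg_cong[where f = card]) auto
    then have "tpow (dd i (up k p i)) * tpow (int (same k p (up k p i))) = tpow (int (wrap k p i))"
      using dd_up[OF that] by (simp add: tpow_add[symmetric])
    then show ?thesis by (metis mult.left_commute)
  qed
  show "dual (bstep w p) i j = astep w p i j"
    using 1 2 dd_refl by (auto simp: adj_def bstep_def astep_def step_def distrib_left)
qed

text \<open>Transposition reverses the order of the factors, so the dual of a descending white
  product ascends, as a purple row does.\<close>

lemma dual_Bs: "ord_ge 1 w \<Longrightarrow> dual (Bs w ps) = As w (rev ps)"
proof (induction ps)
  case (Cons p ps)
  then show ?case
    using kmult_kid_right[OF band_astep[OF Cons.prems]]
    by (simp add: dual_kmult band_bstep[simplified] band_Bs[simplified] dual_bstep As_append)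
qed (simp add: dual_kid)

text \<open>The limit of \<open>window_exchange\<close>. The diagonal at the left end acts on
  \<open>i\<close>, where the column is full, and contributes the scalar; the one at the right end
  acts on \<open>j\<close>, where the column is empty, and contributes 1.\<close>

lemma dual_exchange:
  assumes y: "ord_ge 1 y" and w: "ord_ge 1 w"
  shows "dual (Uk w) \<star> Vk y = smult (qfac (y * w) k) (Vk y \<star> dual (Uk w))"
proof (intro ext mfps_eqI_tr)
  fix i j n
  note b = band_Bs[OF y] band_As[OF w] band_Vk[OF y] band_adj[OF band_Uk[OF w]]
  have evA: "\<forall>\<^sub>F r in sequentially. As w (pos k r r) i j = dual (Uk w) i j" for i j
  proof -
    have "\<forall>\<^sub>F r in sequentially. Bs w (rev (pos k r r)) j i = Uk w j i"
      by (rule eventually_Bs[OF w])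
    then show ?thesis
    proof eventually_elim
      case (elim r)
      have "As w (pos k r r) = dual (Bs w (rev (pos k r r)))" using w by (simp add: dual_Bs)
      then show ?case using elim by (simp add: adj_def)
    qed
  qed
  show "tr_eq n ((dual (Uk w) \<star> Vk y) i j) (smult (qfac (y * w) k) (Vk y \<star> dual (Uk w)) i j)"
  proof (cases "i \<in> M \<and> j \<in> M")
    case True
    show ?thesis
    proof (rule tr_eq_eventually)
      show "\<forall>\<^sub>F r in sequentially. tr_eq n ((As w (pos k r r) \<star> Bs y (pos k r r)) i j)
          ((dual (Uk w) \<star> Vk y) i j)"
        by (intro kmult_limit b evA eventually_Bs y)
      have "\<forall>\<^sub>F r in sequentially. tr_eq n ((Bs y (pos k r r) \<star> As w (pos k r r)) i j)
          ((Vk y \<star> dual (Uk w)) i j)"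
        by (intro kmult_limit b evA eventually_Bs y)
      then show "\<forall>\<^sub>F r in sequentially.
          tr_eq n (qfac (y * w) k * (Bs y (pos k r r) \<star> As w (pos k r r)) i j)
            (smult (qfac (y * w) k) (Vk y \<star> dual (Uk w)) i j)"
        unfolding smult_def by eventually_elim (intro tr_eq_mult tr_eq_refl)
      show "\<forall>\<^sub>F r in sequentially. (As w (pos k r r) \<star> Bs y (pos k r r)) i j =
          qfac (y * w) k * (Bs y (pos k r r) \<star> As w (pos k r r)) i j"
        unfolding eventually_sequentially
      proof (intro exI allI impI)
        \<comment> \<open>The extra 1 puts column \<open>- r\<close>, the first of the window, to
          the left of the window fitting \<open>i\<close>, where every position is occupied.\<close>
        fix r assume r: "row_bound i + row_bound j + 1 \<le> r"
        define lo hi where "lo = - int r * int k" and "hi = (int r + 1) * int k - 1"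
        have p: "pos k r r = [lo..hi]" by (simp add: pos_def lo_def hi_def)
        have K: "int k > 0" using k_pos by simp
        have "int r * int k \<ge> 0" by simp
        then have lohi: "lo \<le> hi + 1" using K by (simp add: lo_def hi_def algebra_simps)
        have "fits k r r i" "fits k (r - 1) r i" "fits k r r j"
          using True r fits_mono[OF fits_row_bound, of i] fits_mono[OF fits_row_bound, of j] by auto
        then have full: "i \<inter> {lo..<lo + int k} = {lo..<lo + int k}"
          and empty: "j \<inter> {hi + 1..<hi + 1 + int k} = {}"
          using r by (auto simp: fits_def lo_def hi_def of_nat_diff algebra_simps)
        have "(As w (pos k r r) \<star> Bs y (pos k r r)) i j =
            (As w (pos k r r) \<star> Bs y (pos k r r)) i j * winfac (y * w) (hi + 1) j"
          by (simp add: winfac_def empty qfac_def)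
        also have "\<dots> = (As w [lo..hi] \<star> (Bs y [lo..hi] \<star> diag (winfac (y * w) (hi + 1)))) i j"
          using True by (simp add: b p kmult_assoc[symmetric] band_diag kmult_diag)
        also have "\<dots> = (diag (winfac (y * w) lo) \<star> (Bs y [lo..hi] \<star> As w [lo..hi])) i j"
          by (simp only: window_exchange[OF y w lohi])
        also have "\<dots> = qfac (y * w) k * (Bs y (pos k r r) \<star> As w (pos k r r)) i j"
          using True by (simp add: p diag_kmult winfac_def full)
        finally show "(As w (pos k r r) \<star> Bs y (pos k r r)) i j =
          qfac (y * w) k * (Bs y (pos k r r) \<star> As w (pos k r r)) i j" .
      qed
    qed
  qed (auto simp: kmult_def smult_def)
qed

text \<open>Commutation up to the scalar \<open>num / den\<close>, kept as two series so that rows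
  can be composed and inverted without dividing.\<close>

definition exch :: "series \<Rightarrow> series \<Rightarrow> (int set \<Rightarrow> int set \<Rightarrow> series) \<Rightarrow>
    (int set \<Rightarrow> int set \<Rightarrow> series) \<Rightarrow> bool" where
  "exch num den R L \<longleftrightarrow> smult den (R \<star> L) = smult num (L \<star> R)"

lemma exch_V_U:
  assumes "ord_ge 1 y" "ord_ge 1 w"
  shows "exch 1 (qfac (y * w) k) (Vk y) (dual (Uk w))"
  using dual_exchange[OF assms] by (simp add: exch_def)

text \<open>Insert the inverse purple row: \<open>U D = U (D V) U\<close> with \<open>V\<close>
  inverse to \<open>U\<close>; exchange \<open>D\<close> with \<open>V\<close> and cancel
  \<open>U V\<close>. The sign in the scalar comes from the parameter \<open>- x\<close> of
  \<open>V\<close>.\<close>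

lemma exch_U_U:
  assumes x: "ord_ge 1 x" and w: "ord_ge 1 w"
  shows "exch (qfac (- (x * w)) k) 1 (Uk x) (dual (Uk w))"
proof -
  let ?U = "Uk x" and ?V = "Vk (- x)" and ?D = "dual (Uk w)"
  note b = band_Uk[OF x] band_Vk[OF ord_ge_uminus[OF x]] band_adj[OF band_Uk[OF w]] band_kmult
    band_smult band_kid
  have "?U \<star> ?D = ?U \<star> ((?D \<star> ?V) \<star> ?U)"
    by (simp add: b kmult_assoc Vk_Uk_inverse[OF x] kmult_kid_right)
  also have "\<dots> = smult (qfac (- (x * w)) k) ((?U \<star> ?V) \<star> (?D \<star> ?U))"
    by (simp add: b dual_exchange[OF ord_ge_uminus[OF x] w] kmult_assoc kmult_smult_left
        kmult_smult_right)
  also have "\<dots> = smult (qfac (- (x * w)) k) (?D \<star> ?U)"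
    by (simp add: b Vk_Uk_inverse[OF x] kmult_kid_left)
  finally show ?thesis by (simp add: exch_def)
qed

text \<open>Multiplying by the inverse of the dual row on both sides reads the relation backwards,
  which swaps numerator and denominator. The dual purple row with \<open>z\<close> is the inverse of
  the dual white row with \<open>- z\<close>.\<close>

lemma exch_dual_inverse:
  assumes z: "ord_ge 1 z" and R: "band R" and c: "exch num den R (dual (Uk (- z)))"
  shows "exch den num R (dual (Vk z))"
proof -
  let ?D = "dual (Uk (- z))" and ?E = "dual (Vk z)"
  note z' = ord_ge_uminus[OF z]
  note b = R band_adj[OF band_Uk[OF z']] band_adj[OF band_Vk[OF z]] band_kmult band_smult band_kid
  have inv: "?D \<star> ?E = kid" "?E \<star> ?D = kid"
    using Vk_Uk_inverse[OF z'] band_Uk[OF z'] band_Vk[OF z]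
    by (simp_all add: dual_kmult[symmetric] dual_kid)
  have "smult num (R \<star> ?E) = ?E \<star> (smult num (?D \<star> R) \<star> ?E)"
    by (simp add: b kmult_assoc[symmetric] kmult_smult_left kmult_smult_right inv kmult_kid_left)
  also have "\<dots> = ?E \<star> (smult den (R \<star> ?D) \<star> ?E)"
    using c by (simp add: exch_def)
  also have "\<dots> = smult den (?E \<star> R)"
    by (simp add: b kmult_assoc kmult_smult_left kmult_smult_right inv kmult_kid_right)
  finally show ?thesis by (simp add: exch_def)
qed

lemma exch_kid_left: "band L \<Longrightarrow> exch 1 1 kid L"
  and exch_kid_right: "band L \<Longrightarrow> exch 1 1 L kid"
  by (simp_all add: exch_def kmult_kid_left kmult_kid_right)

lemma exch_kmult_left:
  assumes "band R1" "band R2" "band L" "exch n1 d1 R1 L" "exch n2 d2 R2 L"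
  shows "exch (n1 * n2) (d1 * d2) (R2 \<star> R1) L"
proof -
  note b = assms(1-3) band_kmult band_smult
  have "smult (d1 * d2) (R2 \<star> R1 \<star> L) = smult d2 (R2 \<star> smult d1 (R1 \<star> L))"
    by (simp add: b kmult_assoc kmult_smult_right smult_smult mult.commute)
  also have "\<dots> = smult n1 (smult d2 (R2 \<star> L) \<star> R1)"
    using assms(4) by (simp add: b exch_def kmult_assoc kmult_smult_left kmult_smult_right smult_smult mult.commute)
  also have "\<dots> = smult (n1 * n2) (L \<star> (R2 \<star> R1))"
    using assms(5) by (simp add: b exch_def kmult_assoc kmult_smult_left smult_smult)
  finally show ?thesis by (simp add: exch_def)
qed

lemma exch_kmult_right:
  assumes "band R" "band L1" "band L2" "exch n1 d1 R L1" "exch n2 d2 R L2"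
  shows "exch (n1 * n2) (d1 * d2) R (L1 \<star> L2)"
proof -
  note b = assms(1-3) band_kmult band_smult
  have "smult (d1 * d2) (R \<star> (L1 \<star> L2)) = smult d2 (smult d1 (R \<star> L1) \<star> L2)"
    by (simp add: b kmult_assoc kmult_smult_left smult_smult mult.commute)
  also have "\<dots> = smult n1 (L1 \<star> smult d2 (R \<star> L2))"
    using assms(4) by (simp add: b exch_def kmult_assoc kmult_smult_left kmult_smult_right smult_smult mult.commute)
  also have "\<dots> = smult (n1 * n2) (L1 \<star> L2 \<star> R)"
    using assms(5) by (simp add: b exch_def kmult_assoc kmult_smult_right smult_smult)
  finally show ?thesis by (simp add: exch_def)
qed

text \<open>Each row passes each dual row once, so the scalars multiply over all pairs.\<close>

lemma exch_kprod:
  assumes A: "\<And>r. r \<in> {1..R} \<Longrightarrow> band (A r)" and B: "\<And>s. s \<in> {1..S} \<Longrightarrow> band (B s)"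
    and e: "\<And>r s. r \<in> {1..R} \<Longrightarrow> s \<in> {1..S} \<Longrightarrow> exch (num r s) (den r s) (A r) (dual (B s))"
  shows "exch (\<Prod>r=1..R. \<Prod>s=1..S. num r s) (\<Prod>r=1..R. \<Prod>s=1..S. den r s)
    (kprod A R) (dual (kprod B S))"
proof -
  have 1: "exch (\<Prod>s=1..S. num r s) (\<Prod>s=1..S. den r s) (A r) (dual (kprod B S))"
    if "r \<in> {1..R}" for r
    using B e[OF that]
  proof (induction S)
    case 0
    then show ?case using A[OF that] by (simp add: dual_kid exch_kid_right)
  next
    case (Suc S)
    have bB: "band (kprod B S)" "band (B (Suc S))" using Suc.prems by (auto intro: band_kprod)
    have IH: "exch (\<Prod>s=1..S. num r s) (\<Prod>s=1..S. den r s) (A r) (dual (kprod B S))"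
      using Suc by auto
    have "exch (prod (num r) {1..S} * num r (Suc S)) (prod (den r) {1..S} * den r (Suc S))
        (A r) (dual (kprod B S) \<star> dual (B (Suc S)))"
      using A[OF that] bB IH Suc.prems(2) by (intro exch_kmult_right band_adj) auto
    then show ?case using bB by (simp add: dual_kmult)
  qed
  show ?thesis using A 1
  proof (induction R)
    case 0
    show ?case using exch_kid_left[OF band_adj[OF band_kprod[OF B]]] by simp
  next
    case (Suc R)
    have bA: "band (kprod A R)" "band (A (Suc R))" using Suc.prems by (auto intro: band_kprod)
    have bB: "band (dual (kprod B S))" using B by (intro band_adj band_kprod) auto
    have IH: "exch (\<Prod>r=1..R. \<Prod>s=1..S. num r s) (\<Prod>r=1..R. \<Prod>s=1..S. den r s)
        (kprod A R) (dual (kprod B S))" using Suc by auto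
    have "exch ((\<Prod>r=1..R. \<Prod>s=1..S. num r s) * prod (num (Suc R)) {1..S})
       ((\<Prod>r=1..R. \<Prod>s=1..S. den r s) * prod (den (Suc R)) {1..S})
        (A (Suc R) \<star> kprod A R) (dual (kprod B S))"
      using bA bB IH Suc.prems(2) by (intro exch_kmult_left) auto
    then show ?case by simp
  qed
qed

end

section \<open>Rows of the lattice as products of elementary moves\<close>

definition pc :: "nat \<Rightarrow> int \<Rightarrow> nat \<Rightarrow> int" where
  "pc k C a = C * int k + int a - 1"

definition col :: "nat \<Rightarrow> int \<Rightarrow> int set" where
  "col k C = {C * int k..<(C + 1) * int k}"

definition lab :: "nat \<Rightarrow> int set \<Rightarrow> int \<Rightarrow> nat \<Rightarrow> int" where
  "lab k S C = (\<lambda>a\<in>{1..k}. if pc k C a \<in> S then 1 else 0)"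

definition posset :: "nat \<Rightarrow> int \<Rightarrow> (nat \<Rightarrow> int) \<Rightarrow> int set" where
  "posset k C L = pc k C ` {a \<in> {1..k}. L a = 1}"

definition shift :: "nat \<Rightarrow> int set \<Rightarrow> int set" where
  "shift k A = (\<lambda>a. a + int k) ` A"

text \<open>All jumps that start in \<open>A\<close>, undone at once.\<close>

definition pull :: "nat \<Rightarrow> int set \<Rightarrow> int set \<Rightarrow> int set" where
  "pull k A T = (T \<union> A) - shift k A"

lemma pc_inj: "pc k C a = pc k C b \<longleftrightarrow> a = b"
  by (simp add: pc_def)

lemma pc_div:
  assumes "a \<in> {1..k}"
  shows "pc k C a div int k = C" and "nat (pc k C a mod int k) + 1 = a"
proof -
  have e: "pc k C a = (int a - 1) + C * int k" by (simp add: pc_def)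
  have "0 \<le> int a - 1" "int a - 1 < int k" using assms by auto
  then show "pc k C a div int k = C" "nat (pc k C a mod int k) + 1 = a"
    unfolding e using assms by (simp_all add: nat_diff_distrib)
qed

lemma pc_surj:
  assumes "k > 0"
  shows "pc k (p div int k) (nat (p mod int k) + 1) = p" "nat (p mod int k) + 1 \<in> {1..k}"
proof -
  have "0 \<le> p mod int k" "p mod int k < int k" using assms by auto
  then show "pc k (p div int k) (nat (p mod int k) + 1) = p" "nat (p mod int k) + 1 \<in> {1..k}"
    by (auto simp: pc_def nat_less_iff Suc_le_eq)
qed

lemma mem_col_iff: "k > 0 \<Longrightarrow> p \<in> col k C \<longleftrightarrow> p div int k = C"
  using int_less_mult_iff_div[of "int k" p C] int_less_mult_iff_div[of "int k" p "C - 1"]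
  by (auto simp: col_def)

lemma col_eq: "k > 0 \<Longrightarrow> col k C = pc k C ` {1..k}"
proof -
  assume k: "k > 0"
  show ?thesis
  proof (intro equalityI subsetI)
    fix p assume "p \<in> col k C"
    then have "p div int k = C" using mem_col_iff[OF k] by simp
    then show "p \<in> pc k C ` {1..k}" using pc_surj[OF k, of p] by (metis imageI)
  next
    fix p assume "p \<in> pc k C ` {1..k}"
    then show "p \<in> col k C" using mem_col_iff[OF k] pc_div(1) by auto
  qed
qed

lemma pc_add: "pc k C a + int k = pc k (C + 1) a"
  by (simp add: pc_def algebra_simps)

lemma lab_labels: "lab k S C \<in> labels k"
  by (auto simp: lab_def labels_def)

lemma lab_apply: "a \<in> {1..k} \<Longrightarrow> lab k S C a = (if pc k C a \<in> S then 1 else 0)"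
  by (simp add: lab_def)

lemma labels_cases: "L \<in> labels k \<Longrightarrow> a \<in> {1..k} \<Longrightarrow> L a = 0 \<or> L a = 1"
  by (force simp: labels_def PiE_def Pi_def)

lemma mem_posset: "a \<in> {1..k} \<Longrightarrow> pc k C a \<in> posset k C L \<longleftrightarrow> L a = 1"
  by (auto simp: posset_def pc_inj)

lemma labels_eqI: "L \<in> labels k \<Longrightarrow> L' \<in> labels k \<Longrightarrow> (\<And>a. a \<in> {1..k} \<Longrightarrow> L a = L' a) \<Longrightarrow> L = L'"
  unfolding labels_def by (rule PiE_ext)

lemma bij_posset:
  assumes k: "k > 0"
  shows "bij_betw (posset k C) (labels k) (Pow (col k C))"
proof (rule bij_betw_byWitness[where f' = "\<lambda>A. lab k A C"])
  show "\<forall>L\<in>labels k. lab k (posset k C L) C = L"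
    by (intro ballI labels_eqI) (auto simp: lab_labels lab_apply mem_posset dest: labels_cases)
  show "\<forall>A\<in>Pow (col k C). posset k C (lab k A C) = A"
    using col_eq[OF k, of C] by (auto simp: posset_def lab_def)
  show "posset k C ` labels k \<subseteq> Pow (col k C)"
    using col_eq[OF k, of C] by (auto simp: posset_def)
  show "(\<lambda>A. lab k A C) ` Pow (col k C) \<subseteq> labels k"
    using lab_labels by auto
qed

lemma finite_labels: "finite (labels k)"
  unfolding labels_def by (intro finite_PiE) auto

lemma empty_label_labels: "empty_label k \<in> labels k"
  by (auto simp: empty_label_def labels_def)

lemma posset_empty: "posset k C (empty_label k) = {}"
  by (auto simp: posset_def empty_label_def)

lemma card_posset:
  assumes "L \<in> labels k"
  shows "card (posset k C L) = label_size k L"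
proof -
  have "card (posset k C L) = card {a \<in> {1..k}. L a = 1}"
    unfolding posset_def by (rule card_image) (auto simp: inj_on_def pc_inj)
  also have "int \<dots> = (\<Sum>c\<in>{1..k}. if L c = 1 then 1 else 0)"
    by (simp add: sum.If_cases Int_def)
  also have "\<dots> = (\<Sum>c = 1..k. L c)"
    by (rule sum.cong) (use labels_cases[OF assms] in auto)
  finally show ?thesis by (simp add: label_size_def)
qed

text \<open>For a colour \<open>c\<close> of \<open>L\<close>, the colours \<open>d > c\<close>
  present in the column are the particles in \<open>col_rest\<close> of its position, so
  \<open>phi\<close> adds up the exponents of the single jumps.\<close>

lemma phi_eq:
  assumes k: "k > 0" and L: "L \<in> labels k" and M: "\<And>a. a \<in> {1..k} \<Longrightarrow> M a = lab k T C a"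
  shows "phi k L M = (\<Sum>p\<in>posset k C L. int (same k p T))"
proof -
  have same: "int (same k (pc k C a) T) = (\<Sum>d\<in>{a<..k}. M d)" if a: "a \<in> {1..k}" for a
  proof -
    have "T \<inter> col_rest k (pc k C a) = pc k C ` {d \<in> {a<..k}. pc k C d \<in> T}"
    proof (intro equalityI subsetI)
      fix p assume p: "p \<in> T \<inter> col_rest k (pc k C a)"
      then have "pc k C a < p" "p < (C + 1) * int k" "p \<in> T"
        using pc_div(1)[OF a] by (auto simp: col_rest_def)
      moreover then have "p \<in> col k C" using a by (auto simp: col_def pc_def)
      then obtain d where "p = pc k C d" "d \<in> {1..k}" using col_eq[OF k] by auto
      ultimately show "p \<in> pc k C ` {d \<in> {a<..k}. pc k C d \<in> T}"
        by (auto simp: pc_def)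
    next
      fix p assume "p \<in> pc k C ` {d \<in> {a<..k}. pc k C d \<in> T}"
      then show "p \<in> T \<inter> col_rest k (pc k C a)"
        using pc_div(1)[OF a] by (auto simp: col_rest_def) (auto simp: pc_def algebra_simps)
    qed
    then have "same k (pc k C a) T = card {d \<in> {a<..k}. pc k C d \<in> T}"
      unfolding same_def by (simp add: card_image inj_on_def pc_inj)
    also have "int \<dots> = (\<Sum>d\<in>{a<..k}. if pc k C d \<in> T then 1 else 0)"
      by (simp add: sum.If_cases Int_def)
    also have "\<dots> = (\<Sum>d\<in>{a<..k}. M d)"
      by (rule sum.cong) (use M a in \<open>auto simp: lab_apply\<close>)
    finally show ?thesis .
  qed
  have "phi k L M = (\<Sum>(c, d)\<in>Sigma {1..k} (\<lambda>c. {c<..k}). L c * M d)"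
    unfolding phi_def by (rule sum.cong) auto
  also have "\<dots> = (\<Sum>c\<in>{1..k}. \<Sum>d\<in>{c<..k}. L c * M d)"
    by (rule sum.Sigma[symmetric]) auto
  also have "\<dots> = (\<Sum>c\<in>{1..k}. if L c = 1 then int (same k (pc k C c) T) else 0)"
    by (rule sum.cong) (use labels_cases[OF L] same in \<open>auto simp: sum_distrib_left[symmetric]\<close>)
  also have "\<dots> = (\<Sum>c\<in>{c \<in> {1..k}. L c = 1}. int (same k (pc k C c) T))"
    by (simp add: sum.If_cases Int_def)
  also have "\<dots> = (\<Sum>p\<in>posset k C L. int (same k p T))"
    unfolding posset_def by (subst sum.reindex) (auto simp: inj_on_def pc_inj)
  finally show ?thesis .
qed

section \<open>Expansion of the product over one column\<close>

lemma col_next: "k > 0 \<Longrightarrow> p \<in> col k C \<Longrightarrow> q \<in> col k C \<Longrightarrow> p + int k \<noteq> q"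
  by (auto simp: mem_col_iff)

text \<open>A jump leads into the next column, so jumps from one column never block each other and
  the product expands over the subsets \<open>A\<close> of positions that jump. The order of the
  positions enters only through the exponent \<open>E\<close>, given by its recursion so that both
  orders are covered.\<close>

lemma kp_column:
  assumes k: "k > 0" and "distinct ps" "set ps \<subseteq> col k C"
    and E0: "\<And>T. E {} T = 0"
    and E1: "\<And>ps1 p ps2 A T. ps = ps1 @ p # ps2 \<Longrightarrow> A \<subseteq> set ps2 \<Longrightarrow>
      E (insert p A) T = int (same k p T) + E A (dn k p T)"
  shows "kp k y (ps @ rest) T S = (\<Sum>A\<in>Pow (set ps).
    if A \<inter> T = {} \<and> shift k A \<subseteq> T
    then y ^ card A * tpow (E A T) * kp k y rest (pull k A T) S else 0)"
  using assms(2,3) E1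
proof (induction ps arbitrary: T)
  case Nil
  then show ?case by (simp add: E0 shift_def pull_def)
next
  case (Cons p ps)
  let ?F = "\<lambda>T A. if A \<inter> T = {} \<and> shift k A \<subseteq> T
    then y ^ card A * tpow (E A T) * kp k y rest (pull k A T) S else 0"
  have IH: "kp k y (ps @ rest) T S = (\<Sum>A\<in>Pow (set ps). ?F T A)" for T
  proof (rule Cons.IH)
    show "distinct ps" "set ps \<subseteq> col k C" using Cons.prems by auto
    fix ps1 p' ps2 A T
    assume "ps = ps1 @ p' # ps2" "A \<subseteq> set ps2"
    then show "E (insert p' A) T = int (same k p' T) + E A (dn k p' T)"
      using Cons.prems(3)[of "p # ps1" p' ps2 A T] by simp
  qed
  have p: "p \<notin> set ps" "p \<in> col k C" using Cons.prems by auto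
  have ins: "?F T (insert p A) =
      (if can_dn k p T then y * tpow (int (same k p T)) * ?F (dn k p T) A else 0)"
    if A: "A \<in> Pow (set ps)" for A
  proof -
    have fin: "finite A" and pA: "p \<notin> A" using A p finite_subset by auto
    \<comment> \<open>Here \<open>q\<close> and \<open>q'\<close> are in column \<open>C\<close>,
      whereas \<open>q + k\<close> is in the next one.\<close>
    have c: "q + int k \<noteq> q'" if "q \<in> insert p A" "q' \<in> insert p A" for q q'
      using col_next[OF k] that A Cons.prems(2) by (metis Pow_iff insertE p(2) subset_iff list.set_intros(2))
    then have c1: "\<forall>a\<in>A. a + int k \<noteq> p \<and> p + int k \<noteq> a" and c2: "\<forall>a\<in>A. \<forall>b\<in>A. a + int k \<noteq> b"
      by auto
    have cond: "insert p A \<inter> T = {} \<and> shift k (insert p A) \<subseteq> T \<longleftrightarrow>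
        can_dn k p T \<and> A \<inter> dn k p T = {} \<and> shift k A \<subseteq> dn k p T"
      using c1 pA k by (auto simp: shift_def can_dn_def dn_def image_subset_iff)
    have pl: "pull k (insert p A) T = pull k A (dn k p T)"
      using c1 c2 pA k by (auto simp: pull_def dn_def shift_def)
    have "E (insert p A) T = int (same k p T) + E A (dn k p T)"
      using Cons.prems(3)[of "[]" p ps A T] A by simp
    then show ?thesis
      unfolding cond using fin pA by (simp add: pl tpow_add mult_ac)
  qed
  have "(\<Sum>A\<in>Pow (set (p # ps)). ?F T A) =
      (\<Sum>A\<in>Pow (set ps). ?F T A) + (\<Sum>A\<in>insert p ` Pow (set ps). ?F T A)"
    unfolding list.set(2) Pow_insert by (rule sum.union_disjoint) (use p in auto)
  also have "(\<Sum>A\<in>insert p ` Pow (set ps). ?F T A) = (\<Sum>A\<in>Pow (set ps). ?F T (insert p A))"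
    by (subst sum.reindex) (use p in \<open>auto simp: inj_on_def\<close>)
  also have "\<dots> = (\<Sum>A\<in>Pow (set ps). if can_dn k p T then y * tpow (int (same k p T)) * ?F (dn k p T) A else 0)"
    by (rule sum.cong[OF refl ins])
  also have "\<dots> = (if can_dn k p T then y * tpow (int (same k p T)) * (\<Sum>A\<in>Pow (set ps). ?F (dn k p T) A) else 0)"
    by (simp only: sum_distrib_left if_cancel) (auto simp: sum_distrib_left)
  also have "(\<Sum>A\<in>Pow (set ps). ?F T A) + \<dots> = kp k y ((p # ps) @ rest) T S"
    by (simp only: append_Cons kp.simps IH)
  finally show ?case by simp
qed

lemma kp_column_labels:
  assumes k: "k > 0" and "distinct ps" "set ps = col k C"
    and "\<And>T. E {} T = 0"
    and "\<And>ps1 p ps2 A T. ps = ps1 @ p # ps2 \<Longrightarrow> A \<subseteq> set ps2 \<Longrightarrow>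
      E (insert p A) T = int (same k p T) + E A (dn k p T)"
  shows "kp k y (ps @ rest) T S = (\<Sum>L\<in>labels k.
    if posset k C L \<inter> T = {} \<and> posset k (C + 1) L \<subseteq> T
    then y ^ label_size k L * tpow (E (posset k C L) T) *
      kp k y rest ((T \<union> posset k C L) - posset k (C + 1) L) S else 0)"
proof -
  let ?F = "\<lambda>A. if A \<inter> T = {} \<and> shift k A \<subseteq> T
    then y ^ card A * tpow (E A T) * kp k y rest (pull k A T) S else 0"
  have sh: "shift k (posset k C L) = posset k (C + 1) L" for L
    by (auto simp: shift_def posset_def pc_add[symmetric])
  have "kp k y (ps @ rest) T S = (\<Sum>A\<in>Pow (set ps). ?F A)"
    using assms(3) by (intro kp_column[where C = C and E = E] k assms(2,4,5)) auto
  also have "\<dots> = (\<Sum>L\<in>labels k. ?F (posset k C L))"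
    unfolding assms(3) by (rule sum.reindex_bij_betw[OF bij_posset[OF k], symmetric])
  also have "\<dots> = (\<Sum>L\<in>labels k.
    if posset k C L \<inter> T = {} \<and> posset k (C + 1) L \<subseteq> T
    then y ^ label_size k L * tpow (E (posset k C L) T) *
      kp k y rest ((T \<union> posset k C L) - posset k (C + 1) L) S else 0)"
    by (rule sum.cong) (auto simp: sh pull_def card_posset)
  finally show ?thesis .
qed

lemma same_cong: "S \<inter> col_rest k p = S' \<inter> col_rest k p \<Longrightarrow> same k p S = same k p S'"
  by (simp add: same_def)

lemma col_rest_subset: "k > 0 \<Longrightarrow> p \<in> col k C \<Longrightarrow> q \<in> col_rest k p \<longleftrightarrow> q \<in> col k C \<and> p < q"
  using mem_col_iff[of k p C] by (auto simp: col_rest_def col_def)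

text \<open>In ascending order a restored particle lies to the left of the positions still to come
  and is not counted by them, so all weights are read off the original \<open>T\<close>.\<close>

lemma kp_column_ascending:
  assumes k: "k > 0"
  shows "kp k y ([C * int k..(C + 1) * int k - 1] @ rest) T S = (\<Sum>L\<in>labels k.
    if posset k C L \<inter> T = {} \<and> posset k (C + 1) L \<subseteq> T
    then y ^ label_size k L * tpow (phi k L (lab k T C)) *
      kp k y rest ((T \<union> posset k C L) - posset k (C + 1) L) S else 0)"
proof -
  let ?ps = "[C * int k..(C + 1) * int k - 1]"
  have set: "set ?ps = col k C" by (auto simp: col_def)
  have E1: "(\<Sum>q\<in>insert p A. int (same k q T)) =
      int (same k p T) + (\<Sum>q\<in>A. int (same k q (dn k p T)))"
    if "?ps = ps1 @ p # ps2" "A \<subseteq> set ps2" for ps1 p ps2 A T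
  proof -
    have "sorted_wrt (<) (ps1 @ p # ps2)" using that(1) sorted_wrt_upto by metis
    then have less: "q \<in> A \<Longrightarrow> p < q" for q using that(2) by (auto simp: sorted_wrt_append)
    have inC: "p \<in> col k C" "A \<subseteq> col k C" using that unfolding set[symmetric] by auto
    have "same k q (dn k p T) = same k q T" if "q \<in> A" for q
      using less[OF that] inC that col_next[OF k inC(1)] col_rest_subset[OF k, of q C]
      by (intro same_cong) (auto simp: dn_def)
    then show ?thesis using less finite_subset[OF that(2)] by (subst sum.insert) auto
  qed
  show ?thesis
    by (subst kp_column_labels[where C = C and E = "\<lambda>A T. \<Sum>p\<in>A. int (same k p T)", OF k _ set _ E1])
      (auto intro!: sum.cong simp: phi_eq[OF k, of _ "lab k T C" T C])
qed

text \<open>In descending order the restored particles lie to the right of the positions still to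
  come and are counted by them, so the weights are read off \<open>T\<close> together with all of
  \<open>posset k C L\<close>.\<close>

lemma kp_column_descending:
  assumes k: "k > 0"
  shows "kp k y (rev [C * int k..(C + 1) * int k - 1] @ rest) T S = (\<Sum>L\<in>labels k.
    if posset k C L \<inter> T = {} \<and> posset k (C + 1) L \<subseteq> T
    then y ^ label_size k L * tpow (phi k L (lab k (T \<union> posset k C L) C)) *
      kp k y rest ((T \<union> posset k C L) - posset k (C + 1) L) S else 0)"
proof -
  let ?ps = "[C * int k..(C + 1) * int k - 1]"
  have set: "set (rev ?ps) = col k C" by (auto simp: col_def)
  have E1: "(\<Sum>q\<in>insert p A. int (same k q (T \<union> insert p A))) =
      int (same k p T) + (\<Sum>q\<in>A. int (same k q (dn k p T \<union> A)))"
    if "rev ?ps = ps1 @ p # ps2" "A \<subseteq> set ps2" for ps1 p ps2 A T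
  proof -
    have "sorted_wrt (<) (rev ps2 @ p # rev ps1)"
      using that(1) sorted_wrt_upto by (metis rev.simps(2) rev_append rev_rev_ident append.assoc append_Cons append_Nil)
    then have less: "q \<in> A \<Longrightarrow> q < p" for q using that(2) by (auto simp: sorted_wrt_append)
    have inC: "p \<in> col k C" "A \<subseteq> col k C" using that unfolding set[symmetric] by auto
    have 1: "same k q (dn k p T \<union> A) = same k q (T \<union> insert p A)" if "q \<in> A" for q
      using less[OF that] inC that col_next[OF k inC(1)] col_rest_subset[OF k, of q C]
      by (intro same_cong) (auto simp: dn_def)
    have 2: "same k p (T \<union> insert p A) = same k p T"
      using less inC col_rest_subset[OF k, of p C] by (intro same_cong) (auto dest: less)
    show ?thesis using less finite_subset[OF that(2)] 1 2 by (subst sum.insert) auto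
  qed
  show ?thesis
    by (subst kp_column_labels[where C = C and E = "\<lambda>A T. \<Sum>p\<in>A. int (same k p (T \<union> A))", OF k _ set _ E1])
      (auto intro!: sum.cong simp: phi_eq[OF k, of _ _ "T \<union> _" C])
qed

text \<open>Only the factors at \<open>q\<close> and at \<open>q - k\<close> can change whether
  \<open>q\<close> is occupied.\<close>

lemma kp_outside:
  assumes "kp k y ps i j \<noteq> 0" "q \<notin> set ps" "q - int k \<notin> set ps"
  shows "q \<in> i \<longleftrightarrow> q \<in> j"
  using assms
proof (induction ps arbitrary: i)
  case (Cons p ps)
  show ?case
  proof (cases "kp k y ps i j = 0")
    case True
    with Cons.prems have "kp k y ps (dn k p i) j \<noteq> 0" by (auto split: if_splits)
    then have "q \<in> dn k p i \<longleftrightarrow> q \<in> j" using Cons by auto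
    then show ?thesis using Cons.prems by (auto simp: dn_def)
  qed (use Cons in auto)
qed (auto split: if_splits)

section \<open>Transfer matrices\<close>

definition paths :: "'a set \<Rightarrow> nat \<Rightarrow> 'a \<Rightarrow> 'a \<Rightarrow> (nat \<Rightarrow> 'a) set" where
  "paths S n a b = {u \<in> {0..n} \<rightarrow>\<^sub>E S. u 0 = a \<and> u n = b}"

text \<open>The entry at \<open>(a, b)\<close> of the product of the transfer matrices
  \<open>w 0\<close>, ..., \<open>w (n - 1)\<close>. It serves twice: for the horizontal edges along
  a row and for the rows of the lattice.\<close>

definition psum :: "'a set \<Rightarrow> (nat \<Rightarrow> 'a \<Rightarrow> 'a \<Rightarrow> 'b :: comm_ring_1) \<Rightarrow> nat \<Rightarrow> 'a \<Rightarrow> 'a \<Rightarrow> 'b" where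
  "psum S w n a b = (\<Sum>u\<in>paths S n a b. \<Prod>c<n. w c (u c) (u (Suc c)))"

lemma finite_paths: "finite S \<Longrightarrow> finite (paths S n a b)"
  unfolding paths_def by (rule finite_subset[of _ "{0..n} \<rightarrow>\<^sub>E S"]) (auto intro: finite_PiE)

lemma psum_0: "a \<in> S \<Longrightarrow> psum S w 0 a b = (if a = b then 1 else 0)"
proof -
  assume a: "a \<in> S"
  have "paths S 0 a b = (if a = b then {\<lambda>i\<in>{0..0}. a} else {})"
    using a by (auto simp: paths_def PiE_def Pi_def extensional_def restrict_def fun_eq_iff)
  then show ?thesis by (simp add: psum_def)
qed

lemma psum_Suc:
  assumes S: "finite S" and b: "b \<in> S"
  shows "psum S w (Suc n) a b = (\<Sum>s\<in>S. psum S w n a s * w n s b)"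
proof -
  let ?f = "\<lambda>n u. \<Prod>c<n. w c (u c) (u (Suc c))"
  have "(\<Sum>s\<in>S. psum S w n a s * w n s b) = (\<Sum>s\<in>S. \<Sum>u\<in>paths S n a s. ?f n u * w n s b)"
    by (simp add: psum_def sum_distrib_right)
  also have "\<dots> = (\<Sum>(s, u)\<in>Sigma S (\<lambda>s. paths S n a s). ?f n u * w n s b)"
    by (rule sum.Sigma) (use S finite_paths in auto)
  also have "\<dots> = psum S w (Suc n) a b"
    unfolding psum_def
  proof (rule sum.reindex_bij_witness[where j = "\<lambda>(s, u). u(Suc n := b)"
        and i = "\<lambda>v. (v n, restrict v {0..n})"], goal_cases)
    case (1 z)
    then show ?case by (auto simp: paths_def fun_eq_iff PiE_def extensional_def)
  next
    case (2 z)
    then show ?case using b by (auto simp: paths_def PiE_def extensional_def Pi_def le_Suc_eq)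
  next
    case (3 v)
    then show ?case by (auto simp: paths_def fun_eq_iff PiE_def extensional_def le_Suc_eq)
  next
    case (4 v)
    then show ?case by (auto simp: paths_def)
  next
    case (5 z)
    then obtain s u where z: "z = (s, u)" "u \<in> paths S n a s" by auto
    have "?f n (u(Suc n := b)) = ?f n u" by (rule prod.cong) auto
    then show ?case using z by (simp add: paths_def)
  qed
  finally show ?thesis by simp
qed

text \<open>Peels off the first factor where \<open>psum_Suc\<close> peels off the last: purple rows
  are evaluated by suffixes, white rows by prefixes.\<close>

lemma psum_left:
  assumes S: "finite S" and a: "a \<in> S" and b: "b \<in> S"
  shows "psum S w (Suc n) a b = (\<Sum>s\<in>S. w 0 a s * psum S (\<lambda>c. w (Suc c)) n s b)"
  using b
proof (induction n arbitrary: b)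
  case 0
  have "psum S w (Suc 0) a b = (\<Sum>s\<in>S. if s = a then w 0 s b else 0)"
    using a by (subst psum_Suc[OF S 0]) (auto simp: psum_0 intro!: sum.cong)
  moreover have "(\<Sum>s\<in>S. w 0 a s * psum S (\<lambda>c. w (Suc c)) 0 s b) = (\<Sum>s\<in>S. if s = b then w 0 a s else 0)"
    by (auto simp: psum_0 intro!: sum.cong)
  ultimately show ?case using S a 0 by (simp add: sum.delta)
next
  case (Suc n)
  have "psum S w (Suc (Suc n)) a b =
      (\<Sum>s\<in>S. (\<Sum>r\<in>S. w 0 a r * psum S (\<lambda>c. w (Suc c)) n r s) * w (Suc n) s b)"
    by (subst psum_Suc[OF S Suc.prems]) (simp add: Suc.IH)
  also have "\<dots> = (\<Sum>s\<in>S. \<Sum>r\<in>S. w 0 a r * (psum S (\<lambda>c. w (Suc c)) n r s * w (Suc n) s b))"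
    by (simp add: sum_distrib_right mult.assoc)
  also have "\<dots> = (\<Sum>r\<in>S. \<Sum>s\<in>S. w 0 a r * (psum S (\<lambda>c. w (Suc c)) n r s * w (Suc n) s b))"
    by (rule sum.swap)
  also have "\<dots> = (\<Sum>r\<in>S. w 0 a r * psum S (\<lambda>c. w (Suc c)) (Suc n) r b)"
    by (simp add: psum_Suc[OF S Suc.prems] sum_distrib_left)
  finally show ?case .
qed

lemma psum_cong:
  assumes "\<And>c J L. c < n \<Longrightarrow> J \<in> S \<Longrightarrow> L \<in> S \<Longrightarrow> w c J L = w' c J L"
  shows "psum S w n a b = psum S w' n a b"
  unfolding psum_def by (intro sum.cong prod.cong assms) (auto simp: paths_def PiE_def Pi_def)

section \<open>Vertices of a row as groups of jumps\<close>

lemma posset_subset_col: "k > 0 \<Longrightarrow> posset k C L \<subseteq> col k C"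
  using bij_posset[of k C] by (auto simp: posset_def col_eq)

lemma cols_disjoint: "k > 0 \<Longrightarrow> C \<noteq> D \<Longrightarrow> col k C \<inter> col k D = {}"
  by (auto simp: mem_col_iff)

lemma pc_in_col: "k > 0 \<Longrightarrow> a \<in> {1..k} \<Longrightarrow> pc k C a \<in> col k C"
  using col_eq[of k C] by auto

lemma phi_cong: "(\<And>a. a \<in> {1..k} \<Longrightarrow> M a = M' a) \<Longrightarrow> phi k L M = phi k L M'"
  unfolding phi_def by (rule sum.cong) auto

lemma label_size_empty: "label_size k (empty_label k) = 0"
  by (simp add: label_size_def empty_label_def)

lemma phi_empty: "phi k (empty_label k) M = 0"
  unfolding phi_def by (rule sum.neutral) (auto simp: empty_label_def)

lemma posset_eq_empty_iff: "L \<in> labels k \<Longrightarrow> posset k C L = {} \<longleftrightarrow> L = empty_label k"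
proof
  assume "L \<in> labels k" "posset k C L = {}"
  then show "L = empty_label k"
    by (intro labels_eqI[OF _ empty_label_labels])
      (auto simp: posset_def empty_label_def dest: labels_cases)
qed (simp add: posset_empty)

lemma lab_cong:
  assumes "k > 0" "T \<inter> col k C = T' \<inter> col k C"
  shows "lab k T C = lab k T' C"
  unfolding lab_def
proof (rule restrict_ext)
  fix a assume "a \<in> {1..k}"
  then have "pc k C a \<in> col k C" by (rule pc_in_col[OF assms(1)])
  then have "pc k C a \<in> T \<longleftrightarrow> pc k C a \<in> T'" using assms(2) by blast
  then show "(if pc k C a \<in> T then 1 else 0) = (if pc k C a \<in> T' then 1 else 0 :: int)" by simp
qed

lemma upto_split: "i \<le> j \<Longrightarrow> j \<le> m + 1 \<Longrightarrow> [i..m] = [i..j - 1] @ [j..m]"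
  using upto_split1[of i j m] by (cases "j = m + 1") auto

lemma col_eq_iff:
  "k > 0 \<Longrightarrow> A \<inter> col k C = B \<inter> col k C \<longleftrightarrow> (\<forall>a\<in>{1..k}. pc k C a \<in> A \<longleftrightarrow> pc k C a \<in> B)"
  unfolding col_eq by blast

lemma posset_subset_iff: "posset k C L \<subseteq> T \<longleftrightarrow> (\<forall>a\<in>{1..k}. L a = 1 \<longrightarrow> pc k C a \<in> T)"
  by (auto simp: posset_def)

lemma posset_disjoint_iff: "posset k C L \<inter> T = {} \<longleftrightarrow> (\<forall>a\<in>{1..k}. L a = 1 \<longrightarrow> pc k C a \<notin> T)"
  by (auto simp: posset_def disjoint_iff)

text \<open>When the jumps of a white row are undone, column \<open>C\<close> first regains the
  particles that left through \<open>L\<close> and then loses those that came in through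
  \<open>J\<close>. The bound on \<open>I + J\<close> says that the regained places are free in
  \<open>T\<close>.\<close>

lemma white_cond:
  assumes k: "k > 0" and J: "J \<in> labels k" and L: "L \<in> labels k"
  shows "(\<forall>c\<in>{1..k}. lab k S C c + J c = lab k T C c + L c) \<and> (\<forall>c\<in>{1..k}. lab k S C c + J c \<noteq> 2) \<longleftrightarrow>
    posset k C L \<inter> T = {} \<and> posset k C J \<subseteq> T \<union> posset k C L \<and>
    (T \<union> posset k C L - posset k C J) \<inter> col k C = S \<inter> col k C"
  unfolding posset_disjoint_iff posset_subset_iff col_eq_iff[OF k] ball_conj_distrib[symmetric]
proof (rule ball_cong[OF refl])
  fix a assume a: "a \<in> {1..k}"
  show "(lab k S C a + J a = lab k T C a + L a \<and> lab k S C a + J a \<noteq> 2) \<longleftrightarrow>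
    ((L a = 1 \<longrightarrow> pc k C a \<notin> T) \<and> (J a = 1 \<longrightarrow> pc k C a \<in> T \<union> posset k C L) \<and>
    (pc k C a \<in> T \<union> posset k C L - posset k C J \<longleftrightarrow> pc k C a \<in> S))"
    using labels_cases[OF J a] labels_cases[OF L a] by (auto simp: lab_apply[OF a] mem_posset[OF a])
qed

text \<open>As in \<open>white_cond\<close>, with the two steps in the opposite order, since purple
  rows treat the columns from left to right.\<close>

lemma purple_cond:
  assumes k: "k > 0" and J: "J \<in> labels k" and L: "L \<in> labels k"
  shows "(\<forall>c\<in>{1..k}. lab k S C c + J c = lab k T C c + L c) \<and> (\<forall>c\<in>{1..k}. lab k T C c \<ge> J c) \<longleftrightarrow>
    posset k C J \<subseteq> T \<and> posset k C L \<inter> (T - posset k C J) = {} \<and>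
    (T - posset k C J \<union> posset k C L) \<inter> col k C = S \<inter> col k C"
  unfolding posset_disjoint_iff posset_subset_iff col_eq_iff[OF k] ball_conj_distrib[symmetric]
proof (rule ball_cong[OF refl])
  fix a assume a: "a \<in> {1..k}"
  show "(lab k S C a + J a = lab k T C a + L a \<and> lab k T C a \<ge> J a) \<longleftrightarrow>
    ((J a = 1 \<longrightarrow> pc k C a \<in> T) \<and> (L a = 1 \<longrightarrow> pc k C a \<notin> T - posset k C J) \<and>
    (pc k C a \<in> T - posset k C J \<union> posset k C L \<longleftrightarrow> pc k C a \<in> S))"
    using labels_cases[OF J a] labels_cases[OF L a] by (auto simp: lab_apply[OF a] mem_posset[OF a])
qed

text \<open>The state in which column \<open>C\<close> has already reached its final value, taken
  from \<open>S\<close>.\<close>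

definition replace_col :: "nat \<Rightarrow> int \<Rightarrow> int set \<Rightarrow> int set \<Rightarrow> int set" where
  "replace_col k C S T = (T - col k C) \<union> (S \<inter> col k C)"

lemma replace_col_other:
  "k > 0 \<Longrightarrow> D \<noteq> C \<Longrightarrow> replace_col k C S T \<inter> col k D = T \<inter> col k D"
  using cols_disjoint[of k C D] by (auto simp: replace_col_def)

text \<open>Induction on the number of columns, with the label at the open right end left free. That
  label records the jumps out of column \<open>C\<close>, the last of the prefix; summing over the
  label on the left of this column matches the expansion of the descending product over column
  \<open>C - 1\<close>. The list starts at column \<open>- l - 1\<close> so that the empty prefix
  has the same form.\<close>

lemma white_prefix:
  assumes k: "k > 0"
    and "L \<in> labels k" and C: "C = int n - int l - 1"
    and S: "\<And>p. p < - int l * int k \<Longrightarrow> p \<in> S" and T: "\<And>p. p < - int l * int k \<Longrightarrow> p \<in> T"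
    and agree: "\<And>p. p \<ge> (C + 1) * int k \<Longrightarrow> p \<in> T \<longleftrightarrow> p \<in> S"
  shows "psum (labels k) (\<lambda>c J L. white_weight k x (lab k S (int c - int l)) J (lab k T (int c - int l)) L)
      n (empty_label k) L =
    (if posset k C L \<inter> T = {} then x ^ label_size k L * tpow (phi k L (lab k (T \<union> posset k C L) C)) *
      kp k x (rev [- (int l + 1) * int k..C * int k - 1]) (T \<union> posset k C L) S else 0)"
  using assms(2,3) T agree
proof (induction n arbitrary: L T C)
  case 0
  have CC: "C = - int l - 1" using 0 by simp
  \<comment> \<open>Column \<open>- l - 1\<close> is full, so no jump out of it can be undone and
    \<open>L\<close> must be empty.\<close>
  have "col k C \<subseteq> T" using 0(3) by (auto simp: col_def CC)
  then have e: "posset k C L \<inter> T = {} \<longleftrightarrow> empty_label k = L"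
    using posset_subset_col[OF k, of C L] posset_eq_empty_iff[OF 0(1), of C] by auto
  have TS: "T = S"
  proof (rule set_eqI)
    fix p
    show "p \<in> T \<longleftrightarrow> p \<in> S"
      using 0(3)[of p] 0(4)[of p] S[of p] by (cases "p < - int l * int k") (auto simp: CC)
  qed
  show ?case
    using e by (auto simp: psum_0 empty_label_labels label_size_empty phi_empty posset_empty TS CC)
next
  case (Suc n)
  define C' where "C' = C - 1"
  have C': "C = C' + 1" "C' = int n - int l - 1" "int n - int l = C" using Suc.prems(2) by (auto simp: C'_def)
  define T' where "T' = replace_col k C S T"
  define U where "U = T \<union> posset k C L"
  let ?lo = "- (int l + 1) * int k"
  let ?w = "\<lambda>T c J L. white_weight k x (lab k S (int c - int l)) J (lab k T (int c - int l)) L"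
  let ?rest = "rev [?lo..C' * int k - 1]"
  have colC: "p \<in> col k C \<longleftrightarrow> C * int k \<le> p \<and> p < (C + 1) * int k" for p by (auto simp: col_def)
  have sub: "posset k C' J \<subseteq> col k C'" "posset k C J \<subseteq> col k C" for J
    using posset_subset_col[OF k] by auto
  have disj: "col k C' \<inter> col k C = {}" by (rule cols_disjoint[OF k]) (simp add: C'_def)
  have out: "p \<notin> col k C" if "p \<in> posset k C' J" for p J
    using that sub(1)[of J] disj by blast
  \<comment> \<open>The remaining prefix does not see column \<open>C\<close>, which may therefore
    be replaced by its final value; this restores \<open>agree\<close> for the induction
    hypothesis.\<close>
  have psum_T: "psum (labels k) (?w T) n (empty_label k) J = psum (labels k) (?w T') n (empty_label k) J" for J
  proof (rule psum_cong)
    fix c J L assume "c < n"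
    then have "int c - int l \<noteq> C" using C' by auto
    then have "lab k T (int c - int l) = lab k T' (int c - int l)"
      using replace_col_other[OF k, of "int c - int l" C S T] by (intro lab_cong[OF k]) (auto simp: T'_def)
    then show "?w T c J L = ?w T' c J L" by simp
  qed
  have IH: "psum (labels k) (?w T') n (empty_label k) J =
    (if posset k C' J \<inter> T' = {} then x ^ label_size k J * tpow (phi k J (lab k (T' \<union> posset k C' J) C')) *
      kp k x ?rest (T' \<union> posset k C' J) S else 0)" if "J \<in> labels k" for J
  proof (rule Suc.IH[OF that C'(2)])
    show "p \<in> T'" if "p < - int l * int k" for p
      using that Suc.prems(3) S by (auto simp: T'_def replace_col_def)
    show "p \<in> T' \<longleftrightarrow> p \<in> S" if "p \<ge> (C' + 1) * int k" for p
      using that Suc.prems(4)[of p] colC[of p] C'(1) by (auto simp: T'_def replace_col_def)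
  qed
  have list: "rev [?lo..C * int k - 1] = rev [C' * int k..(C' + 1) * int k - 1] @ ?rest"
  proof -
    have "?lo \<le> C' * int k" "C' * int k \<le> C * int k"
      unfolding C'(1) using C'(2) by (simp_all add: mult_right_mono)
    then have "[?lo..C * int k - 1] = [?lo..C' * int k - 1] @ [C' * int k..C * int k - 1]"
      by (intro upto_split) auto
    then show ?thesis by (simp add: C'(1))
  qed
  have summand: "psum (labels k) (?w T) n (empty_label k) J * ?w T n J L =
     (if posset k C L \<inter> T = {} then x ^ label_size k L * tpow (phi k L (lab k U C)) *
       (if posset k C' J \<inter> U = {} \<and> posset k (C' + 1) J \<subseteq> U
        then x ^ label_size k J * tpow (phi k J (lab k (U \<union> posset k C' J) C')) *
          kp k x ?rest ((U \<union> posset k C' J) - posset k (C' + 1) J) S else 0) else 0)"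
    if J: "J \<in> labels k" for J
  proof (cases "posset k C L \<inter> T = {} \<and> posset k C J \<subseteq> T \<union> posset k C L \<and>
    (T \<union> posset k C L - posset k C J) \<inter> col k C = S \<inter> col k C")
    case True
    then have w: "?w T n J L = x ^ label_size k L * tpow (phi k L (lab k U C))"
    proof -
      have c: "(\<forall>c\<in>{1..k}. lab k S C c + J c = lab k T C c + L c) \<and> (\<forall>c\<in>{1..k}. lab k S C c + J c \<noteq> 2)"
        using True by (rule white_cond[OF k J Suc.prems(1), THEN iffD2])
      have phi: "phi k L (\<lambda>c. lab k S C c + J c) = phi k L (lab k U C)"
      proof (rule phi_cong)
        fix a assume a: "a \<in> {1..k}"
        have "pc k C a \<in> U \<longleftrightarrow> pc k C a \<in> T \<or> L a = 1" using mem_posset[OF a, of C L] by (simp add: U_def)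
        moreover have "pc k C a \<in> T \<Longrightarrow> L a \<noteq> 1" using True mem_posset[OF a, of C L] by blast
        ultimately show "lab k S C a + J a = lab k U C a"
          using c a labels_cases[OF Suc.prems(1) a] by (auto simp: lab_apply)
      qed
      show ?thesis unfolding C'(3) white_weight_def if_P[OF c] phi ..
    qed
    have i1: "posset k C' J \<inter> T' = posset k C' J \<inter> U"
      using sub(2)[of L] by (auto simp: T'_def U_def replace_col_def dest: out)
    have i2: "T' \<union> posset k C' J = (U \<union> posset k C' J) - posset k (C' + 1) J"
    proof (rule set_eqI)
      fix p
      show "p \<in> T' \<union> posset k C' J \<longleftrightarrow> p \<in> (U \<union> posset k C' J) - posset k (C' + 1) J"
      proof (cases "p \<in> col k C")
        case pC: True
        then have "p \<in> S \<longleftrightarrow> p \<in> T \<union> posset k C L - posset k C J" using True by blast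
        then show ?thesis using pC out[of p J] by (auto simp: T'_def U_def replace_col_def C'(1))
      next
        case False
        then show ?thesis using sub[of J] sub(2)[of L] by (auto simp: T'_def U_def replace_col_def C'(1))
      qed
    qed
    have i3: "lab k (T' \<union> posset k C' J) C' = lab k (U \<union> posset k C' J) C'"
      by (rule lab_cong[OF k]) (use disj sub(2)[of L] in \<open>auto simp: T'_def U_def replace_col_def\<close>)
    have "posset k (C' + 1) J \<subseteq> U" using True by (simp add: U_def C'(1))
    then show ?thesis
      unfolding psum_T IH[OF J] w i1 i3 using True by (simp add: i2 mult_ac)
  next
    case False
    then have "?w T n J L = 0"
      using white_cond[OF k J Suc.prems(1), of S C T] unfolding C'(3) white_weight_def by auto
    \<comment> \<open>The vertex weight is zero here. If only column \<open>C\<close> fails to come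
      out as in \<open>S\<close>, the jump side vanishes as well: the remaining factors belong to
      columns too far left to repair it.\<close>
    moreover have "kp k x ?rest ((U \<union> posset k C' J) - posset k (C' + 1) J) S = 0"
      if "posset k C L \<inter> T = {}" "posset k (C' + 1) J \<subseteq> U"
    proof (rule ccontr)
      assume nz: "kp k x ?rest ((U \<union> posset k C' J) - posset k (C' + 1) J) S \<noteq> 0"
      have "p \<in> (U \<union> posset k C' J) - posset k (C' + 1) J \<longleftrightarrow> p \<in> S" if "p \<in> col k C" for p
      proof (rule kp_outside[OF nz])
        show "p \<notin> set ?rest" "p - int k \<notin> set ?rest"
          using that by (auto simp: col_def C'(1) algebra_simps)
      qed
      then have "(T \<union> posset k C L - posset k C J) \<inter> col k C = S \<inter> col k C"
        using out[of _ J] by (fastforce simp: U_def C'(1))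
      then show False using False that by (auto simp: U_def C'(1))
    qed
    ultimately show ?thesis by auto
  qed
  have "psum (labels k) (?w T) (Suc n) (empty_label k) L =
      (\<Sum>J\<in>labels k. psum (labels k) (?w T) n (empty_label k) J * ?w T n J L)"
    by (rule psum_Suc[OF finite_labels Suc.prems(1)])
  also have "\<dots> = (if posset k C L \<inter> T = {} then x ^ label_size k L * tpow (phi k L (lab k U C)) *
      (\<Sum>J\<in>labels k. if posset k C' J \<inter> U = {} \<and> posset k (C' + 1) J \<subseteq> U
        then x ^ label_size k J * tpow (phi k J (lab k (U \<union> posset k C' J) C')) *
          kp k x ?rest ((U \<union> posset k C' J) - posset k (C' + 1) J) S else 0) else 0)"
    by (simp add: summand sum_distrib_left)
  finally show ?case
    unfolding list kp_column_descending[OF k] U_def[symmetric] .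
qed

text \<open>The mirror image of \<open>white_prefix\<close>: suffixes, a free label on the left, and
  the ascending product. The empty suffix has \<open>C = N + 1\<close>, an empty column, which
  forces \<open>J\<close> to be empty.\<close>

lemma purple_suffix:
  assumes k: "k > 0"
    and "J \<in> labels k" and C: "C = int N + 1 - int n"
    and S: "\<And>p. p \<ge> (int N + 1) * int k \<Longrightarrow> p \<notin> S" and T: "\<And>p. p \<ge> (int N + 1) * int k \<Longrightarrow> p \<notin> T"
    and agree: "\<And>p. p < C * int k \<Longrightarrow> p \<in> T \<longleftrightarrow> p \<in> S"
  shows "psum (labels k) (\<lambda>c J L. purple_weight k y (lab k S (C + int c)) J (lab k T (C + int c)) L)
      n J (empty_label k) =
    (if posset k C J \<subseteq> T then kp k y [C * int k..(int N + 1) * int k - 1] (T - posset k C J) S else 0)"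
  using assms(2,3) T agree
proof (induction n arbitrary: J T C)
  case 0
  have CC: "C = int N + 1" using 0 by simp
  have "col k C \<inter> T = {}" using 0(3) by (auto simp: col_def CC)
  then have e: "posset k C J \<subseteq> T \<longleftrightarrow> J = empty_label k"
    using posset_subset_col[OF k, of C J] posset_eq_empty_iff[OF 0(1), of C] by auto
  have TS: "T = S"
  proof (rule set_eqI)
    fix p
    show "p \<in> T \<longleftrightarrow> p \<in> S"
      using 0(3)[of p] 0(4)[of p] S[of p] by (cases "p < (int N + 1) * int k") (auto simp: CC)
  qed
  show ?case
    using e 0(1) by (auto simp: psum_0 posset_empty TS CC)
next
  case (Suc n)
  define C' where "C' = C + 1"
  have C': "C' = C + 1" "C' = int N + 1 - int n" using Suc.prems(2) by (auto simp: C'_def)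
  define T' where "T' = replace_col k C S T"
  define U where "U = T - posset k C J"
  let ?hi = "(int N + 1) * int k - 1"
  let ?w = "\<lambda>T C c J L. purple_weight k y (lab k S (C + int c)) J (lab k T (C + int c)) L"
  let ?rest = "[C' * int k..?hi]"
  have colC: "p \<in> col k C \<longleftrightarrow> C * int k \<le> p \<and> p < C' * int k" for p by (auto simp: col_def C'_def)
  have sub: "posset k C' J \<subseteq> col k C'" "posset k C J \<subseteq> col k C" for J
    using posset_subset_col[OF k] by auto
  have disj: "col k C' \<inter> col k C = {}" by (rule cols_disjoint[OF k]) (simp add: C'_def)
  have out: "p \<notin> col k C" if "p \<in> posset k C' J" for p J
    using that sub(1)[of J] disj by blast
  have psum_T: "psum (labels k) (\<lambda>c. ?w T C (Suc c)) n L (empty_label k) =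
      psum (labels k) (?w T' C') n L (empty_label k)" for L
  proof (rule psum_cong)
    fix c J L
    have "lab k T (C + int (Suc c)) = lab k T' (C + int (Suc c))"
      using replace_col_other[OF k, of "C + int (Suc c)" C S T] by (intro lab_cong[OF k]) (auto simp: T'_def)
    moreover have "C + int (Suc c) = C' + int c" by (simp add: C'_def)
    ultimately show "?w T C (Suc c) J L = ?w T' C' c J L" by (simp only:)
  qed
  have IH: "psum (labels k) (?w T' C') n L (empty_label k) =
    (if posset k C' L \<subseteq> T' then kp k y ?rest (T' - posset k C' L) S else 0)" if "L \<in> labels k" for L
  proof (rule Suc.IH[OF that C'(2)])
    show "p \<notin> T'" if "p \<ge> (int N + 1) * int k" for p
      using that Suc.prems(3) S by (auto simp: T'_def replace_col_def)
    show "p \<in> T' \<longleftrightarrow> p \<in> S" if "p < C' * int k" for p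
      using that Suc.prems(4)[of p] colC[of p] by (auto simp: T'_def replace_col_def)
  qed
  have list: "[C * int k..?hi] = [C * int k..(C + 1) * int k - 1] @ ?rest"
  proof -
    have "C * int k \<le> C' * int k" using C'(1) by (simp add: mult_right_mono)
    moreover have "C' * int k \<le> (int N + 1) * int k"
      unfolding C'(2) by (simp add: mult_right_mono)
    ultimately have "[C * int k..?hi] = [C * int k..C' * int k - 1] @ [C' * int k..?hi]"
      by (intro upto_split) auto
    then show ?thesis by (simp add: C'(1))
  qed
  have summand: "?w T C 0 J L * psum (labels k) (\<lambda>c. ?w T C (Suc c)) n L (empty_label k) =
     (if posset k C J \<subseteq> T then
       (if posset k C L \<inter> U = {} \<and> posset k (C + 1) L \<subseteq> U
        then y ^ label_size k L * tpow (phi k L (lab k U C)) *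
          kp k y ?rest ((U \<union> posset k C L) - posset k (C + 1) L) S else 0) else 0)"
    if L: "L \<in> labels k" for L
  proof (cases "posset k C J \<subseteq> T \<and> posset k C L \<inter> (T - posset k C J) = {} \<and>
    (T - posset k C J \<union> posset k C L) \<inter> col k C = S \<inter> col k C")
    case True
    then have w: "?w T C 0 J L = y ^ label_size k L * tpow (phi k L (lab k U C))"
    proof -
      have c: "(\<forall>c\<in>{1..k}. lab k S C c + J c = lab k T C c + L c) \<and> (\<forall>c\<in>{1..k}. lab k T C c \<ge> J c)"
        using True by (rule purple_cond[OF k Suc.prems(1) L, THEN iffD2])
      have "phi k L (\<lambda>c. lab k T C c - J c) = phi k L (lab k U C)"
      proof (rule phi_cong)
        fix a assume a: "a \<in> {1..k}"
        have "pc k C a \<in> U \<longleftrightarrow> pc k C a \<in> T \<and> J a \<noteq> 1" using mem_posset[OF a, of C J] by (simp add: U_def)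
        then show "lab k T C a - J a = lab k U C a"
          using bspec[OF conjunct2[OF c] a] labels_cases[OF Suc.prems(1) a]
          by (auto simp: lab_apply[OF a] split: if_splits)
      qed
      with c show ?thesis unfolding purple_weight_def by simp
    qed
    have i1: "posset k C' L \<subseteq> T' \<longleftrightarrow> posset k (C + 1) L \<subseteq> U"
      using sub(1)[of L] sub(2)[of J] disj by (auto simp: T'_def U_def replace_col_def C'(1))
    have i2: "T' - posset k C' L = (U \<union> posset k C L) - posset k (C + 1) L"
    proof (rule set_eqI)
      fix p
      show "p \<in> T' - posset k C' L \<longleftrightarrow> p \<in> (U \<union> posset k C L) - posset k (C + 1) L"
      proof (cases "p \<in> col k C")
        case pC: True
        then have "p \<in> S \<longleftrightarrow> p \<in> T - posset k C J \<union> posset k C L" using True by blast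
        then show ?thesis using pC sub disj by (auto simp: T'_def U_def replace_col_def C'(1))
      next
        case False
        then show ?thesis using sub(2)[of J] sub(2)[of L] by (auto simp: T'_def U_def replace_col_def C'(1))
      qed
    qed
    have "posset k C L \<inter> U = {}" using True by (simp add: U_def)
    then show ?thesis
      unfolding psum_T IH[OF L] w i1 i2 using True by simp
  next
    case False
    then have "?w T C 0 J L = 0"
      using purple_cond[OF k Suc.prems(1) L, of S C T] unfolding purple_weight_def by auto
    moreover have "kp k y ?rest ((U \<union> posset k C L) - posset k (C + 1) L) S = 0"
      if "posset k C J \<subseteq> T" "posset k C L \<inter> U = {}"
    proof (rule ccontr)
      assume nz: "kp k y ?rest ((U \<union> posset k C L) - posset k (C + 1) L) S \<noteq> 0"
      have "p \<in> (U \<union> posset k C L) - posset k (C + 1) L \<longleftrightarrow> p \<in> S" if "p \<in> col k C" for p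
      proof (rule kp_outside[OF nz])
        show "p \<notin> set ?rest" "p - int k \<notin> set ?rest"
          using that by (auto simp: col_def C'(1) algebra_simps)
      qed
      then have "(T - posset k C J \<union> posset k C L) \<inter> col k C = S \<inter> col k C"
        using out[of _ L] by (fastforce simp: U_def C'(1))
      then show False using False that by (auto simp: U_def)
    qed
    ultimately show ?thesis by auto
  qed
  have "psum (labels k) (?w T C) (Suc n) J (empty_label k) =
      (\<Sum>L\<in>labels k. ?w T C 0 J L * psum (labels k) (\<lambda>c. ?w T C (Suc c)) n L (empty_label k))"
    by (rule psum_left[OF finite_labels Suc.prems(1) empty_label_labels])
  also have "\<dots> = (\<Sum>L\<in>labels k. if posset k C J \<subseteq> T then
       (if posset k C L \<inter> U = {} \<and> posset k (C + 1) L \<subseteq> U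
        then y ^ label_size k L * tpow (phi k L (lab k U C)) *
          kp k y ?rest ((U \<union> posset k C L) - posset k (C + 1) L) S else 0) else 0)"
    by (rule sum.cong[OF refl summand])
  also have "\<dots> = (if posset k C J \<subseteq> T then
      (\<Sum>L\<in>labels k. if posset k C L \<inter> U = {} \<and> posset k (C + 1) L \<subseteq> U
        then y ^ label_size k L * tpow (phi k L (lab k U C)) *
          kp k y ?rest ((U \<union> posset k C L) - posset k (C + 1) L) S else 0) else 0)"
    by simp
  finally show ?case
    unfolding list kp_column_ascending[OF k] U_def[symmetric] .
qed

text \<open>\<open>white_prefix\<close> yields the columns \<open>- l - 1\<close> to
  \<open>N - 1\<close>, and \<open>pos\<close> the columns \<open>- l\<close> to \<open>N\<close>;
  the columns in which they differ are idle for states in the window.\<close>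

lemma white_row:
  assumes k: "k > 0" and S: "fits k l N S" and T: "fits k l N T"
  shows "psum (labels k) (\<lambda>c J L. white_weight k x (lab k S (int c - int l)) J (lab k T (int c - int l)) L)
    (l + N + 1) (empty_label k) (empty_label k) = kp k x (rev (pos k l N)) T S"
proof -
  let ?f = "filter (\<lambda>p. - int l * int k \<le> p \<and> p < int N * int k)"
  have 1: "- (int l + 1) * int k \<le> - int l * int k" by (simp add: algebra_simps)
  have "psum (labels k) (\<lambda>c J L. white_weight k x (lab k S (int c - int l)) J (lab k T (int c - int l)) L)
    (l + N + 1) (empty_label k) (empty_label k) =
    kp k x (rev [- (int l + 1) * int k..int N * int k - 1]) T S"
    by (subst white_prefix[OF k empty_label_labels, where C = "int N"])
      (use S T in \<open>auto simp: fits_def posset_empty label_size_empty phi_empty\<close>)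
  also have "\<dots> = kp k x (?f (rev [- (int l + 1) * int k..int N * int k - 1])) T S"
    by (rule kp_filter[OF T])
  also have "?f (rev [- (int l + 1) * int k..int N * int k - 1]) = ?f (rev (pos k l N))"
    unfolding pos_def rev_filter[symmetric] filter_upto using 1 by (simp add: algebra_simps)
  also have "kp k x \<dots> T S = kp k x (rev (pos k l N)) T S"
    by (rule kp_filter[OF T, symmetric])
  finally show ?thesis .
qed

lemma purple_row:
  assumes k: "k > 0" and S: "fits k l N S" and T: "fits k l N T"
  shows "psum (labels k) (\<lambda>c J L. purple_weight k y (lab k S (int c - int l)) J (lab k T (int c - int l)) L)
    (l + N + 1) (empty_label k) (empty_label k) = kp k y (pos k l N) T S"
proof -
  have "(- int l) + int c = int c - int l" for c by simp
  then show ?thesis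
    using purple_suffix[OF k empty_label_labels, of "- int l" N "l + N + 1" S T y] S T
    by (auto simp: fits_def posset_empty pos_def)
qed

section \<open>The partition function as a product of kernels\<close>

definition rows :: "nat \<Rightarrow> nat \<Rightarrow> nat \<Rightarrow> (int \<Rightarrow> nat \<Rightarrow> int) set" where
  "rows k l N = {- int l..int N} \<rightarrow>\<^sub>E labels k"

definition row_sum :: "nat \<Rightarrow> nat \<Rightarrow> nat \<Rightarrow>
    ((nat \<Rightarrow> int) \<Rightarrow> (nat \<Rightarrow> int) \<Rightarrow> (nat \<Rightarrow> int) \<Rightarrow> (nat \<Rightarrow> int) \<Rightarrow> series) \<Rightarrow>
    (int \<Rightarrow> nat \<Rightarrow> int) \<Rightarrow> (int \<Rightarrow> nat \<Rightarrow> int) \<Rightarrow> series" where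
  "row_sum k l N w b t = psum (labels k) (\<lambda>c J L. w (b (int c - int l)) J (t (int c - int l)) L)
    (l + N + 1) (empty_label k) (empty_label k)"

lemma prod_columns:
  "(\<Prod>C\<in>{- int l..int N}. f C) = (\<Prod>c<l + N + 1. f (int c - int l))"
  by (rule prod.reindex_bij_witness[where i = "\<lambda>c. int c - int l" and j = "\<lambda>C. nat (C + int l)"]) auto

text \<open>Separates the rows of vertical labels from the words of horizontal labels. Counters are
  shifted so that both become members of \<open>paths\<close>: lattice row \<open>Suc r\<close> lies
  between the vertical rows \<open>r\<close> and \<open>Suc r\<close>, and column \<open>- l\<close>
  becomes 0.\<close>

definition split_config where
  "split_config l N R = (\<lambda>(v :: int \<times> nat \<Rightarrow> nat \<Rightarrow> int, h :: int \<times> nat \<Rightarrow> nat \<Rightarrow> int).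
    (\<lambda>r\<in>{0..R}. \<lambda>C\<in>{- int l..int N}. v (C, r),
     \<lambda>r\<in>{..<R}. \<lambda>c\<in>{0..l + N + 1}. h (int c - int l, Suc r)))"

definition join_config where
  "join_config l N R = (\<lambda>(u :: nat \<Rightarrow> int \<Rightarrow> nat \<Rightarrow> int, g :: nat \<Rightarrow> nat \<Rightarrow> nat \<Rightarrow> int).
    (\<lambda>z\<in>{- int l..int N} \<times> {0..R}. u (snd z) (fst z),
     \<lambda>z\<in>{- int l..int N + 1} \<times> {1..R}. g (snd z - 1) (nat (fst z + int l))))"

lemma bij_configurations:
  assumes b: "b = (\<lambda>C\<in>{- int l..int N}. boundary_label k l mu C)"
    and t: "t = (\<lambda>C\<in>{- int l..int N}. boundary_label k l lam C)"
  shows "bij_betw (split_config l N R) (configurations k l N R lam mu)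
    (paths (rows k l N) R b t \<times> ({..<R} \<rightarrow>\<^sub>E paths (labels k) (l + N + 1) (empty_label k) (empty_label k)))"
    (is "bij_betw _ _ (?U \<times> (_ \<rightarrow>\<^sub>E ?P))")
proof (rule bij_betw_byWitness[where f' = "join_config l N R"])
  show "\<forall>vh\<in>configurations k l N R lam mu. join_config l N R (split_config l N R vh) = vh"
  proof
    fix vh assume "vh \<in> configurations k l N R lam mu"
    then obtain v h where vh: "vh = (v, h)"
      and v: "v \<in> {- int l..int N} \<times> {0..R} \<rightarrow>\<^sub>E labels k"
      and h: "h \<in> {- int l..int N + 1} \<times> {1..R} \<rightarrow>\<^sub>E labels k"
      by (auto simp: configurations_def)
    show "join_config l N R (split_config l N R vh) = vh"
      unfolding vh split_config_def join_config_def prod.case prod.inject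
    proof (intro conjI ext, goal_cases)
      case (1 z d)
      then show ?case using PiE_arb[OF v, of z] by (cases z) auto
    next
      case (2 z d)
      then show ?case using PiE_arb[OF h, of z] by (cases z) (auto simp: nat_le_iff)
    qed
  qed
  show "\<forall>ug\<in>?U \<times> ({..<R} \<rightarrow>\<^sub>E ?P). split_config l N R (join_config l N R ug) = ug"
  proof
    fix ug assume "ug \<in> ?U \<times> ({..<R} \<rightarrow>\<^sub>E ?P)"
    then obtain u g where ug: "ug = (u, g)" and u: "u \<in> {0..R} \<rightarrow>\<^sub>E rows k l N"
      and g: "g \<in> {..<R} \<rightarrow>\<^sub>E ?P"
      by (auto simp: paths_def)
    have u': "r \<in> {0..R} \<Longrightarrow> C \<notin> {- int l..int N} \<Longrightarrow> u r C = undefined" for r C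
      using PiE_mem[OF u, of r] unfolding rows_def by (rule PiE_arb)
    have g': "r \<in> {..<R} \<Longrightarrow> c \<notin> {0..l + N + 1} \<Longrightarrow> g r c = undefined" for r c
      using PiE_mem[OF g, of r] unfolding paths_def by (auto intro: PiE_arb)
    show "split_config l N R (join_config l N R ug) = ug"
      unfolding ug split_config_def join_config_def prod.case prod.inject
    proof (intro conjI ext, goal_cases)
      case (1 r C d)
      then show ?case using PiE_arb[OF u, of r] u'[of r C] by auto
    next
      case (2 r c d)
      then show ?case using PiE_arb[OF g, of r] g'[of r c] by auto
    qed
  qed
  show "split_config l N R ` configurations k l N R lam mu \<subseteq> ?U \<times> ({..<R} \<rightarrow>\<^sub>E ?P)"
  proof (rule image_subsetI)
    fix vh assume "vh \<in> configurations k l N R lam mu"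
    then obtain v h where vh: "vh = (v, h)" and c: "(v, h) \<in> configurations k l N R lam mu"
      by (cases vh) auto
    show "split_config l N R vh \<in> ?U \<times> ({..<R} \<rightarrow>\<^sub>E ?P)"
      unfolding vh split_config_def prod.case
    proof (rule SigmaI)
      show "(\<lambda>r\<in>{0..R}. \<lambda>C\<in>{- int l..int N}. v (C, r)) \<in> ?U"
        using c by (auto simp: configurations_def paths_def rows_def b t intro!: restrict_ext)
      show "(\<lambda>r\<in>{..<R}. \<lambda>c\<in>{0..l + N + 1}. h (int c - int l, Suc r)) \<in> {..<R} \<rightarrow>\<^sub>E ?P"
      proof (rule restrict_PiE_iff[THEN iffD2], intro ballI)
        fix r assume "r \<in> {..<R}"
        then have r: "Suc r \<in> {1..R}" by auto
        have h: "h \<in> {- int l..int N + 1} \<times> {1..R} \<rightarrow>\<^sub>E labels k"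
          and e: "h (- int l, Suc r) = empty_label k" "h (int N + 1, Suc r) = empty_label k"
          using c r unfolding configurations_def by blast+
        have "h (int c - int l, Suc r) \<in> labels k" if "c \<in> {0..l + N + 1}" for c
          by (rule PiE_mem[OF h]) (use that r in auto)
        moreover have "int (l + N + 1) - int l = int N + 1" by simp
        ultimately show "(\<lambda>c\<in>{0..l + N + 1}. h (int c - int l, Suc r)) \<in> ?P"
          using e by (simp add: paths_def add.commute)
      qed
    qed
  qed
  show "join_config l N R ` (?U \<times> ({..<R} \<rightarrow>\<^sub>E ?P)) \<subseteq> configurations k l N R lam mu"
  proof (rule image_subsetI)
    fix ug assume "ug \<in> ?U \<times> ({..<R} \<rightarrow>\<^sub>E ?P)"
    then obtain u g where ug: "ug = (u, g)" and u: "u \<in> ?U" and g: "g \<in> {..<R} \<rightarrow>\<^sub>E ?P"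
      by auto
    have ur: "u r C \<in> labels k" if "r \<in> {0..R}" "C \<in> {- int l..int N}" for r C
    proof -
      have "u r \<in> rows k l N" using u that(1) by (auto simp: paths_def)
      then show ?thesis using that(2) unfolding rows_def by (rule PiE_mem)
    qed
    have gp: "g r \<in> ?P" if "r < R" for r
      by (rule PiE_mem[OF g]) (use that in auto)
    have gr: "g r c \<in> labels k" if "r < R" "c \<le> l + N + 1" for r c
      using gp[OF that(1)] that(2) by (auto simp: paths_def)
    have ge: "g r 0 = empty_label k" "g r (l + N + 1) = empty_label k" if "r < R" for r
      using gp[OF that] by (simp_all add: paths_def)
    have ub: "u 0 = b" "u R = t" using u by (simp_all add: paths_def)
    have nn: "nat (int N + 1 + int l) = l + N + 1" by simp
    show "join_config l N R ug \<in> configurations k l N R lam mu"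
      unfolding ug configurations_def join_config_def mem_Collect_eq prod.case
    proof (intro conjI, goal_cases)
      case 1
      show ?case using ur by auto
    next
      case 2
      show ?case using gr by (auto simp: nat_le_iff)
    next
      case 3
      show ?case using ub by (auto simp: b t)
    next
      case 4
      show ?case using ge nn by auto
    qed
  qed
qed

text \<open>Once all vertical labels are fixed, the horizontal labels of different rows are
  independent, so the sum over them factors into one sum per row.\<close>

lemma partition_function_psum:
  assumes b: "b = (\<lambda>C\<in>{- int l..int N}. boundary_label k l mu C)"
    and t: "t = (\<lambda>C\<in>{- int l..int N}. boundary_label k l lam C)"
  shows "partition_function k l N n m x y lam mu =
    psum (rows k l N) (\<lambda>r. row_sum k l N (vertex_weight k n x y (Suc r))) (n + m) b t"
proof -
  let ?R = "n + m" and ?P = "paths (labels k) (l + N + 1) (empty_label k) (empty_label k)"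
  let ?w = "\<lambda>u r g. \<Prod>c<l + N + 1. vertex_weight k n x y (Suc r) (u r (int c - int l)) (g c)
    (u (Suc r) (int c - int l)) (g (Suc c))"
  have "partition_function k l N n m x y lam mu =
      (\<Sum>z\<in>configurations k l N ?R lam mu.
        case split_config l N ?R z of (u, g) \<Rightarrow> \<Prod>r<?R. ?w u r (g r))"
    unfolding partition_function_def
  proof (rule sum.cong[OF refl])
    fix z assume "z \<in> configurations k l N ?R lam mu"
    obtain v h where z: "z = (v, h)" by (cases z)
    have "(\<Prod>C\<in>{- int l..int N}. vertex_weight k n x y (Suc r) (v (C, r)) (h (C, Suc r)) (v (C, Suc r)) (h (C + 1, Suc r))) =
        ?w (\<lambda>r\<in>{0..?R}. \<lambda>C\<in>{- int l..int N}. v (C, r)) r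
          ((\<lambda>r\<in>{..<?R}. \<lambda>c\<in>{0..l + N + 1}. h (int c - int l, Suc r)) r)"
      if "r < ?R" for r
      unfolding prod_columns using that
      by (intro prod.cong) (auto simp: algebra_simps)
    then show "(case z of (v, h) \<Rightarrow> \<Prod>r = 1..?R. \<Prod>c\<in>{- int l..int N}.
        vertex_weight k n x y r (v (c, r - 1)) (h (c, r)) (v (c, r)) (h (c + 1, r))) =
      (case split_config l N ?R z of (u, g) \<Rightarrow> \<Prod>r<?R. ?w u r (g r))"
      unfolding z split_config_def prod.case One_nat_def prod.atLeast1_atMost_eq
      by (intro prod.cong) auto
  qed
  also have "\<dots> = (\<Sum>(u, g)\<in>paths (rows k l N) ?R b t \<times> ({..<?R} \<rightarrow>\<^sub>E ?P). \<Prod>r<?R. ?w u r (g r))"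
    by (rule sum.reindex_bij_betw[OF bij_configurations[OF b t]])
  also have "\<dots> = (\<Sum>u\<in>paths (rows k l N) ?R b t. \<Sum>g\<in>{..<?R} \<rightarrow>\<^sub>E ?P. \<Prod>r<?R. ?w u r (g r))"
    by (rule sum.cartesian_product[symmetric])
  also have "\<dots> = (\<Sum>u\<in>paths (rows k l N) ?R b t. \<Prod>r<?R. \<Sum>g\<in>?P. ?w u r g)"
    by (intro sum.cong refl prod_sum_PiE[symmetric]) (auto intro: finite_paths finite_labels)
  finally show ?thesis by (simp add: psum_def row_sum_def)
qed

section \<open>Rows of vertical labels as particle states\<close>

definition row_of :: "nat \<Rightarrow> nat \<Rightarrow> nat \<Rightarrow> int set \<Rightarrow> int \<Rightarrow> nat \<Rightarrow> int" where
  "row_of k l N S = (\<lambda>C\<in>{- int l..int N}. lab k S C)"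

lemma mem_window:
  fixes p :: int
  assumes "k > 0"
  shows "p < - int l * int k \<longleftrightarrow> p div int k < - int l" "p \<ge> (int N + 1) * int k \<longleftrightarrow> p div int k > int N"
  using int_less_mult_iff_div[of "int k" p "- int l - 1"] int_less_mult_iff_div[of "int k" p "int N"] assms
  by auto

text \<open>The inverse fills every column left of \<open>- l\<close> and leaves every column right
  of \<open>N\<close> empty, as \<open>fits\<close> demands.\<close>

lemma bij_row_of:
  assumes k: "k > 0"
  shows "bij_betw (row_of k l N) {S. fits k l N S} (rows k l N)"
proof (rule bij_betw_byWitness[where f' = "\<lambda>u. {p. p div int k < - int l \<or>
    (p div int k \<le> int N \<and> u (p div int k) (nat (p mod int k) + 1) = 1)}"])
  show "\<forall>S\<in>{S. fits k l N S}. {p. p div int k < - int l \<or>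
    (p div int k \<le> int N \<and> row_of k l N S (p div int k) (nat (p mod int k) + 1) = 1)} = S"
  proof (clarify, rule set_eqI)
    fix S and p :: int assume f: "fits k l N S"
    have "lab k S (p div int k) (nat (p mod int k) + 1) = (if p \<in> S then 1 else 0)"
      using pc_surj[OF k, of p] by (simp add: lab_apply)
    then show "p \<in> {p. p div int k < - int l \<or>
       (p div int k \<le> int N \<and> row_of k l N S (p div int k) (nat (p mod int k) + 1) = 1)} \<longleftrightarrow> p \<in> S"
      using f mem_window[OF k, where p = p] by (auto simp: row_of_def fits_def split: if_splits)
  qed
  show "\<forall>u\<in>rows k l N. row_of k l N {p. p div int k < - int l \<or>
    (p div int k \<le> int N \<and> u (p div int k) (nat (p mod int k) + 1) = 1)} = u"
  proof
    fix u assume u: "u \<in> rows k l N"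
    show "row_of k l N {p. p div int k < - int l \<or>
      (p div int k \<le> int N \<and> u (p div int k) (nat (p mod int k) + 1) = 1)} = u" (is "row_of k l N ?S = u")
    proof
      fix C
      show "row_of k l N ?S C = u C"
      proof (cases "C \<in> {- int l..int N}")
        case True
        have uC: "u C \<in> labels k" using u True unfolding rows_def by (rule PiE_mem)
        have "lab k ?S C = u C"
        proof (rule labels_eqI[OF lab_labels uC])
          fix a assume a: "a \<in> {1..k}"
          show "lab k ?S C a = u C a"
            using True labels_cases[OF uC a] pc_div[OF a, of C] by (auto simp: lab_apply[OF a])
        qed
        then show ?thesis using True by (simp add: row_of_def)
      next
        case False
        then show ?thesis using u by (auto simp: row_of_def rows_def)
      qed
    qed
  qed
  show "row_of k l N ` {S. fits k l N S} \<subseteq> rows k l N"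
    by (auto simp: row_of_def rows_def lab_labels)
  show "(\<lambda>u. {p. p div int k < - int l \<or>
    (p div int k \<le> int N \<and> u (p div int k) (nat (p mod int k) + 1) = 1)}) ` rows k l N \<subseteq> {S. fits k l N S}"
    using mem_window[OF k] by (auto simp: fits_def)
qed

lemma finite_rows: "finite (rows k l N)"
  unfolding rows_def by (intro finite_PiE finite_labels) auto

section \<open>Rows of the lattice as kernels\<close>

context moves
begin

text \<open>Intermediate rows of labels need not come from tuples of partitions. Above a row that
  does, such rows contribute nothing.\<close>

lemma kp_closed: "kp k y ps i j \<noteq> 0 \<Longrightarrow> j \<in> M \<Longrightarrow> i \<in> M"
proof (induction ps arbitrary: i)
  case (Cons p ps)
  show ?case
  proof (cases "kp k y ps i j = 0")
    case True
    with Cons.prems have d: "can_dn k p i" "kp k y ps (dn k p i) j \<noteq> 0" by (auto split: if_splits)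
    then have M: "dn k p i \<in> M" using Cons by blast
    have "can_up k p (dn k p i)" "up k p (dn k p i) = i"
      using d(1) k_pos by (auto simp: can_dn_def can_up_def dn_def up_def)
    then show ?thesis using up_closed[OF M, of p] by simp
  qed (use Cons in auto)
qed (auto split: if_splits)

definition row_kernel :: "nat \<Rightarrow> (nat \<Rightarrow> series) \<Rightarrow> (nat \<Rightarrow> series) \<Rightarrow> nat \<Rightarrow> int set \<Rightarrow> int set \<Rightarrow> series" where
  "row_kernel n x y r = (if r \<le> n then Uk (x r) else Vk (y (r - n)))"

lemma row_sum_kernel:
  assumes S: "S \<in> M" "fits k l N S" and T: "fits k l N T"
  shows "row_sum k l N (vertex_weight k n x y r) (row_of k l N S) (row_of k l N T) =
    row_kernel n x y r T S"
proof -
  let ?c = "if r \<le> n then kp k (x r) (rev (pos k l N)) T S else kp k (y (r - n)) (pos k l N) T S"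
  have "row_sum k l N (vertex_weight k n x y r) (row_of k l N S) (row_of k l N T) =
    psum (labels k) (\<lambda>c J L. vertex_weight k n x y r (lab k S (int c - int l)) J (lab k T (int c - int l)) L)
      (l + N + 1) (empty_label k) (empty_label k)"
    unfolding row_sum_def row_of_def by (rule psum_cong) auto
  also have "\<dots> = ?c"
    using white_row[OF k_pos S(2) T, of "x r"] purple_row[OF k_pos S(2) T, of "y (r - n)"]
    by (simp add: vertex_weight_def)
  also have "\<dots> = row_kernel n x y r T S"
  proof (cases "T \<in> M")
    case True
    then show ?thesis using S T by (simp add: row_kernel_def Vk_eq Uk_eq)
  next
    case False
    then have "?c = 0" using kp_closed[of _ _ T S] S(1) by auto
    then show ?thesis using False by (simp add: row_kernel_def Uk_def Vk_def)
  qed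
  finally show ?thesis .
qed

lemma row_kernel_fits:
  assumes "row_kernel n x y r T S \<noteq> 0" "fits k l N T"
  shows "fits k l N S"
proof -
  have "T \<in> M" "S \<in> M" using assms(1) by (auto simp: row_kernel_def Uk_def Vk_def split: if_splits)
  then show ?thesis
    using assms kp_fits[of k l N T _ _ S] by (auto simp: row_kernel_def Uk_eq Vk_eq split: if_splits)
qed

text \<open>The lattice sums over the states in the window, \<open>kmult\<close> over all of
  \<open>M\<close>. The two agree because going down a row keeps a state in the window and states
  outside \<open>M\<close> contribute zero.\<close>

lemma psum_rows:
  assumes x: "\<And>r. r \<in> {1..R} \<Longrightarrow> band (row_kernel n x y r)"
    and S: "S \<in> M" "fits k l N S" and T: "fits k l N T"
  shows "psum (rows k l N) (\<lambda>r. row_sum k l N (vertex_weight k n x y (Suc r))) R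
    (row_of k l N S) (row_of k l N T) = kprod (row_kernel n x y) R T S"
  using x T
proof (induction R arbitrary: T)
  case 0
  have "row_of k l N S \<in> rows k l N" using bij_row_of[OF k_pos] S(2) by (auto simp: bij_betw_def)
  moreover have "row_of k l N S = row_of k l N T \<longleftrightarrow> S = T"
    using bij_row_of[OF k_pos, of l N] S(2) 0(2) by (auto simp: bij_betw_def inj_on_def)
  ultimately show ?case using S(1) by (auto simp: psum_0 kid_def)
next
  case (Suc R)
  let ?K = "row_kernel n x y" and ?ro = "row_of k l N"
  let ?w = "\<lambda>r. row_sum k l N (vertex_weight k n x y (Suc r))"
  have bij: "bij_betw ?ro {S. fits k l N S} (rows k l N)" by (rule bij_row_of[OF k_pos])
  have fin: "finite {S. fits k l N S}"
    using bij_betw_finite[OF bij] finite_rows by simp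
  have bK: "band (kprod ?K R)" "band (?K (Suc R))" using Suc.prems(1) by (auto intro: band_kprod)
  have zero: "kprod ?K R i S = 0" if "i \<notin> M" for i using band_zero[OF bK(1)] that by blast
  have roT: "?ro T \<in> rows k l N" using bij Suc.prems(2) by (auto simp: bij_betw_def)
  have "psum (rows k l N) ?w (Suc R) (?ro S) (?ro T) =
      (\<Sum>s\<in>rows k l N. psum (rows k l N) ?w R (?ro S) s * ?w R s (?ro T))"
    by (rule psum_Suc[OF finite_rows roT])
  also have "\<dots> = (\<Sum>i\<in>{S. fits k l N S}. psum (rows k l N) ?w R (?ro S) (?ro i) * ?w R (?ro i) (?ro T))"
    by (rule sum.reindex_bij_betw[OF bij, symmetric])
  also have "\<dots> = (\<Sum>i\<in>{S. fits k l N S}. kprod ?K R i S * ?w R (?ro i) (?ro T))"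
    by (rule sum.cong) (use Suc in auto)
  also have "\<dots> = (\<Sum>i\<in>{i \<in> M. fits k l N i}. ?K (Suc R) T i * kprod ?K R i S)"
  proof (rule sum.mono_neutral_cong_right)
    show "finite {S. fits k l N S}" by (rule fin)
    show "{i \<in> M. fits k l N i} \<subseteq> {S. fits k l N S}" by auto
    show "\<forall>i\<in>{S. fits k l N S} - {i \<in> M. fits k l N i}. kprod ?K R i S * ?w R (?ro i) (?ro T) = 0"
    proof
      fix i assume "i \<in> {S. fits k l N S} - {i \<in> M. fits k l N i}"
      then have "i \<notin> M" by auto
      then show "kprod ?K R i S * ?w R (?ro i) (?ro T) = 0" by (simp add: zero)
    qed
  qed (simp add: row_sum_kernel Suc.prems(2) mult.commute)
  also have "\<dots> = kprod ?K (Suc R) T S"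
  proof (cases "T \<in> M")
    case True
    have "(?K (Suc R) \<star> kprod ?K R) T S = (\<Sum>i\<in>{i \<in> M. fits k l N i}. ?K (Suc R) T i * kprod ?K R i S)"
      using True S(1) fin row_kernel_fits[of n x y "Suc R" T _ l N] Suc.prems(2)
      by (intro kmult_finite_support) auto
    then show ?thesis by simp
  next
    case False
    then show ?thesis using band_zero[OF bK(2), of T] by (simp add: kmult_def)
  qed
  finally show ?case .
qed

end

section \<open>Partitions as particle configurations\<close>

text \<open>The Maya diagram of a partition, also called its beta set. Parts are indexed from 0, so
  \<open>- int j - 1\<close> is the usual \<open>- j\<close>.\<close>

definition maya1 :: "(nat \<Rightarrow> nat) \<Rightarrow> int set" where
  "maya1 f = range (\<lambda>j. int (f j) - int j - 1)"

text \<open>The \<open>k\<close> Maya diagrams interleaved into one, as when a partition is built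
  from its \<open>k\<close>-quotient.\<close>

definition maya :: "nat \<Rightarrow> ptuple \<Rightarrow> int set" where
  "maya k \<rho> = {p. p div int k \<in> maya1 (\<rho> (nat (p mod int k) + 1))}"

lemma partitions_antimono: "f \<in> partitions \<Longrightarrow> i \<le> j \<Longrightarrow> f j \<le> f i"
  by (auto simp: partitions_def antimono_def)

lemma content_strict: "f \<in> partitions \<Longrightarrow> i < j \<Longrightarrow> int (f j) - int j < int (f i) - int i"
  using partitions_antimono[of f i j] by auto

lemma content_inj: "f \<in> partitions \<Longrightarrow> int (f i) - int i = int (f j) - int j \<longleftrightarrow> i = j"
  using content_strict[of f i j] content_strict[of f j i] by (cases i j rule: linorder_cases) auto

lemma partitions_update:
  assumes "f \<in> partitions" "f (Suc j) \<le> c" "\<And>i. j = Suc i \<Longrightarrow> c \<le> f i"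
  shows "f(j := c) \<in> partitions"
proof -
  have "antimono (f(j := c))"
    using assms(2,3) partitions_antimono[OF assms(1)] by (intro decseq_SucI) auto
  moreover have "finite {i. (f(j := c)) i \<noteq> 0}"
    by (rule finite_subset[of _ "insert j {i. f i \<noteq> 0}"]) (use assms(1) in \<open>auto simp: partitions_def\<close>)
  ultimately show ?thesis by (simp add: partitions_def)
qed

lemma maya1_update:
  assumes "f \<in> partitions"
  shows "maya1 (f(j := c)) = insert (int c - int j - 1) (maya1 f - {int (f j) - int j - 1})"
proof -
  have "maya1 (f(j := c)) = insert (int c - int j - 1) ((\<lambda>i. int (f i) - int i - 1) ` (- {j}))"
    by (force simp: maya1_def)
  also have "(\<lambda>i. int (f i) - int i - 1) ` (- {j}) = maya1 f - {int (f j) - int j - 1}"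
    using content_inj[OF assms] by (auto simp: maya1_def)
  finally show ?thesis .
qed

text \<open>The move adds a box to row \<open>j\<close>; the free place \<open>C + 1\<close> forces
  the preceding row to be strictly longer.\<close>

lemma maya1_up:
  assumes f: "f \<in> partitions" and C: "C \<in> maya1 f" "C + 1 \<notin> maya1 f"
  shows "\<exists>g\<in>partitions. maya1 g = insert (C + 1) (maya1 f - {C})"
proof -
  obtain j where j: "C = int (f j) - int j - 1" using C(1) by (auto simp: maya1_def)
  have "f(j := Suc (f j)) \<in> partitions"
  proof (rule partitions_update[OF f])
    show "f (Suc j) \<le> Suc (f j)" using partitions_antimono[OF f, of j "Suc j"] by simp
    fix i assume i: "j = Suc i"
    have "C + 1 \<noteq> int (f i) - int i - 1" using C(2) by (auto simp: maya1_def)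
    then show "Suc (f j) \<le> f i" using partitions_antimono[OF f, of i j] i j by auto
  qed
  moreover have "maya1 (f(j := Suc (f j))) = insert (C + 1) (maya1 f - {C})"
    unfolding maya1_update[OF f] j by (simp add: algebra_simps)
  ultimately show ?thesis by blast
qed

text \<open>The move removes a box from row \<open>j\<close>; the free place \<open>C\<close> forces
  the next row to be strictly shorter.\<close>

lemma maya1_dn:
  assumes f: "f \<in> partitions" and C: "C + 1 \<in> maya1 f" "C \<notin> maya1 f"
  shows "\<exists>g\<in>partitions. maya1 g = insert C (maya1 f - {C + 1})"
proof -
  obtain j where j: "C + 1 = int (f j) - int j - 1" using C(1) by (auto simp: maya1_def)
  have "int (f (Suc j)) - int (Suc j) - 1 \<in> maya1 f" unfolding maya1_def by (rule range_eqI[OF refl])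
  then have "C \<noteq> int (f (Suc j)) - int (Suc j) - 1" using C(2) by metis
  then have less: "f (Suc j) < f j" using partitions_antimono[OF f, of j "Suc j"] j by auto
  have "f(j := f j - 1) \<in> partitions"
  proof (rule partitions_update[OF f])
    show "f (Suc j) \<le> f j - 1" using less by simp
    fix i assume i: "j = Suc i"
    show "f j - 1 \<le> f i" using partitions_antimono[OF f, of i j] i by simp
  qed
  moreover have "maya1 (f(j := f j - 1)) = insert C (maya1 f - {C + 1})"
  proof -
    have "int (f j - 1) - int j - 1 = C" using less j by (simp add: of_nat_diff)
    then show ?thesis unfolding maya1_update[OF f] j[symmetric] by simp
  qed
  ultimately show ?thesis by blast
qed

text \<open>Compare from the largest part on. If all earlier parts agree, the particle of part
  \<open>j\<close> of one partition belongs to a part of index at least \<open>j\<close> of the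
  other, and those particles lie no further right than that of part \<open>j\<close>.\<close>

lemma maya1_inj:
  assumes f: "f \<in> partitions" and g: "g \<in> partitions" and e: "maya1 f = maya1 g"
  shows "f = g"
proof -
  have le: "f' j \<le> g' j" if f': "f' \<in> partitions" and g': "g' \<in> partitions" and e': "maya1 f' = maya1 g'"
    and eq: "\<And>i. i < j \<Longrightarrow> f' i = g' i" for f' g' :: "nat \<Rightarrow> nat" and j
  proof -
    have "int (f' j) - int j - 1 \<in> maya1 g'" using e' by (auto simp: maya1_def)
    then obtain i where i: "int (f' j) - int j = int (g' i) - int i" by (auto simp: maya1_def)
    have "\<not> i < j" using eq[of i] i content_inj[OF f', of i j] by auto
    then have "int (g' i) - int i \<le> int (g' j) - int j"
      using content_strict[OF g', of j i] by (cases "i = j") auto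
    then show ?thesis using i by simp
  qed
  have "f j = g j" for j
  proof (induction j rule: less_induct)
    case (less j)
    then show ?case using le[OF f g e] le[OF g f e[symmetric]] by (metis antisym)
  qed
  then show ?thesis by auto
qed

lemma num_parts_le_iff:
  assumes "f \<in> partitions"
  shows "f j = 0 \<longleftrightarrow> num_parts f \<le> j"
proof -
  define n where "n = (LEAST n. f n = 0)"
  have ex: "\<exists>n. f n = 0"
  proof (rule ccontr)
    assume "\<nexists>n. f n = 0"
    then have "{i. f i \<noteq> 0} = UNIV" by auto
    then show False using assms by (simp add: partitions_def)
  qed
  have n: "f n = 0" unfolding n_def using ex by (rule LeastI_ex)
  have iff: "f i = 0 \<longleftrightarrow> n \<le> i" for i
    using partitions_antimono[OF assms, of n i] n Least_le[of "\<lambda>n. f n = 0" i] by (auto simp: n_def)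
  have "{j. j \<ge> 1 \<and> part f j \<noteq> 0} = {1..n}"
    using iff by (auto simp: part_def not_le)
  then have "num_parts f = n" by (simp add: num_parts_def)
  then show ?thesis using iff by simp
qed

lemma maya1_low:
  assumes "f \<in> partitions" "num_parts f \<le> l" "C < - int l"
  shows "C \<in> maya1 f"
proof -
  have "l \<le> nat (- C - 1)" using assms(3) by linarith
  then have "f (nat (- C - 1)) = 0" using num_parts_le_iff[OF assms(1)] assms(2) by simp
  then have "C = int (f (nat (- C - 1))) - int (nat (- C - 1)) - 1" using assms(3) by simp
  then show ?thesis unfolding maya1_def by (rule range_eqI)
qed

lemma maya1_high:
  assumes "f \<in> partitions" "f 0 \<le> N" "C > int N"
  shows "C \<notin> maya1 f"
proof
  assume "C \<in> maya1 f"
  then obtain j where "C = int (f j) - int j - 1" by (auto simp: maya1_def)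
  moreover have "f j \<le> f 0" using partitions_antimono[OF assms(1), of 0 j] by simp
  ultimately show False using assms(2,3) by linarith
qed

lemma tuple_partition: "\<alpha> \<in> partition_tuples k \<Longrightarrow> a \<in> {1..k} \<Longrightarrow> \<alpha> a \<in> partitions"
  unfolding partition_tuples_def by (rule PiE_mem)

lemma pc_maya: "a \<in> {1..k} \<Longrightarrow> pc k C a \<in> maya k \<alpha> \<longleftrightarrow> C \<in> maya1 (\<alpha> a)"
  using pc_div[of a k C] by (simp add: maya_def)

definition has_parts :: "nat \<Rightarrow> ptuple \<Rightarrow> nat \<Rightarrow> bool" where
  "has_parts k \<alpha> l \<longleftrightarrow> (\<forall>a\<in>{1..k}. num_parts (\<alpha> a) \<le> l)"

lemma fits_maya:
  assumes k: "k > 0" and \<alpha>: "\<alpha> \<in> partition_tuples k" and l: "has_parts k \<alpha> l"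
    and N: "\<And>a. a \<in> {1..k} \<Longrightarrow> \<alpha> a 0 \<le> N"
  shows "fits k l N (maya k \<alpha>)"
  unfolding fits_def
proof (intro conjI allI impI)
  fix p :: int
  let ?a = "nat (p mod int k) + 1"
  have a: "?a \<in> {1..k}" by (rule pc_surj[OF k])
  note al = tuple_partition[OF \<alpha> a]
  show "p \<in> maya k \<alpha>" if "p < - int l * int k"
    using maya1_low[OF al, of l] l a mem_window(1)[OF k, of p l] that by (auto simp: maya_def has_parts_def)
  show "p \<notin> maya k \<alpha>" if "p \<ge> (int N + 1) * int k"
    using maya1_high[OF al N[OF a]] mem_window(2)[OF k, of N p] that by (auto simp: maya_def)
qed

lemma has_parts_max:
  assumes "k > 0"
  shows "has_parts k \<alpha> (max_num_parts k \<alpha> \<beta>)" "has_parts k \<beta> (max_num_parts k \<alpha> \<beta>)"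
proof -
  have "max (num_parts (\<alpha> a)) (num_parts (\<beta> a)) \<le> max_num_parts k \<alpha> \<beta>" if "a \<in> {1..k}" for a
    unfolding max_num_parts_def by (rule Max_ge) (use that in auto)
  then show "has_parts k \<alpha> (max_num_parts k \<alpha> \<beta>)" "has_parts k \<beta> (max_num_parts k \<alpha> \<beta>)"
    by (auto simp: has_parts_def)
qed

lemma has_parts_max_iff:
  assumes "k > 0"
  shows "max_num_parts k \<alpha> \<beta> \<le> L \<longleftrightarrow> has_parts k \<alpha> L \<and> has_parts k \<beta> L"
proof -
  have "{1..k} \<noteq> {}" using assms by auto
  then show ?thesis unfolding max_num_parts_def has_parts_def by (subst Max_le_iff) auto
qed

lemma max_part_ge:
  assumes "a \<in> {1..k}"
  shows "\<alpha> a 0 \<le> max_part k \<alpha> \<beta>" "\<beta> a 0 \<le> max_part k \<alpha> \<beta>"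
proof -
  have "max (part (\<alpha> a) 1) (part (\<beta> a) 1) \<le> max_part k \<alpha> \<beta>"
    unfolding max_part_def by (rule Max_ge) (use assms in auto)
  then show "\<alpha> a 0 \<le> max_part k \<alpha> \<beta>" "\<beta> a 0 \<le> max_part k \<alpha> \<beta>" by (auto simp: part_def)
qed

text \<open>Parts beyond the \<open>l\<close>-th are zero and put their particles in columns left of
  \<open>- l\<close>, so stopping after \<open>l\<close> parts is invisible in the lattice.\<close>

lemma boundary_label_maya:
  assumes \<alpha>: "\<alpha> \<in> partition_tuples k" and l: "has_parts k \<alpha> l" and C: "C \<ge> - int l"
  shows "boundary_label k l \<alpha> C = lab k (maya k \<alpha>) C"
  unfolding boundary_label_def lab_def
proof (rule restrict_ext)
  fix a assume a: "a \<in> {1..k}"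
  have "(\<exists>j\<in>{1..l}. C = int (part (\<alpha> a) j) - int j) \<longleftrightarrow> C \<in> maya1 (\<alpha> a)"
  proof
    assume "\<exists>j\<in>{1..l}. C = int (part (\<alpha> a) j) - int j"
    then obtain j where "j \<ge> 1" "C = int (\<alpha> a (j - 1)) - int j" by (auto simp: part_def)
    then have "C = int (\<alpha> a (j - 1)) - int (j - 1) - 1" by (simp add: of_nat_diff)
    then show "C \<in> maya1 (\<alpha> a)" unfolding maya1_def by (rule range_eqI)
  next
    assume "C \<in> maya1 (\<alpha> a)"
    then obtain j where j: "C = int (\<alpha> a j) - int j - 1" by (auto simp: maya1_def)
    have "j < l"
    proof (rule ccontr)
      assume "\<not> j < l"
      then have "\<alpha> a j = 0"
        using num_parts_le_iff[OF tuple_partition[OF \<alpha> a], of j] bspec[OF l[unfolded has_parts_def] a] by simp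
      with j C \<open>\<not> j < l\<close> show False by simp
    qed
    then have "Suc j \<in> {1..l}" "C = int (part (\<alpha> a) (Suc j)) - int (Suc j)"
      using j by (auto simp: part_def)
    then show "\<exists>j\<in>{1..l}. C = int (part (\<alpha> a) j) - int j" by blast
  qed
  then show "(if \<exists>j\<in>{1..l}. C = int (part (\<alpha> a) j) - int j then 1 else 0) =
      (if pc k C a \<in> maya k \<alpha> then 1 else 0 :: int)"
    by (simp add: pc_maya[OF a])
qed

section \<open>Tuples of partitions as states\<close>

definition mayas :: "nat \<Rightarrow> int set set" where
  "mayas k = maya k ` partition_tuples k"

lemma bij_maya:
  assumes k: "k > 0"
  shows "bij_betw (maya k) (partition_tuples k) (mayas k)"
  unfolding bij_betw_def mayas_def
proof (intro conjI inj_onI refl)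
  fix \<alpha> \<beta> assume \<alpha>: "\<alpha> \<in> partition_tuples k" and \<beta>: "\<beta> \<in> partition_tuples k"
    and e: "maya k \<alpha> = maya k \<beta>"
  show "\<alpha> = \<beta>"
  proof (rule PiE_ext[OF \<alpha>[unfolded partition_tuples_def] \<beta>[unfolded partition_tuples_def]])
    fix a assume a: "a \<in> {1..k}"
    have "C \<in> maya1 (\<alpha> a) \<longleftrightarrow> C \<in> maya1 (\<beta> a)" for C
      using e pc_maya[OF a, of C \<alpha>] pc_maya[OF a, of C \<beta>] by simp
    then show "\<alpha> a = \<beta> a"
      by (intro maya1_inj tuple_partition[OF \<alpha> a] tuple_partition[OF \<beta> a]) auto
  qed
qed

lemma maya_update:
  assumes k: "k > 0" and a: "a \<in> {1..k}"
    and g: "maya1 g = insert D (maya1 (\<alpha> a) - {C})"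
  shows "maya k (\<alpha>(a := g)) = insert (pc k D a) (maya k \<alpha> - {pc k C a})"
proof (rule set_eqI)
  fix p
  let ?b = "nat (p mod int k) + 1"
  have p: "p = pc k (p div int k) ?b" "?b \<in> {1..k}" using pc_surj[OF k, of p] by simp_all
  have eq: "p = pc k E a \<longleftrightarrow> p div int k = E \<and> ?b = a" for E
    using p(1) pc_div[OF a, of E] by metis
  show "p \<in> maya k (\<alpha>(a := g)) \<longleftrightarrow> p \<in> insert (pc k D a) (maya k \<alpha> - {pc k C a})"
    using g by (cases "?b = a") (auto simp: maya_def eq)
qed

lemma tuple_update:
  "\<alpha> \<in> partition_tuples k \<Longrightarrow> a \<in> {1..k} \<Longrightarrow> g \<in> partitions \<Longrightarrow> \<alpha>(a := g) \<in> partition_tuples k"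
  unfolding partition_tuples_def by (auto simp: PiE_def extensional_def Pi_def)

lemma mayas_moves:
  assumes k: "k > 0" and S: "S \<in> mayas k"
  shows "can_up k p S \<Longrightarrow> up k p S \<in> mayas k" and "can_dn k p S \<Longrightarrow> dn k p S \<in> mayas k"
proof -
  obtain \<alpha> where \<alpha>: "\<alpha> \<in> partition_tuples k" "S = maya k \<alpha>" using S by (auto simp: mayas_def)
  define C a where "C = p div int k" and "a = nat (p mod int k) + 1"
  have p: "p = pc k C a" and a: "a \<in> {1..k}" using pc_surj[OF k, of p] by (simp_all add: C_def a_def)
  have move: "insert (pc k D a) (S - {pc k E a}) \<in> mayas k"
    if "\<exists>g\<in>partitions. maya1 g = insert D (maya1 (\<alpha> a) - {E})" for D E
    using that maya_update[OF k a] tuple_update[OF \<alpha>(1) a] by (metis \<alpha>(2) image_eqI mayas_def)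
  show "up k p S \<in> mayas k" if "can_up k p S"
    using that move[OF maya1_up[OF tuple_partition[OF \<alpha>(1) a], of C]] pc_maya[OF a]
    by (simp add: can_up_def up_def \<alpha>(2) p pc_add)
  show "dn k p S \<in> mayas k" if "can_dn k p S"
    using that move[OF maya1_dn[OF tuple_partition[OF \<alpha>(1) a], of C]] pc_maya[OF a]
    by (simp add: can_dn_def dn_def \<alpha>(2) p pc_add)
qed

lemma mayas_fits:
  assumes k: "k > 0" and S: "S \<in> mayas k"
  shows "\<exists>r. fits k r r S"
proof -
  obtain \<alpha> where \<alpha>: "\<alpha> \<in> partition_tuples k" "S = maya k \<alpha>" using S by (auto simp: mayas_def)
  have "fits k (max_num_parts k \<alpha> \<alpha>) (max_part k \<alpha> \<alpha>) S"
    unfolding \<alpha>(2) by (intro fits_maya k \<alpha>(1) has_parts_max max_part_ge)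
  then show ?thesis using fits_mono by (metis max.cobounded1 max.cobounded2)
qed

text \<open>The total number of boxes, read off from particles and holes.\<close>

definition psize :: "nat \<Rightarrow> int set \<Rightarrow> nat" where
  "psize k S = (\<Sum>p\<in>{p \<in> S. p \<ge> 0}. nat (p div int k + 1)) +
     (\<Sum>p\<in>{p. p < 0 \<and> p \<notin> S}. nat (- (p div int k) - 1))"

lemma finite_fits_parts:
  assumes "fits k L N S"
  shows "finite {p \<in> S. p \<ge> c}" "finite {p. p < c \<and> p \<notin> S}"
proof -
  have "p \<le> (int N + 1) * int k" if "p \<in> S" for p
  proof (rule ccontr)
    assume "\<not> p \<le> (int N + 1) * int k"
    then have "p \<ge> (int N + 1) * int k" by linarith
    with assms that show False unfolding fits_def by blast
  qed
  then have "{p \<in> S. p \<ge> c} \<subseteq> {c..(int N + 1) * int k}" by (simp add: subset_iff)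
  then show "finite {p \<in> S. p \<ge> c}" by (rule finite_subset) (rule finite_atLeastAtMost_int)
  have "p \<ge> - int L * int k" if "p \<notin> S" for p
  proof (rule ccontr)
    assume "\<not> p \<ge> - int L * int k"
    then have "p < - int L * int k" by linarith
    with assms that show False unfolding fits_def by blast
  qed
  then have "{p. p < c \<and> p \<notin> S} \<subseteq> {- int L * int k..<c}" by (simp add: subset_iff)
  then show "finite {p. p < c \<and> p \<notin> S}" by (rule finite_subset) (rule finite_atLeastLessThan_int)
qed

text \<open>A particle in column \<open>c >= 0\<close> counts \<open>c + 1\<close> and a hole in
  column \<open>c < 0\<close> counts \<open>- (c + 1)\<close>: one potential, measured against the
  empty tuple. Hence a move down lowers the total by one, also across the border between columns
  \<open>- 1\<close> and \<open>0\<close>.\<close>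

lemma psize_dn:
  assumes k: "k > 0" and S: "fits k L N S" and dn: "can_dn k p S"
  shows "psize k S = psize k (dn k p S) + 1"
proof -
  let ?K = "int k" and ?B = "S - {p + int k}"
  define P where "P S = (\<Sum>p\<in>{p \<in> S. p \<ge> 0}. nat (p div int k + 1))" for S
  define H where "H S = (\<Sum>p\<in>{p. p < 0 \<and> p \<notin> S}. nat (- (p div int k) - 1))" for S
  have K: "?K > 0" using k by simp
  have sgn: "q \<ge> 0 \<longleftrightarrow> q div ?K \<ge> 0" for q using K by (simp add: pos_imp_zdiv_nonneg_iff)
  have fin: "finite {q \<in> ?B. q \<ge> 0}" "finite {q. q < 0 \<and> q \<notin> ?B}"
  proof -
    show "finite {q \<in> ?B. q \<ge> 0}"
      by (rule finite_subset[OF _ finite_fits_parts(1)[OF S, of 0]]) auto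
    have "finite (insert (p + ?K) {q. q < 0 \<and> q \<notin> S})" using finite_fits_parts(2)[OF S, of 0] by simp
    then show "finite {q. q < 0 \<and> q \<notin> ?B}" by (rule rev_finite_subset) auto
  qed
  have P: "P (insert q ?B) = P ?B + (if q div ?K \<ge> 0 then nat (q div ?K + 1) else 0)" if "q \<notin> ?B" for q
  proof -
    have "{x \<in> insert q ?B. x \<ge> 0} = (if q \<ge> 0 then insert q {x \<in> ?B. x \<ge> 0} else {x \<in> ?B. x \<ge> 0})" by auto
    then show ?thesis using fin(1) that unfolding P_def sgn[of q, symmetric] by (simp add: add.commute)
  qed
  have H: "H ?B = H (insert q ?B) + (if q div ?K \<ge> 0 then 0 else nat (- (q div ?K) - 1))" if "q \<notin> ?B" for q
  proof -
    have e: "{x. x < 0 \<and> x \<notin> ?B} = (if q \<ge> 0 then {x. x < 0 \<and> x \<notin> insert q ?B} else insert q {x. x < 0 \<and> x \<notin> insert q ?B})"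
      using that by auto
    have "finite {x. x < 0 \<and> x \<notin> insert q ?B}" by (rule finite_subset[OF _ fin(2)]) auto
    then show ?thesis unfolding H_def e sgn[of q, symmetric] by (simp add: add.commute)
  qed
  have nin: "p \<notin> ?B" "p + ?K \<notin> ?B" using dn by (auto simp: can_dn_def)
  have ins: "S = insert (p + ?K) ?B" "dn k p S = insert p ?B" using dn by (auto simp: can_dn_def dn_def)
  have sh: "(p + ?K) div ?K = p div ?K + 1" using K by simp
  have "P (insert (p + ?K) ?B) + H (insert (p + ?K) ?B) = P (insert p ?B) + H (insert p ?B) + 1"
    using P[OF nin(1)] P[OF nin(2)] H[OF nin(1)] H[OF nin(2)] unfolding sh
    by (cases "p div ?K \<ge> 0"; cases "p div ?K + 1 \<ge> 0") simp_all
  then show ?thesis unfolding psize_def ins(2) P_def[symmetric] H_def[symmetric] using ins(1) by metis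
qed

text \<open>A single hole or particle violating these bounds would already contribute more than
  \<open>n\<close>. This leaves finitely many states up to each size.\<close>

lemma psize_level:
  assumes k: "k > 0" and S: "fits k L N S" and n: "psize k S \<le> n"
  shows "fits k (n + 1) n S"
  unfolding fits_def mem_window[OF k]
proof (intro conjI allI impI; rule ccontr)
  note fin = finite_fits_parts[OF S, of 0]
  fix p :: int assume p: "p div int k < - int (n + 1)" "p \<notin> S"
  have "p < 0" using p(1) pos_imp_zdiv_nonneg_iff[of "int k" p] k by (cases "p < 0") auto
  then have "nat (- (p div int k) - 1) \<le> (\<Sum>p\<in>{p. p < 0 \<and> p \<notin> S}. nat (- (p div int k) - 1))"
    using p(2) fin by (intro member_le_sum) auto
  then show False using p(1) n by (simp add: psize_def)
next
  note fin = finite_fits_parts[OF S, of 0]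
  fix p :: int assume p: "p div int k > int n" "\<not> p \<notin> S"
  have "p \<ge> 0" using p(1) pos_imp_zdiv_nonneg_iff[of "int k" p] k by (cases "p < 0") auto
  then have "nat (p div int k + 1) \<le> (\<Sum>p\<in>{p \<in> S. p \<ge> 0}. nat (p div int k + 1))"
    using p(2) fin by (intro member_le_sum) auto
  then show False using p(1) n by (simp add: psize_def)
qed

lemma moves_mayas:
  assumes k: "k > 0"
  shows "moves (mayas k) (psize k) k"
proof -
  interpret graded_index "mayas k" "psize k"
  proof
    fix n
    have "finite {S. fits k (n + 1) n S}"
      using bij_betw_finite[OF bij_row_of[OF k, of "n + 1" n]] finite_rows by blast
    moreover have "{S \<in> mayas k. psize k S \<le> n} \<subseteq> {S. fits k (n + 1) n S}"
      using mayas_fits[OF k] psize_level[OF k] by blast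
    ultimately show "finite {S \<in> mayas k. psize k S \<le> n}" by (rule rev_finite_subset)
  qed
  show ?thesis
  proof
    show "k > 0" by (rule k)
    show "S \<in> mayas k \<Longrightarrow> can_up k p S \<Longrightarrow> up k p S \<in> mayas k" for S p by (rule mayas_moves(1)[OF k])
    show "S \<in> mayas k \<Longrightarrow> can_dn k p S \<Longrightarrow> dn k p S \<in> mayas k" for S p by (rule mayas_moves(2)[OF k])
    show "S \<in> mayas k \<Longrightarrow> \<exists>r. fits k r r S" for S by (rule mayas_fits[OF k])
    show "gap S (dn k p S) \<le> 1" if "S \<in> mayas k" "can_dn k p S" for S p
      using mayas_fits[OF k that(1)] psize_dn[OF k _ that(2)] by (auto simp: gap_def)
  qed
qed

section \<open>The inversion statistic\<close>

definition inv_rel :: "nat \<Rightarrow> int \<Rightarrow> int \<Rightarrow> bool" where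
  "inv_rel k p q \<longleftrightarrow> p mod int k < q mod int k \<and> q div int k < p div int k"

definition inversions :: "nat \<Rightarrow> int set \<Rightarrow> (int \<times> int) set" where
  "inversions k A = {(p, q) \<in> A \<times> A. inv_rel k p q}"

text \<open>The cut at column \<open>- L\<close> makes the count finite; it corresponds to using
  \<open>L\<close> parts in \<open>N_stat\<close>.\<close>

definition num_inv :: "nat \<Rightarrow> nat \<Rightarrow> int set \<Rightarrow> nat" where
  "num_inv k L S = card (inversions k {p \<in> S. p \<ge> - int L * int k})"

lemma card_inversions_insert:
  assumes "finite B" "x \<notin> B"
  shows "card (inversions k (insert x B)) =
    card (inversions k B) + (card {q \<in> B. inv_rel k x q} + card {q \<in> B. inv_rel k q x})"
proof -
  have e: "inversions k (insert x B) = inversions k B \<union>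
      (Pair x ` {q \<in> B. inv_rel k x q} \<union> (\<lambda>q. (q, x)) ` {q \<in> B. inv_rel k q x})"
    by (auto simp: inversions_def inv_rel_def)
  have fin: "finite (inversions k B)"
    by (rule finite_subset[of _ "B \<times> B"]) (use assms in \<open>auto simp: inversions_def\<close>)
  have "card (Pair x ` {q \<in> B. inv_rel k x q} \<union> (\<lambda>q. (q, x)) ` {q \<in> B. inv_rel k q x}) =
      card {q \<in> B. inv_rel k x q} + card {q \<in> B. inv_rel k q x}"
    using assms by (subst card_Un_disjoint) (auto simp: card_image inj_on_def)
  then show ?thesis
    unfolding e using assms fin by (subst card_Un_disjoint) (auto simp: inversions_def)
qed

text \<open>Jumping one column to the right, a particle gains an inversion with each larger colour
  in the column it leaves and loses one with each smaller colour in the column it enters.\<close>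

lemma num_inv_up:
  assumes k: "k > 0" and S: "fits k L N S" and up: "can_up k p S" and p: "p \<ge> - int L * int k"
  shows "int (num_inv k L (up k p S)) = int (num_inv k L S) + int (same k p S) - int (wrap k p S)"
proof -
  let ?K = "int k" and ?lo = "- int L * int k"
  define B where "B = {q \<in> S. q \<ge> ?lo} - {p}"
  have K: "?K > 0" using k by simp
  have finB: "finite B" using finite_fits_parts(1)[OF S, of ?lo] by (simp add: B_def)
  have 1: "{q \<in> S. q \<ge> ?lo} = insert p B" "{q \<in> up k p S. q \<ge> ?lo} = insert (p + ?K) B"
    using up p K by (auto simp: B_def can_up_def up_def)
  have nin: "p \<notin> B" "p + ?K \<notin> B" using up by (auto simp: B_def can_up_def)
  have dm: "(p + ?K) div ?K = p div ?K + 1" "(p + ?K) mod ?K = p mod ?K" using K by simp_all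
  have lex: "q < q' \<longleftrightarrow> q div ?K < q' div ?K \<or> (q div ?K = q' div ?K \<and> q mod ?K < q' mod ?K)" for q q'
  proof -
    have "q div ?K < q' div ?K \<Longrightarrow> q < q'" using zdiv_mono1[of q' q ?K] K by (meson not_le)
    moreover have "q < q' \<Longrightarrow> q div ?K \<le> q' div ?K" using zdiv_mono1[of q q' ?K] K by simp
    moreover have "q div ?K = q' div ?K \<Longrightarrow> q < q' \<longleftrightarrow> q mod ?K < q' mod ?K"
      by (metis div_mult_mod_eq add_less_cancel_left)
    ultimately show ?thesis by (meson less_le)
  qed
  have col: "q \<in> col_rest k p \<longleftrightarrow> p div ?K = q div ?K \<and> p mod ?K < q mod ?K" for q
    unfolding col_rest_def greaterThanLessThan_iff int_less_mult_iff_div[OF K] lex[of p q] by auto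
  have nxt: "q \<in> next_col k p \<longleftrightarrow> q div ?K = p div ?K + 1 \<and> q mod ?K < p mod ?K" for q
    using int_less_mult_iff_div[OF K, of q "p div ?K"] lex[of q "p + ?K"] dm
    by (auto simp: next_col_def)
  have lo: "q \<ge> ?lo" if "q div ?K \<ge> p div ?K" for q
    using that p mem_window(1)[OF k, of q L] mem_window(1)[OF k, of p L] by auto
  have r1: "{q \<in> B. inv_rel k (p + ?K) q} = {q \<in> B. inv_rel k p q} \<union> (S \<inter> col_rest k p)"
    using lo by (auto simp: inv_rel_def dm col B_def)
  have r2: "{q \<in> B. inv_rel k q p} = {q \<in> B. inv_rel k q (p + ?K)} \<union> (S \<inter> next_col k p)"
    using lo by (auto simp: inv_rel_def dm nxt B_def)
  have finS: "finite (S \<inter> col_rest k p)" "finite (S \<inter> next_col k p)"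
    by (simp_all add: col_rest_def next_col_def)
  have c1: "card {q \<in> B. inv_rel k (p + ?K) q} = card {q \<in> B. inv_rel k p q} + same k p S"
    unfolding r1 same_def
    by (rule card_Un_disjoint) (use finB finS in \<open>auto simp: inv_rel_def col\<close>)
  have c2: "card {q \<in> B. inv_rel k q p} = card {q \<in> B. inv_rel k q (p + ?K)} + wrap k p S"
    unfolding r2 wrap_def
    by (rule card_Un_disjoint) (use finB finS in \<open>auto simp: inv_rel_def dm nxt\<close>)
  show ?thesis
    unfolding num_inv_def 1 card_inversions_insert[OF finB nin(1)] card_inversions_insert[OF finB nin(2)]
      c1 c2 by simp
qed

text \<open>The particles in columns from \<open>- L\<close> on are the first \<open>L\<close> parts
  of each colour, and an inversion is a smaller colour standing in a larger column, which is what
  \<open>N_stat\<close> counts.\<close>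

lemma N_stat_num_inv:
  assumes k: "k > 0" and \<alpha>: "\<alpha> \<in> partition_tuples k" and L: "has_parts k \<alpha> L"
  shows "N_stat k L \<alpha> = num_inv k L (maya k \<alpha>)"
proof -
  let ?ab = "{(a, b). 1 \<le> a \<and> a < b \<and> b \<le> k}"
  let ?c = "\<lambda>a j. int (part (\<alpha> a) j) - int j"
  let ?ij = "\<lambda>(a, b). {(i, j) \<in> {1..L} \<times> {1..L}. ?c a j > ?c b i}"
  \<comment> \<open>In the pair \<open>(i, j)\<close> the index \<open>j\<close> belongs to the
    smaller colour \<open>a\<close>, hence the crossing.\<close>
  let ?f = "\<lambda>((a, b), (i, j)). (pc k (?c a j) a, pc k (?c b i) b)"
  have finab: "finite ?ab" by (rule finite_subset[of _ "{1..k} \<times> {1..k}"]) auto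
  have "N_stat k L \<alpha> = (\<Sum>z\<in>?ab. card (?ij z))"
    unfolding N_stat_def by (rule sum.cong) auto
  also have "\<dots> = card (Sigma ?ab ?ij)"
    by (rule card_SigmaI[symmetric]) (use finab in \<open>auto intro: finite_subset[of _ "{1..L} \<times> {1..L}"]\<close>)
  also have "\<dots> = num_inv k L (maya k \<alpha>)"
    unfolding num_inv_def
  proof (rule bij_betw_same_card)
    have cinj: "?c a j = ?c a j' \<longleftrightarrow> j = j'" if "a \<in> {1..k}" "j \<ge> 1" "j' \<ge> 1" for a j j'
      using content_inj[OF tuple_partition[OF \<alpha> that(1)], of "j - 1" "j' - 1"] that(2,3)
      by (auto simp: part_def of_nat_diff)
    have pceq: "pc k C a = pc k D b \<longleftrightarrow> C = D \<and> a = b" if "a \<in> {1..k}" "b \<in> {1..k}" for C D a b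
      using pc_div[OF that(1), of C] pc_div[OF that(2), of D] by metis
    have cmaya: "?c a j \<in> maya1 (\<alpha> a)" "?c a j \<ge> - int L" if "j \<in> {1..L}" for a j
    proof -
      have "?c a j = int (\<alpha> a (j - 1)) - int (j - 1) - 1" using that by (simp add: part_def of_nat_diff)
      then show "?c a j \<in> maya1 (\<alpha> a)" unfolding maya1_def by (rule range_eqI)
      show "?c a j \<ge> - int L" using that by simp
    qed
    have surj: "\<exists>j\<in>{1..L}. C = ?c a j" if a: "a \<in> {1..k}" and C: "C \<in> maya1 (\<alpha> a)" "C \<ge> - int L" for a C
    proof -
      have "lab k (maya k \<alpha>) C a = 1" using C(1) pc_maya[OF a] by (simp add: lab_apply[OF a])
      then have "boundary_label k L \<alpha> C a = 1" using boundary_label_maya[OF \<alpha> L C(2)] by simp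
      then show ?thesis using a by (auto simp: boundary_label_def split: if_splits)
    qed
    have pos: "pc k C a \<ge> - int L * int k \<longleftrightarrow> C \<ge> - int L" if "a \<in> {1..k}" for C a
      using mem_window(1)[OF k, of "pc k C a" L] pc_div(1)[OF that, of C] by auto
    have md: "pc k C a mod int k = int a - 1" if "a \<in> {1..k}" for C a
      using pc_div(2)[OF that, of C] k by (metis add_diff_cancel_right' int_nat_eq of_nat_0_less_iff of_nat_1 of_nat_add pos_mod_sign)
    have rel: "inv_rel k (pc k C a) (pc k D b) \<longleftrightarrow> a < b \<and> D < C" if "a \<in> {1..k}" "b \<in> {1..k}" for C D a b
      using that by (simp add: inv_rel_def md pc_div(1))
    show "bij_betw ?f (Sigma ?ab ?ij) (inversions k {p \<in> maya k \<alpha>. p \<ge> - int L * int k})"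
    proof (rule bij_betwI')
      fix z z' assume z: "z \<in> Sigma ?ab ?ij" and z': "z' \<in> Sigma ?ab ?ij"
      obtain a b i j a' b' i' j' where e: "z = ((a, b), (i, j))" "z' = ((a', b'), (i', j'))"
        by (metis surj_pair)
      have m: "a \<in> {1..k}" "b \<in> {1..k}" "a' \<in> {1..k}" "b' \<in> {1..k}" "i \<ge> 1" "j \<ge> 1" "i' \<ge> 1" "j' \<ge> 1"
        using z z' by (auto simp: e)
      show "?f z = ?f z' \<longleftrightarrow> z = z'"
        using cinj[of a j j'] cinj[of b i i'] m
        by (auto simp: e pceq[OF m(1,3)] pceq[OF m(2,4)])
    next
      fix z assume z: "z \<in> Sigma ?ab ?ij"
      obtain a b i j where e: "z = ((a, b), (i, j))" by (metis surj_pair)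
      have m: "a \<in> {1..k}" "b \<in> {1..k}" "i \<in> {1..L}" "j \<in> {1..L}" "a < b" "?c b i < ?c a j"
        using z by (auto simp: e)
      show "?f z \<in> inversions k {p \<in> maya k \<alpha>. p \<ge> - int L * int k}"
        using cmaya(1)[OF m(4), of a] cmaya(1)[OF m(3), of b] m
          pos[OF m(1), of "?c a j"] pos[OF m(2), of "?c b i"]
        by (simp add: e inversions_def pc_maya rel)
    next
      fix z assume "z \<in> inversions k {p \<in> maya k \<alpha>. p \<ge> - int L * int k}"
      then obtain p q where z: "z = (p, q)" and pq: "p \<in> maya k \<alpha>" "q \<in> maya k \<alpha>"
        "p \<ge> - int L * int k" "q \<ge> - int L * int k" "inv_rel k p q" by (auto simp: inversions_def)
      obtain C a where p: "p = pc k C a" and a: "a \<in> {1..k}" using pc_surj[OF k, of p] by metis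
      obtain D b where q: "q = pc k D b" and b: "b \<in> {1..k}" using pc_surj[OF k, of q] by metis
      obtain j where j: "j \<in> {1..L}" "C = ?c a j"
        using surj[OF a, of C] pq p pc_maya[OF a] pos[OF a] by auto
      obtain i where i: "i \<in> {1..L}" "D = ?c b i"
        using surj[OF b, of D] pq q pc_maya[OF b] pos[OF b] by auto
      have "a < b" "D < C" using pq(5) rel[OF a b] by (auto simp: p q)
      then have "((a, b), (i, j)) \<in> Sigma ?ab ?ij" "z = ?f ((a, b), (i, j))"
        using a b i j by (auto simp: z p q)
      then show "\<exists>w\<in>Sigma ?ab ?ij. z = ?f w" by blast
    qed
  qed
  finally show ?thesis .
qed

text \<open>Part \<open>L + 1\<close> is zero in each colour and lies to the left of the first
  \<open>L\<close> particles of every colour. This adds \<open>L\<close> per pair of colours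
  whatever the tuple, so differences of \<open>N_stat\<close> do not change with
  \<open>L\<close>.\<close>

lemma N_stat_Suc:
  assumes \<alpha>: "\<alpha> \<in> partition_tuples k" and L: "has_parts k \<alpha> L"
  shows "N_stat k (Suc L) \<alpha> = N_stat k L \<alpha> + L * card {(a, b). 1 \<le> a \<and> a < b \<and> b \<le> k}"
proof -
  let ?c = "\<lambda>a j. int (part (\<alpha> a) j) - int j"
  let ?ij = "\<lambda>L a b. {(i, j) \<in> {1..L} \<times> {1..L}. ?c a j > ?c b i}"
  have 1: "card (?ij (Suc L) a b) = card (?ij L a b) + L" if "1 \<le> a" "a < b" "b \<le> k" for a b
  proof -
    have ab: "a \<in> {1..k}" "b \<in> {1..k}" using that by auto
    have z: "part (\<alpha> a) (Suc L) = 0" "part (\<alpha> b) (Suc L) = 0"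
      using num_parts_le_iff[OF tuple_partition[OF \<alpha> ab(1)], of L]
        num_parts_le_iff[OF tuple_partition[OF \<alpha> ab(2)], of L] L ab
      by (auto simp: part_def has_parts_def)
    have "?ij (Suc L) a b = ?ij L a b \<union> Pair (Suc L) ` {1..L}"
    proof (intro equalityI subsetI)
      fix w assume "w \<in> ?ij (Suc L) a b"
      then obtain i j where w: "w = (i, j)" "i \<in> {1..Suc L}" "j \<in> {1..Suc L}" "?c a j > ?c b i" by auto
      have "j \<noteq> Suc L" using w z by (auto simp: le_Suc_eq)
      then have "j \<in> {1..L}" using w(3) by auto
      then show "w \<in> ?ij L a b \<union> Pair (Suc L) ` {1..L}" using w by (cases "i = Suc L") auto
    next
      fix w assume "w \<in> ?ij L a b \<union> Pair (Suc L) ` {1..L}"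
      then show "w \<in> ?ij (Suc L) a b" using z by auto
    qed
    moreover have "finite (?ij L a b)" by (rule finite_subset[of _ "{1..L} \<times> {1..L}"]) auto
    moreover have "?ij L a b \<inter> Pair (Suc L) ` {1..L} = {}" by auto
    ultimately show ?thesis by (simp add: card_Un_disjoint card_image inj_on_def)
  qed
  have "N_stat k (Suc L) \<alpha> = (\<Sum>z\<in>{(a, b). 1 \<le> a \<and> a < b \<and> b \<le> k}.
      (case z of (a, b) \<Rightarrow> card (?ij L a b)) + L)"
    unfolding N_stat_def by (rule sum.cong) (auto simp: 1[simplified])
  then show ?thesis by (simp add: N_stat_def sum.distrib mult.commute)
qed

lemma d_stat_eq:
  assumes k: "k > 0" and \<alpha>: "\<alpha> \<in> partition_tuples k" and \<beta>: "\<beta> \<in> partition_tuples k"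
    and L: "has_parts k \<alpha> L" "has_parts k \<beta> L"
  shows "d_stat k \<alpha> \<beta> = int (num_inv k L (maya k \<beta>)) - int (num_inv k L (maya k \<alpha>))"
proof -
  have "max_num_parts k \<alpha> \<beta> \<le> L" using L has_parts_max_iff[OF k] by simp
  then have "int (N_stat k L \<beta>) - int (N_stat k L \<alpha>) = d_stat k \<alpha> \<beta>"
  proof (induction L rule: dec_induct)
    case base
    then show ?case by (simp add: d_stat_def Let_def)
  next
    case (step L)
    then have "has_parts k \<alpha> L" "has_parts k \<beta> L" using has_parts_max_iff[OF k] by auto
    then show ?case using step by (simp add: N_stat_Suc[OF \<alpha>] N_stat_Suc[OF \<beta>])
  qed
  then show ?thesis using N_stat_num_inv[OF k] \<alpha> \<beta> L by simp
qed

text \<open>The arguments are swapped because the dual kernel at \<open>(i, j)\<close> has to carry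
  \<open>d\<close> from \<open>j\<close> to \<open>i\<close>.\<close>

definition dd :: "nat \<Rightarrow> int set \<Rightarrow> int set \<Rightarrow> int" where
  "dd k i j = d_stat k (inv_into (partition_tuples k) (maya k) j) (inv_into (partition_tuples k) (maya k) i)"

lemma dd_maya:
  assumes "k > 0" "\<alpha> \<in> partition_tuples k" "\<beta> \<in> partition_tuples k"
  shows "dd k (maya k \<alpha>) (maya k \<beta>) = d_stat k \<beta> \<alpha>"
  using bij_betw_imp_inj_on[OF bij_maya[OF assms(1)]] assms(2,3) by (simp add: dd_def)

lemma has_parts_mono: "has_parts k \<alpha> L \<Longrightarrow> L \<le> L' \<Longrightarrow> has_parts k \<alpha> L'"
  by (force simp: has_parts_def)

lemma moves_adj_mayas:
  assumes k: "k > 0"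
  shows "moves_adj (mayas k) (psize k) k (dd k)"
proof -
  interpret moves "mayas k" "psize k" k by (rule moves_mayas[OF k])
  have ex: "\<exists>L. has_parts k \<alpha> L" for \<alpha> using has_parts_max(1)[OF k] by blast
  show ?thesis
  proof
    fix i j l assume "i \<in> mayas k" "j \<in> mayas k" "l \<in> mayas k"
    then obtain \<alpha> \<beta> \<gamma> where e: "i = maya k \<alpha>" "j = maya k \<beta>" "l = maya k \<gamma>"
      and P: "\<alpha> \<in> partition_tuples k" "\<beta> \<in> partition_tuples k" "\<gamma> \<in> partition_tuples k"
      by (auto simp: mayas_def)
    obtain La Lb Lc where "has_parts k \<alpha> La" "has_parts k \<beta> Lb" "has_parts k \<gamma> Lc" using ex by metis
    then have "has_parts k \<alpha> (La + Lb + Lc)" "has_parts k \<beta> (La + Lb + Lc)" "has_parts k \<gamma> (La + Lb + Lc)"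
      by (auto intro: has_parts_mono)
    then show "dd k i j = dd k i l + dd k l j"
      using P by (simp add: e dd_maya[OF k] d_stat_eq[OF k, where L = "La + Lb + Lc"])
  next
    fix i p assume i: "i \<in> mayas k" and up: "can_up k p i"
    obtain \<alpha> where \<alpha>: "\<alpha> \<in> partition_tuples k" "i = maya k \<alpha>" using i by (auto simp: mayas_def)
    obtain \<beta> where \<beta>: "\<beta> \<in> partition_tuples k" "up k p i = maya k \<beta>"
      using up_closed[OF i up] by (auto simp: mayas_def)
    obtain La Lb where L0: "has_parts k \<alpha> La" "has_parts k \<beta> Lb" using ex by metis
    obtain r where r: "fits k r r i" using ex_fits[OF i] by auto
    \<comment> \<open>Large enough for the parts of both tuples, for the window of \<open>i\<close>
      and, through \<open>nat (- p)\<close>, for \<open>p\<close> to lie above the cut at column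
      \<open>- L\<close>.\<close>
    define L where "L = La + Lb + r + nat (- p)"
    have L: "has_parts k \<alpha> L" "has_parts k \<beta> L" using L0 by (auto simp: L_def intro: has_parts_mono)
    have f: "fits k L L i" by (rule fits_mono[OF r]) (auto simp: L_def)
    have "int L \<le> int L * int k" using k by (simp add: mult_le_cancel_left1)
    moreover have "- p \<le> int L" by (simp add: L_def)
    ultimately have p: "p \<ge> - int L * int k" by simp
    show "dd k i (up k p i) = int (wrap k p i) - int (same k p i)"
      using num_inv_up[OF k f up p] d_stat_eq[OF k \<beta>(1) \<alpha>(1) L(2,1)] \<alpha> \<beta>
      by (simp add: dd_maya[OF k])
  qed
qed

section \<open>The Cauchy identity\<close>

lemma ord_ge_vars: "ord_ge 1 (x_var i)" "ord_ge 1 (y_var i)" "ord_ge 1 (w_var i)" "ord_ge 1 (z_var i)"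
  by (auto simp: ord_ge_def x_var_def y_var_def w_var_def z_var_def mfps_var_def)

section \<open>The factor Omega\<close>

lemma prod_split:
  fixes f :: "nat \<Rightarrow> 'a :: comm_monoid_mult"
  shows "(\<Prod>r=1..n + m. f r) = (\<Prod>i=1..n. f i) * (\<Prod>j=1..m. f (n + j))"
  by (induction m) (simp_all add: mult.assoc)

lemma qfac_eq: "k > 0 \<Longrightarrow> qfac s k = (\<Prod>l = 0..k - 1. 1 + s * tpow (int l))"
  unfolding qfac_def by (rule prod.cong) auto

lemma prod_qfac:
  assumes "k > 0"
  shows "(\<Prod>i\<in>A. \<Prod>j\<in>B. qfac (s i j) k) = (\<Prod>l = 0..k - 1. \<Prod>i\<in>A. \<Prod>j\<in>B. 1 + s i j * tpow (int l))"
proof -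
  have "(\<Prod>i\<in>A. \<Prod>j\<in>B. qfac (s i j) k) = (\<Prod>i\<in>A. \<Prod>l = 0..k - 1. \<Prod>j\<in>B. 1 + s i j * tpow (int l))"
    unfolding qfac_eq[OF assms] by (intro prod.cong refl prod.swap)
  also have "\<dots> = (\<Prod>l = 0..k - 1. \<Prod>i\<in>A. \<Prod>j\<in>B. 1 + s i j * tpow (int l))"
    by (rule prod.swap)
  finally show ?thesis .
qed

lemma units_prod:
  fixes f :: "'i \<Rightarrow> ('v, 'a :: comm_ring_1) mfps"
  assumes "\<And>i. i \<in> A \<Longrightarrow> \<exists>g. f i * g = 1"
  shows "(\<Prod>i\<in>A. f i) * (\<Prod>i\<in>A. inverse (f i)) = 1"
proof -
  have "f i * inverse (f i) = 1" if "i \<in> A" for i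
    using assms[OF that] mfps_inverse_unique by metis
  then show ?thesis unfolding prod.distrib[symmetric] by simp
qed

lemma unit_prod:
  fixes f :: "'i \<Rightarrow> ('v, 'a :: comm_ring_1) mfps"
  assumes "\<And>i. i \<in> A \<Longrightarrow> \<exists>g. f i * g = 1"
  shows "\<exists>g. (\<Prod>i\<in>A. f i) * g = 1"
  by (rule exI, rule units_prod, rule assms)

lemma unit_mult:
  fixes f f' :: "('v, 'a :: comm_ring_1) mfps"
  assumes "\<exists>g. f * g = 1" "\<exists>g. f' * g = 1"
  shows "\<exists>g. f * f' * g = 1"
proof -
  obtain g where g: "f * g = 1" using assms(1) ..
  obtain g' where g': "f' * g' = 1" using assms(2) ..
  have "f * f' * (g * g') = (f * g) * (f' * g')" by (simp only: mult_ac)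
  then have "f * f' * (g * g') = 1" by (simp only: g g' mult_1_right)
  then show ?thesis ..
qed

lemma unit_factor:
  fixes a b :: series
  assumes "ord_ge 1 a"
  shows "\<exists>g. (1 + a * b * tpow c) * g = 1"
proof (rule one_plus_unit)
  have "ord_ge (1 + 0) (a * (b * tpow c))" using assms by (rule ord_ge_mult) simp
  then show "ord_ge 1 (a * b * tpow c)" by (simp add: mult.assoc)
qed

text \<open>Together with \<open>fac_den\<close> a table of exchange scalars: a row and a dual row
  of the same type give a numerator, of different types a denominator. Rows beyond \<open>n\<close>
  and dual rows beyond \<open>p\<close> are purple.\<close>

definition fac_num :: "nat \<Rightarrow> nat \<Rightarrow> nat \<Rightarrow> nat \<Rightarrow> nat \<Rightarrow> series" where
  "fac_num k n p r s =
     (if r \<le> n then if s \<le> p then qfac (- (x_var r * w_var s)) k else 1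
      else if s \<le> p then 1 else qfac (- (y_var (r - n) * z_var (s - p))) k)"

definition fac_den :: "nat \<Rightarrow> nat \<Rightarrow> nat \<Rightarrow> nat \<Rightarrow> nat \<Rightarrow> series" where
  "fac_den k n p r s =
     (if r \<le> n then if s \<le> p then 1 else qfac (x_var r * z_var (s - p)) k
      else if s \<le> p then qfac (y_var (r - n) * w_var s) k else 1)"

text \<open>Each factor of the denominator has constant term 1 and is a unit; this gives the
  division in \<open>Omega\<close> its usual meaning.\<close>

lemma Omega_eq:
  assumes k: "k > 0"
  shows "(\<Prod>r=1..n + m. \<Prod>s=1..p + q. fac_den k n p r s) * Omega k n m p q =
    (\<Prod>r=1..n + m. \<Prod>s=1..p + q. fac_num k n p r s)"
proof -
  let ?N = "\<lambda>l. (\<Prod>i = 1..n. \<Prod>\<alpha> = 1..p. 1 - x_var i * w_var \<alpha> * tpow (int l)) *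
         (\<Prod>j = 1..m. \<Prod>\<beta> = 1..q. 1 - y_var j * z_var \<beta> * tpow (int l))"
  let ?D = "\<lambda>l. (\<Prod>j = 1..m. \<Prod>\<alpha> = 1..p. 1 + y_var j * w_var \<alpha> * tpow (int l)) *
         (\<Prod>i = 1..n. \<Prod>\<beta> = 1..q. 1 + x_var i * z_var \<beta> * tpow (int l))"
  have N: "(\<Prod>r=1..n + m. \<Prod>s=1..p + q. fac_num k n p r s) = (\<Prod>l = 0..k - 1. ?N l)"
  proof -
    have "(\<Prod>r=1..n + m. \<Prod>s=1..p + q. fac_num k n p r s) =
      (\<Prod>i=1..n. \<Prod>s=1..p. qfac (- (x_var i * w_var s)) k) *
      (\<Prod>j=1..m. \<Prod>t=1..q. qfac (- (y_var j * z_var t)) k)"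
      unfolding prod_split
      by (intro arg_cong2[where f = "(*)"] prod.cong refl) (auto simp: fac_num_def)
    then show ?thesis by (simp add: prod_qfac[OF k] prod.distrib)
  qed
  have D: "(\<Prod>r=1..n + m. \<Prod>s=1..p + q. fac_den k n p r s) = (\<Prod>l = 0..k - 1. ?D l)"
  proof -
    have "(\<Prod>r=1..n + m. \<Prod>s=1..p + q. fac_den k n p r s) =
      (\<Prod>i=1..n. \<Prod>t=1..q. qfac (x_var i * z_var t) k) *
      (\<Prod>j=1..m. \<Prod>s=1..p. qfac (y_var j * w_var s) k)"
      unfolding prod_split
      by (intro arg_cong2[where f = "(*)"] prod.cong refl) (auto simp: fac_den_def)
    then show ?thesis by (simp add: prod_qfac[OF k] prod.distrib mult.commute)
  qed
  have "\<exists>g. ?D l * g = 1" for l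
    by (intro unit_mult unit_prod unit_factor ord_ge_vars)
  then have inv: "(\<Prod>l = 0..k - 1. ?D l) * (\<Prod>l = 0..k - 1. inverse (?D l)) = 1"
    by (rule units_prod)
  have "Omega k n m p q = (\<Prod>l = 0..k - 1. ?N l) * (\<Prod>l = 0..k - 1. inverse (?D l))"
    unfolding Omega_def divide_mfps_def prod.distrib ..
  then show ?thesis
    unfolding N D by (simp only: mult.left_commute[of "\<Prod>l = 0..k - 1. ?D l"] inv mult_1_right)
qed

lemma den_unit:
  "\<exists>g. (\<Prod>r=1..n + m. \<Prod>s=1..p + q. fac_den k n p r s) * g = 1"
proof (intro unit_prod)
  fix r s
  show "\<exists>g. fac_den k n p r s * g = 1"
    unfolding fac_den_def qfac_def by (auto intro!: unit_prod unit_factor ord_ge_vars[simplified])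
qed

text \<open>The window chosen in \<open>LS\<close> contains both boundary states, and the kernel
  product is the same for all such windows.\<close>

lemma LS_eq_kprod:
  assumes k: "k > 0" and \<alpha>: "\<alpha> \<in> partition_tuples k" and \<beta>: "\<beta> \<in> partition_tuples k"
    and x: "\<And>i. ord_ge 1 (x i)" and y: "\<And>j. ord_ge 1 (y j)"
  shows "LS k n m x y \<alpha> \<beta> =
    moves.kprod (mayas k) (moves.row_kernel (mayas k) k n x y) (n + m) (maya k \<alpha>) (maya k \<beta>)"
proof -
  interpret moves "mayas k" "psize k" k by (rule moves_mayas[OF k])
  define l N where "l = max_num_parts k \<alpha> \<beta>" and "N = max_part k \<alpha> \<beta>"
  note hp = has_parts_max[OF k, where \<alpha> = \<alpha> and \<beta> = \<beta>, folded l_def]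
  have row: "(\<lambda>C\<in>{- int l..int N}. boundary_label k l \<gamma> C) = row_of k l N (maya k \<gamma>)"
    if "\<gamma> \<in> partition_tuples k" "has_parts k \<gamma> l" for \<gamma>
    unfolding row_of_def by (intro restrict_ext boundary_label_maya[OF that]) auto
  have "LS k n m x y \<alpha> \<beta> = psum (rows k l N) (\<lambda>r. row_sum k l N (vertex_weight k n x y (Suc r))) (n + m)
      (row_of k l N (maya k \<beta>)) (row_of k l N (maya k \<alpha>))"
    unfolding LS_def l_def[symmetric] N_def[symmetric]
    by (rule partition_function_psum[OF row[OF \<beta> hp(2), symmetric] row[OF \<alpha> hp(1), symmetric]])
  also have "\<dots> = kprod (row_kernel n x y) (n + m) (maya k \<alpha>) (maya k \<beta>)"
  proof (rule psum_rows)
    show "band (row_kernel n x y r)" for r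
      using x y by (auto simp: row_kernel_def band_Uk[simplified] band_Vk[simplified])
    show "maya k \<beta> \<in> mayas k" using \<beta> by (auto simp: mayas_def)
    show "fits k l N (maya k \<beta>)" "fits k l N (maya k \<alpha>)"
      by (intro fits_maya k \<alpha> \<beta> hp; simp add: N_def max_part_ge)+
  qed
  finally show ?thesis .
qed

theorem theorem6p13:
  fixes k n m p q :: nat and \<mu> \<nu> :: ptuple
  assumes "k \<ge> 1" and "n \<ge> 1" and "m \<ge> 1" and "p \<ge> 1" and "q \<ge> 1"
    and "\<mu> \<in> partition_tuples k" and "\<nu> \<in> partition_tuples k"
  shows
    "mfps_summable
       (\<lambda>\<rho>. tpow (d_stat k \<mu> \<rho>) * LS k n m x_var y_var \<nu> \<rho> * LS k p q w_var z_var \<mu> \<rho>)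
       (partition_tuples k) \<and>
     mfps_summable
       (\<lambda>\<rho>. tpow (d_stat k \<rho> \<nu>) * LS k n m x_var y_var \<rho> \<mu> * LS k p q w_var z_var \<rho> \<nu>)
       (partition_tuples k) \<and>
     mfps_sum
       (\<lambda>\<rho>. tpow (d_stat k \<mu> \<rho>) * LS k n m x_var y_var \<nu> \<rho> * LS k p q w_var z_var \<mu> \<rho>)
       (partition_tuples k) =
     Omega k n m p q *
     mfps_sum
       (\<lambda>\<rho>. tpow (d_stat k \<rho> \<nu>) * LS k n m x_var y_var \<rho> \<mu> * LS k p q w_var z_var \<rho> \<nu>)
       (partition_tuples k)"
proof -
  have k: "k > 0" using assms(1) by simp
  note \<mu> = assms(6) and \<nu> = assms(7)
  interpret moves_adj "mayas k" "psize k" k "dd k" by (rule moves_adj_mayas[OF k])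
  let ?xy = "row_kernel n x_var y_var" and ?wz = "row_kernel p w_var z_var"
  define A where "A = kprod ?xy (n + m)"
  define B where "B = dual (kprod ?wz (p + q))"
  let ?i = "maya k \<nu>" and ?j = "maya k \<mu>"
  let ?F = "\<lambda>\<rho>. tpow (d_stat k \<mu> \<rho>) * LS k n m x_var y_var \<nu> \<rho> * LS k p q w_var z_var \<mu> \<rho>"
  let ?G = "\<lambda>\<rho>. tpow (d_stat k \<rho> \<nu>) * LS k n m x_var y_var \<rho> \<mu> * LS k p q w_var z_var \<rho> \<nu>"
  have bxy: "band (?xy r)" and bwz: "band (?wz r)" for r
    by (auto simp: row_kernel_def intro!: band_Uk band_Vk ord_ge_vars)
  have bA: "band A" unfolding A_def by (rule band_kprod) (rule bxy)
  have bB: "band B" unfolding B_def by (intro band_adj band_kprod bwz)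
  note LS = LS_eq_kprod[OF k _ _ ord_ge_vars(1,2)] LS_eq_kprod[OF k _ _ ord_ge_vars(3,4)]
  \<comment> \<open>The shape \<nu> is the first index of \<open>A\<close>, and t^d is the twist
    inside \<open>B\<close>, which turns the left sum into an entry of \<open>A \<star> B\<close>.
    On the right the twist sits between \<nu> and \<rho>, giving \<open>B \<star> A\<close>.\<close>
  have F: "?F \<rho> = A ?i (maya k \<rho>) * B (maya k \<rho>) ?j" if "\<rho> \<in> partition_tuples k" for \<rho>
    using that \<mu> \<nu> by (simp add: A_def B_def LS adj_def dd_maya[OF k] mult_ac)
  have G: "?G \<rho> = B ?i (maya k \<rho>) * A (maya k \<rho>) ?j" if "\<rho> \<in> partition_tuples k" for \<rho>
    using that \<mu> \<nu> by (simp add: A_def B_def LS adj_def dd_maya[OF k] mult_ac)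
  note bij = bij_maya[OF k]
  have ij: "?i \<in> mayas k" "?j \<in> mayas k" using \<mu> \<nu> by (auto simp: mayas_def)
  have sF: "mfps_summable ?F (partition_tuples k)"
    using mfps_summable_reindex[OF bij summable_kterms[OF bA bB, of ?i ?j]] F
    by (simp cong: mfps_summable_cong)
  have sG: "mfps_summable ?G (partition_tuples k)"
    using mfps_summable_reindex[OF bij summable_kterms[OF bB bA, of ?i ?j]] G
    by (simp cong: mfps_summable_cong)
  have "mfps_sum ?F (partition_tuples k) = mfps_sum (\<lambda>\<rho>. A ?i (maya k \<rho>) * B (maya k \<rho>) ?j) (partition_tuples k)"
    by (rule mfps_sum_cong[OF F])
  also have "\<dots> = kmult A B ?i ?j"
    using mfps_sum_reindex[OF bij, of "\<lambda>l. A ?i l * B l ?j"] ij by (simp add: kmult_def)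
  finally have sumF: "mfps_sum ?F (partition_tuples k) = kmult A B ?i ?j" .
  have "mfps_sum ?G (partition_tuples k) = mfps_sum (\<lambda>\<rho>. B ?i (maya k \<rho>) * A (maya k \<rho>) ?j) (partition_tuples k)"
    by (rule mfps_sum_cong[OF G])
  also have "\<dots> = kmult B A ?i ?j"
    using mfps_sum_reindex[OF bij, of "\<lambda>l. B ?i l * A l ?j"] ij by (simp add: kmult_def)
  finally have sumG: "mfps_sum ?G (partition_tuples k) = kmult B A ?i ?j" .
  let ?num = "\<Prod>r=1..n + m. \<Prod>s=1..p + q. fac_num k n p r s"
  let ?den = "\<Prod>r=1..n + m. \<Prod>s=1..p + q. fac_den k n p r s"
  have "exch ?num ?den A B"
    unfolding A_def B_def
  proof (rule exch_kprod)
    show "band (?xy r)" "band (?wz r)" for r by (rule bxy bwz)+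
    fix r s
    note o = ord_ge_vars
    show "exch (fac_num k n p r s) (fac_den k n p r s) (?xy r) (dual (?wz s))"
    proof (cases "r \<le> n"; cases "s \<le> p")
      assume "r \<le> n" "s \<le> p"
      then show ?thesis
        using exch_U_U[OF o(1,3)] by (simp add: fac_num_def fac_den_def row_kernel_def)
    next
      \<comment> \<open>The dual purple row with \<open>z\<close> is treated as the inverse of the
        dual white row with \<open>- z\<close>; the sign of \<open>- z\<close> cancels the one in
        the scalar of \<open>exch_U_U\<close>.\<close>
      assume "r \<le> n" "\<not> s \<le> p"
      then show ?thesis
        using exch_dual_inverse[OF o(4) band_Uk[OF o(1)] exch_U_U[OF o(1) ord_ge_uminus[OF o(4)]]]
        by (simp add: fac_num_def fac_den_def row_kernel_def)
    next
      assume "\<not> r \<le> n" "s \<le> p"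
      then show ?thesis
        using exch_V_U[OF o(2,3)] by (simp add: fac_num_def fac_den_def row_kernel_def)
    next
      assume "\<not> r \<le> n" "\<not> s \<le> p"
      then show ?thesis
        using exch_dual_inverse[OF o(4) band_Vk[OF o(2)] exch_V_U[OF o(2) ord_ge_uminus[OF o(4)]]]
        by (simp add: fac_num_def fac_den_def row_kernel_def)
    qed
  qed
  then have "smult ?den (kmult A B) ?i ?j = smult ?num (kmult B A) ?i ?j" by (simp only: exch_def)
  then have e: "?den * kmult A B ?i ?j = ?den * (Omega k n m p q * kmult B A ?i ?j)"
    unfolding smult_def Omega_eq[OF k, symmetric] by (simp only: mult.assoc)
  obtain g where g: "?den * g = 1" using den_unit by blast
  have gd: "g * (?den * a) = a" for a
    using g by (simp only: mult.assoc[symmetric] mult.commute[of g] mult_1_left)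
  have "kmult A B ?i ?j = g * (?den * kmult A B ?i ?j)"
    by (rule gd[symmetric])
  also have "\<dots> = Omega k n m p q * kmult B A ?i ?j"
    unfolding e by (rule gd)
  finally show ?thesis using sF sG sumF sumG by simp
qed

end
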